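(* Let $\underline w_0$ be an arbitrary reduced expression of the longest element $w_0\in S_n$, let $s_{\underline w_0}$ be the seed corresponding to the pseudoline arrangement $\operatorname{pa}(\underline w_0)$, with toric chart $\mathcal X_{s_{\underline w_0}}$, and let $W$ be the superpotential. With $N=\binom n2$, $$\mathcal S_{\underline w_0}=\{x\in\mathbb R^{N+n-1}\mid (W|_{\mathcal X_{s_{\underline w_0}}})^{\operatorname{trop}}(x)\ge0\}=:\Xi_{s_{\underline w_0}}.$$
   Context: Pseudoline arrangement. For a reduced expression $\underline w=s_{i_1}\cdots s_{i_\ell}$, $\operatorname{pa}(\underline w)$ consists of lines $l_1,\dots,l_n$ drawn from left to right, $l_i$ starting at height $i$ (from the bottom); the $j$-th crossing interchanges the lines at heights $i_j,i_j+1$ and is at level $i_j$; if it crosses $l_k,l_m$ ($k<m$) it is denoted $v_{(k,m)}$. The right end of $l_i$ is $L_i$, at height $h(i)$. The strip at level $r$ (between heights $r,r+1$) is cut by the crossings at level $r$ into faces: $F_r$, unbounded to the left, and for each crossing at level $r$ (the $j$-th, $=v_{(k,m)}$) the face $F_{i_j}=F_{(k,m)}$ with that crossing as left endpoint. $J(i)=\{j\mid s_{i_j}=s_i\}=\{j_1<\dots<j_{n_i}\}$. $\mathbb R^{\ell+n-1}$ has standard basis $e_F$ ($F$ a face); write $e_{(k,m)}=e_{F_{(k,m)}}$, $e_i=e_{F_i}$, and $X_F=z^{e_F}$ for the coordinates of the torus $\mathcal X_{s_{\underline w}}$. GP-paths. For $i\in[n-1]$ orient $l_1,\dots,l_i$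 from right to left and $l_{i+1},\dots,l_n$ from left to right. A directed path along the lines is rigorous if it never goes straight along $l_a$ through a crossing with $l_b$ where either $a<b$ and both are oriented to the left, or $a>b$ and both are oriented to the right. A GP-path is a rigorous path from some $L_p$ to some $L_q$ with $p\le i<q$, $h(i+1)\le h(p)\le h(i)$, $h(i+1)\le h(q)\le h(i)$. $\mathcal P_{\underline w}$ is the set of all GP-paths for all $i$. Weighted area cone. For $\mathbf p\in\mathcal P_{\underline w}$, $e_{\mathbf p}=-\sum e_F$ over the faces $F$ in the region enclosed by $\mathbf p$ (to its left); $e_{[i:k]}=-e_{F_i}-\sum_{j\in J(i),j\le j_k}e_{F_{i_j}}$, $0\le k\le n_i$ ($e_{[i:0]}=-e_{F_i}$). $\mathcal S_{\underline w}=\{x\in\mathbb R^{\ell+n-1}\mid e_{\mathbf p}^tx\ge0\ \forall\mathbf p\in\mathcal P_{\underline w},\ e_{[i:k]}^tx\ge0\ \forall i\in[n-1],0\le k\le n_i\}$. Superpotential. $W$ is the Gross-Hacking-Keel-Kontsevich superpotential (sum of the $\vartheta$-functions of the frozen variables) on the mirror dual $\mathcal X$ of the $\mathcal A$-cluster variety $G^{e,w_0}=B\cap B^-w_0B^-\subset SL_n$. Explicitly, in the initial seed of $\hat{\underline w}_0=s_1\,s_2s_1\,s_3s_2s_1\cdots s_{n-1}\cdots s_2s_1$ (Magee): $$W|_{\mathcal X_{s_0}}=\sum_{i=1}^{n-1}\Big(\sum_{k=0}^{n-1-i}z^{-e_i-\sum_{j=1}^ke_{(j,i+j)}}+\sum_{k=0}^{n-1-i}z^{-\sum_{j=0}^ke_{(i,n-j)}}\Big).$$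 Any reduced expression of $w_0$ is reached from $\hat{\underline w}_0$ by commutations of orthogonal reflections (which do not change the faces up to obvious identification) and braid moves; under a braid move the expression of $W$ changes by $\mathcal X$-mutation as follows. Suppose the letters $j,j+1,j+2$ of $\underline w$ are $s_rs_ts_r$ with $|r-t|=1$, replaced by $s_ts_rs_t$. Let $F$ be the level-$r$ face between crossings $j$ and $j+2$; $E_1$ the level-$r$ face with right endpoint crossing $j$; $E_2$ the level-$t$ face with left endpoint crossing $j+1$; $E_3$ the level-$r$ face with left endpoint crossing $j+2$; $E_4$ the level-$t$ face with right endpoint crossing $j+1$. In the new arrangement $F$ is replaced by the level-$t$ face $F'$ between crossings $j$ and $j+2$, and $E_1,E_2,E_3,E_4$ become respectively: the level-$r$ face with right endpoint $j+1$, the level-$t$ face with left endpoint $j+2$, the level-$r$ face with left endpoint $j+1$, the level-$t$ face with right endpoint $j$; other faces are unchanged. The old coordinates are expressed by the new ones $X'$ through $X_F=X_{F'}'^{-1}$, $X_{E}=X_E'(1+X'_{F'})$ for $E=E_1,E_2$, $X_E=X'_E(1+X_{F'}'^{-1})^{-1}$ for $E=E_3,E_4$, and $X_E=X_E'$ otherwise; $W|_{\mathcal X_{s_{\underline w_0}}}$ is the resulting Laurent polynomial. Tropicalization: for a Laurent polynomial $\sum_ua_uz^u$ with positive coefficients, its tropicalization is $x\mapsto\min\{u^tx\mid a_u\neq0\}$. *)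

theory Defs
  imports
    Complex_Main
    "HOL-Library.Poly_Mapping"
    "HOL-Library.Extended_Real"
    "HOL-Combinatorics.Permutations"
begin

section \<open>Reduced words in the symmetric group\<close>

text \<open>
  The symmetric group on n letters consists of the permutations of \<open>{1..n}\<close>. The word
  \<open>[i\<^sub>1, \<dots>, i\<^sub>l]\<close> stands for the product of the simple transpositions
  \<open>s\<^sub>i = (i, i+1)\<close>, multiplied as functions.
\<close>

definition simple_word :: "nat \<Rightarrow> nat list \<Rightarrow> bool" where
  "simple_word n w \<longleftrightarrow> set w \<subseteq> {1..<n}"

definition word_perm :: "nat list \<Rightarrow> nat \<Rightarrow> nat" where
  "word_perm w = foldr (\<lambda>s p. transpose s (Suc s) \<circ> p) w id"

definition coxeter_length :: "nat \<Rightarrow> (nat \<Rightarrow> nat) \<Rightarrow> nat" where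
  "coxeter_length n p = (LEAST l. \<exists>w. simple_word n w \<and> word_perm w = p \<and> length w = l)"

definition reduced_expression :: "nat \<Rightarrow> (nat \<Rightarrow> nat) \<Rightarrow> nat list \<Rightarrow> bool" where
  "reduced_expression n p w \<longleftrightarrow>
     simple_word n w \<and> word_perm w = p \<and> length w = coxeter_length n p"

definition longest_element :: "nat \<Rightarrow> (nat \<Rightarrow> nat) \<Rightarrow> bool" where
  "longest_element n p \<longleftrightarrow>
     p permutes {1..n} \<and> (\<forall>q. q permutes {1..n} \<longrightarrow> coxeter_length n q \<le> coxeter_length n p)"


section \<open>Pseudoline arrangements\<close>

text \<open>
  Crossings are numbered from 0 by their position in the word, so crossing j has level
  \<open>w ! j\<close>. Crossing j lies between column j and column \<open>Suc j\<close> of the diagram; column 0 is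
  to the left of all crossings and column \<open>length w\<close> contains the right ends of the lines.
  \<open>height w c a\<close> is the height of line a in column c.
\<close>

definition height :: "nat list \<Rightarrow> nat \<Rightarrow> nat \<Rightarrow> nat" where
  "height w c a = fold (\<lambda>s. transpose s (Suc s)) (take c w) a"

definition end_height :: "nat list \<Rightarrow> nat \<Rightarrow> nat" where
  "end_height w a = height w (length w) a"

definition crosses :: "nat list \<Rightarrow> nat \<Rightarrow> nat \<Rightarrow> nat \<Rightarrow> bool" where
  "crosses w j a b \<longleftrightarrow>
     j < length w \<and> {height w j a, height w j b} = {w ! j, Suc (w ! j)}"

text \<open>
  \<open>Unb r\<close> is the face of level r which is unbounded to the left; \<open>Cr j\<close> is the face whose
  left endpoint is crossing j.
\<close>

datatype face = Unb nat | Cr nat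

definition faces :: "nat \<Rightarrow> nat list \<Rightarrow> face set" where
  "faces n w = Unb ` {1..<n} \<union> Cr ` {..<length w}"

definition crossing_face :: "nat list \<Rightarrow> nat \<Rightarrow> nat \<Rightarrow> face" where
  "crossing_face w k m = Cr (THE j. crosses w j k m)"

definition left_face :: "nat list \<Rightarrow> nat \<Rightarrow> face" where \<comment> \<open>the face with right endpoint crossing j\<close>
  "left_face w j =
     (if \<exists>k<j. w ! k = w ! j then Cr (Max {k. k < j \<and> w ! k = w ! j}) else Unb (w ! j))"

text \<open>The real vector space with basis the faces: real functions vanishing off the faces.\<close>

definition face_space :: "nat \<Rightarrow> nat list \<Rightarrow> (face \<Rightarrow> real) set" where
  "face_space n w = {x. \<forall>F. F \<notin> faces n w \<longrightarrow> x F = 0}"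

text \<open>Integral vectors, used both as linear forms and as exponents of Laurent monomials.\<close>

type_synonym face_vec = "face \<Rightarrow>\<^sub>0 int"

abbreviation basis_vec :: "face \<Rightarrow> face_vec" where
  "basis_vec F \<equiv> Poly_Mapping.single F 1"

definition pairing :: "face_vec \<Rightarrow> (face \<Rightarrow> real) \<Rightarrow> real" where
  "pairing u x = (\<Sum>F\<in>Poly_Mapping.keys u. of_int (Poly_Mapping.lookup u F) * x F)"


section \<open>GP-paths and the weighted area cone\<close>

text \<open>
  A path is a list of line pieces: \<open>(c, a)\<close> is the piece of line a inside column c. For the
  orientation given by i, the lines \<open>a \<le> i\<close> run to the left and the others to the right, so
  a piece is entered through one of the two crossings adjacent to its column and left through
  the other one. At a crossing not involving line a, this line simply continues.
\<close>

definition enters_at :: "nat \<Rightarrow> nat \<times> nat \<Rightarrow> nat \<Rightarrow> bool" where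
  "enters_at i P j \<longleftrightarrow> fst P = (if snd P \<le> i then j else Suc j)"

definition leaves_at :: "nat \<Rightarrow> nat \<times> nat \<Rightarrow> nat \<Rightarrow> bool" where
  "leaves_at i P j \<longleftrightarrow> fst P = (if snd P \<le> i then Suc j else j)"

definition straight_forbidden :: "nat list \<Rightarrow> nat \<Rightarrow> nat \<Rightarrow> nat \<Rightarrow> bool" where
  "straight_forbidden w i j a \<longleftrightarrow>
     (\<exists>b. crosses w j a b \<and> (a < b \<and> a \<le> i \<and> b \<le> i \<or> a > b \<and> a > i \<and> b > i))"

definition rigorous_step :: "nat list \<Rightarrow> nat \<Rightarrow> nat \<times> nat \<Rightarrow> nat \<times> nat \<Rightarrow> bool" where
  "rigorous_step w i P Q \<longleftrightarrow>
     (\<exists>j<length w. leaves_at i P j \<and> enters_at i Q j \<and>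
        (snd P = snd Q \<and> \<not> straight_forbidden w i j (snd P) \<or> crosses w j (snd P) (snd Q)))"

definition rigorous_path :: "nat list \<Rightarrow> nat \<Rightarrow> (nat \<times> nat) list \<Rightarrow> bool" where
  "rigorous_path w i ps \<longleftrightarrow> ps \<noteq> [] \<and> distinct ps \<and> successively (rigorous_step w i) ps"

definition gp_path :: "nat \<Rightarrow> nat list \<Rightarrow> nat \<Rightarrow> (nat \<times> nat) list \<Rightarrow> bool" where
  "gp_path n w i ps \<longleftrightarrow> i \<in> {1..<n} \<and> rigorous_path w i ps \<and>
     (\<exists>p q. 1 \<le> p \<and> p \<le> i \<and> i < q \<and> q \<le> n \<and>
        end_height w p \<in> {end_height w (Suc i)..end_height w i} \<and>
        end_height w q \<in> {end_height w (Suc i)..end_height w i} \<and>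
        hd ps = (length w, p) \<and> last ps = (length w, q))"

text \<open>
  Close a GP-path by a vertical segment to the right of the diagram. The winding number of the
  resulting curve around the point of column c at height \<open>r + 1/2\<close> is obtained by following the
  vertical ray upwards from this point: a piece directed to the left counts 1, a piece directed
  to the right counts -1. The region enclosed by the path and lying to its left consists of the
  points with winding number 1.
\<close>

definition winding :: "nat list \<Rightarrow> nat \<Rightarrow> (nat \<times> nat) list \<Rightarrow> nat \<Rightarrow> nat \<Rightarrow> int" where
  "winding w i ps c r =
     int (card {P \<in> set ps. fst P = c \<and> r < height w c (snd P) \<and> snd P \<le> i})
     - int (card {P \<in> set ps. fst P = c \<and> r < height w c (snd P) \<and> i < snd P})"

text \<open>The column and level of a point of the given face: its leftmost column is chosen.\<close>

fun face_point :: "nat list \<Rightarrow> face \<Rightarrow> nat \<times> nat" where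
  "face_point w (Unb r) = (0, r)"
| "face_point w (Cr j) = (Suc j, w ! j)"

definition enclosed_faces :: "nat \<Rightarrow> nat list \<Rightarrow> nat \<Rightarrow> (nat \<times> nat) list \<Rightarrow> face set" where
  "enclosed_faces n w i ps =
     {F \<in> faces n w. case face_point w F of (c, r) \<Rightarrow> winding w i ps c r = 1}"

definition path_vec :: "nat \<Rightarrow> nat list \<Rightarrow> nat \<Rightarrow> (nat \<times> nat) list \<Rightarrow> face_vec" where
  "path_vec n w i ps = - (\<Sum>F\<in>enclosed_faces n w i ps. basis_vec F)"

definition level_crossings :: "nat list \<Rightarrow> nat \<Rightarrow> nat list" where
  "level_crossings w i = filter (\<lambda>j. w ! j = i) [0..<length w]"

definition level_vec :: "nat list \<Rightarrow> nat \<Rightarrow> nat \<Rightarrow> face_vec" where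
  "level_vec w i k =
     - basis_vec (Unb i) - (\<Sum>j\<leftarrow>take k (level_crossings w i). basis_vec (Cr j))"

definition weighted_area_cone :: "nat \<Rightarrow> nat list \<Rightarrow> (face \<Rightarrow> real) set" where
  "weighted_area_cone n w =
     {x \<in> face_space n w.
        (\<forall>i ps. gp_path n w i ps \<longrightarrow> pairing (path_vec n w i ps) x \<ge> 0) \<and>
        (\<forall>i\<in>{1..<n}. \<forall>k\<le>length (level_crossings w i). pairing (level_vec w i k) x \<ge> 0)}"


section \<open>Laurent polynomials and tropicalization\<close>

type_synonym laurent = "face_vec \<Rightarrow>\<^sub>0 int"

abbreviation laurent_monom :: "face_vec \<Rightarrow> laurent" where
  "laurent_monom u \<equiv> Poly_Mapping.single u 1"

definition laurent_eval :: "laurent \<Rightarrow> (face \<Rightarrow> complex) \<Rightarrow> complex" where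
  "laurent_eval f X =
     (\<Sum>u\<in>Poly_Mapping.keys f. of_int (Poly_Mapping.lookup f u) *
        (\<Prod>F\<in>Poly_Mapping.keys u. X F powi Poly_Mapping.lookup u F))"

text \<open>
  The infimum is a minimum over a finite set; extended reals only serve to give the zero
  polynomial (the superpotential for \<open>n \<le> 1\<close>) the tropicalization \<open>\<infinity>\<close>.
\<close>

definition trop :: "laurent \<Rightarrow> (face \<Rightarrow> real) \<Rightarrow> ereal" where
  "trop f x = (INF u\<in>Poly_Mapping.keys f. ereal (pairing u x))"


section \<open>The superpotential\<close>

text \<open>The word \<open>s\<^sub>1 s\<^sub>2 s\<^sub>1 s\<^sub>3 s\<^sub>2 s\<^sub>1 \<dots>\<close> of the initial seed.\<close>

definition initial_word :: "nat \<Rightarrow> nat list" where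
  "initial_word n = concat (map (\<lambda>m. rev [1..<Suc m]) [1..<n])"

definition initial_superpotential :: "nat \<Rightarrow> laurent" where
  "initial_superpotential n =
     (let e = (\<lambda>k m. basis_vec (crossing_face (initial_word n) k m)) in
      \<Sum>i\<in>{1..<n}.
        (\<Sum>k\<in>{0..n - 1 - i}. laurent_monom (- basis_vec (Unb i) - (\<Sum>j\<in>{1..k}. e j (i + j)))) +
        (\<Sum>k\<in>{0..n - 1 - i}. laurent_monom (- (\<Sum>j\<in>{0..k}. e i (n - j)))))"

definition commutation_move :: "nat list \<Rightarrow> nat \<Rightarrow> nat list \<Rightarrow> bool" where
  "commutation_move w j w' \<longleftrightarrow> Suc j < length w \<and>
     (w ! j + 2 \<le> w ! Suc j \<or> w ! Suc j + 2 \<le> w ! j) \<and>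
     w' = w[j := w ! Suc j, Suc j := w ! j]"

definition braid_move :: "nat list \<Rightarrow> nat \<Rightarrow> nat list \<Rightarrow> bool" where
  "braid_move w j w' \<longleftrightarrow> j + 2 < length w \<and> w ! (j + 2) = w ! j \<and>
     (w ! j = Suc (w ! (j + 1)) \<or> w ! (j + 1) = Suc (w ! j)) \<and>
     w' = w[j := w ! (j + 1), j + 1 := w ! j, j + 2 := w ! (j + 1)]"

text \<open>
  The next two functions express the old coordinates in terms of the new ones \<open>X'\<close>. A
  commutation exchanges the numbers of the two crossings and leaves the faces unchanged. For
  the X-mutation at a braid move, both F and F' are \<open>Cr j\<close>; the right-hand sides use
  the names in \<open>w'\<close> of the faces into which the neighbours of F turn.
\<close>

definition commutation_coords :: "nat \<Rightarrow> (face \<Rightarrow> complex) \<Rightarrow> face \<Rightarrow> complex" where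
  "commutation_coords j X' E = X' (transpose (Cr j) (Cr (Suc j)) E)"

definition mutation_coords ::
    "nat list \<Rightarrow> nat \<Rightarrow> nat list \<Rightarrow> (face \<Rightarrow> complex) \<Rightarrow> face \<Rightarrow> complex" where
  "mutation_coords w j w' X' E =
     (if E = Cr j then inverse (X' (Cr j))
      else if E = left_face w j then X' (left_face w' (j + 1)) * (1 + X' (Cr j))
      else if E = Cr (j + 1) then X' (Cr (j + 2)) * (1 + X' (Cr j))
      else if E = Cr (j + 2) then X' (Cr (j + 1)) * inverse (1 + inverse (X' (Cr j)))
      else if E = left_face w (j + 1) then X' (left_face w' j) * inverse (1 + inverse (X' (Cr j)))
      else X' E)"

text \<open>
  \<open>superpotential_expr n w f\<close>: the Laurent polynomial f is obtained from the one of the initial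
  seed by pulling back along the coordinate changes of a sequence of moves leading to w. The
  pullback along the birational mutation map is expressed by equality of functions on the part
  of the complex torus where the map is defined.
\<close>

inductive superpotential_expr :: "nat \<Rightarrow> nat list \<Rightarrow> laurent \<Rightarrow> bool" for n where
  initial: "superpotential_expr n (initial_word n) (initial_superpotential n)"
| commutation:
    "superpotential_expr n w f \<Longrightarrow> commutation_move w j w' \<Longrightarrow>
     (\<And>X'. (\<forall>F. X' F \<noteq> 0) \<Longrightarrow>
        laurent_eval f' X' = laurent_eval f (commutation_coords j X')) \<Longrightarrow>
     superpotential_expr n w' f'"
| braid:
    "superpotential_expr n w f \<Longrightarrow> braid_move w j w' \<Longrightarrow>
     (\<And>X'. (\<forall>F. X' F \<noteq> 0) \<Longrightarrow> 1 + X' (Cr j) \<noteq> 0 \<Longrightarrow>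
        laurent_eval f' X' = laurent_eval f (mutation_coords w j w' X')) \<Longrightarrow>
     superpotential_expr n w' f'"

text \<open>
  The superpotential is a function on the whole cluster variety, so its expression in a seed
  does not depend on the sequence of moves used to reach the seed.
\<close>

definition superpotential :: "nat \<Rightarrow> nat list \<Rightarrow> laurent" where
  "superpotential n w = (THE f. superpotential_expr n w f)"

definition superpotential_cone :: "nat \<Rightarrow> nat list \<Rightarrow> (face \<Rightarrow> real) set" where
  "superpotential_cone n w = {x \<in> face_space n w. trop (superpotential n w) x \<ge> 0}"

end

theory Submission
  imports Defs
begin

text \<open>For a fixed \<open>i\<close>, put particles on the lines \<open>1, \<dots>, i\<close> and take the symmetric difference with
  the pieces of a GP-path. This turns the path into a history of \<open>i\<close> particles that move from left to
  right: at a crossing of level \<open>r\<close>, a particle at height \<open>r\<close> may hop to a free height \<open>r + 1\<close>. All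
  GP-paths arise in this way from the histories that end with the lines \<open>1, \<dots>, i - 1, i + 1\<close>. The
  number of particles above a point is the one for the lines \<open>1, \<dots>, i\<close> themselves, which hop
  whenever they can, minus the winding number of the path; this deficit is 0 or 1.

  Weighting a history by the powers of \<open>X\<^sub>F\<close> with the number of particles above \<open>F\<close>, the sum over the
  GP-paths becomes a quotient of two history sums, that is, of two generalized minors. History sums
  with prescribed ends are invariant under the mutations, by a local identity for three consecutive
  crossings, and so are the sums of the monomials \<open>e\<^bsub>[i:k]\<^esub>\<close> with \<open>k < n\<^sub>i\<close>. On the initial seed both sums give
  Magee's formula. As all reduced words of the longest element are connected by moves and a Laurent
  polynomial is determined by its values on the positive torus, the superpotential is the sum of
  these monomials for every reduced word, and its tropicalization is read off. The vectors with
  \<open>k = n\<^sub>i\<close> are redundant.\<close>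

section \<open>Reduced words of the longest element\<close>

text \<open>The dictionary works because a particle that keeps its height at a crossing changes its
  line, while a hopping particle stays on its line. Turns and straight passages of a path thus
  become occupation numbers, and the shape of a path, which a braid move may change in many ways,
  never has to be followed. The base lines \<open>1, ..., i\<close> enter through one fact: theirs
  is the only history between its two ends. So the denominator of the quotient is a monomial, and
  the quotient is a sum of monomials. So also a set of pieces that is conserved at all crossings and
  avoids both ends is empty; hence a history yields one path and no closed curves besides it. The
  comparison with the base lines also bounds the deficit, which rules out a double passage through a
  crossing. Since the superpotential is a definite description, both existence and uniqueness are
  due; the invariance is proved for values at points of the torus and then transferred to Laurent
  polynomials. All coefficients are nonnegative, so no monomial cancels.\<close>

lemma word_perm_Nil [simp]: "word_perm [] = id"
  by (simp add: word_perm_def)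

lemma word_perm_Cons [simp]: "word_perm (s # w) = transpose s (Suc s) \<circ> word_perm w"
  by (simp add: word_perm_def)

lemma word_perm_append: "word_perm (u @ v) = word_perm u \<circ> word_perm v"
  by (induction u) (auto simp: comp_assoc)

lemma simple_word_simps [simp]:
  "simple_word n []"
  "simple_word n (s # w) \<longleftrightarrow> s \<in> {1..<n} \<and> simple_word n w"
  "simple_word n (u @ v) \<longleftrightarrow> simple_word n u \<and> simple_word n v"
  by (auto simp: simple_word_def)

lemma word_perm_permutes: "simple_word n w \<Longrightarrow> word_perm w permutes {1..n}"
proof (induction w)
  case (Cons s w)
  then show ?case
    unfolding word_perm_Cons
    by (intro permutes_compose[OF Cons.IH] permutes_swap_id) auto
qed (auto simp: permutes_id)

text \<open>The longest element; outside \<open>{1..n}\<close> it is the identity, as is the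
  \<open>word_perm\<close> of every simple word.\<close>

definition flip :: "nat \<Rightarrow> nat \<Rightarrow> nat" where
  "flip n a = (if a \<in> {1..n} then Suc n - a else a)"

lemma flip_flip [simp]: "flip n (flip n a) = a"
  by (auto simp: flip_def)

lemma flip_permutes: "flip n permutes {1..n}"
proof (rule bij_imp_permutes)
  show "bij_betw (flip n) {1..n} {1..n}"
    by (rule bij_betw_byWitness[where f' = "flip n"]) (auto simp: flip_def)
qed (auto simp: flip_def)

section \<open>Inversions and the Coxeter length\<close>

definition inversions :: "nat \<Rightarrow> (nat \<Rightarrow> nat) \<Rightarrow> (nat \<times> nat) set" where
  "inversions n p = {(x, y). 1 \<le> x \<and> x < y \<and> y \<le> n \<and> p y < p x}"

lemma finite_inversions [simp]: "finite (inversions n p)"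
  by (rule finite_subset[of _ "{1..n} \<times> {1..n}"]) (auto simp: inversions_def)

lemma inversions_id [simp]: "inversions n id = {}"
  by (auto simp: inversions_def)

lemma inversions_flip: "inversions n (flip n) = {(x, y). 1 \<le> x \<and> x < y \<and> y \<le> n}"
  by (auto simp: inversions_def flip_def)

lemma card_inversions_flip: "card (inversions n (flip n)) = (\<Sum>y\<in>{1..n}. y - 1)"
proof -
  have "inversions n (flip n) = prod.swap ` (SIGMA y:{1..n}. {1..<y})"
    unfolding inversions_flip by (auto simp: image_iff)
  then show ?thesis by (simp add: card_image)
qed

lemma card_inversions_le: "card (inversions n p) \<le> card (inversions n (flip n))"
proof (rule card_mono)
  show "inversions n p \<subseteq> inversions n (flip n)"
    by (auto simp: inversions_flip) (auto simp: inversions_def)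
qed simp

text \<open>Exchanging the positions \<open>s\<close> and \<open>Suc s\<close> matches the
  inversions other than \<open>(s, Suc s)\<close> before and after, so only this pair changes its
  status.\<close>

lemma card_inversions_ascent:
  assumes "s \<in> {1..<n}" "p s < p (Suc s)"
  shows "card (inversions n (p \<circ> transpose s (Suc s))) = Suc (card (inversions n p))"
proof -
  let ?t = "transpose s (Suc s)"
  have 1: "?t x = (if x = s then Suc s else if x = Suc s then s else x)" for x
    by (auto simp: transpose_def)
  have sub: "map_prod ?t ?t z \<in> inversions n q"
    if "z \<in> inversions n (q \<circ> ?t)" "z \<noteq> (s, Suc s)" for q z
    using that assms(1) unfolding inversions_def by (auto simp: 1 split: if_splits)
  have eq: "inversions n (p \<circ> ?t) = insert (s, Suc s) (map_prod ?t ?t ` inversions n p)"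
  proof (intro set_eqI iffI)
    fix z assume z: "z \<in> inversions n (p \<circ> ?t)"
    have "z = map_prod ?t ?t (map_prod ?t ?t z)" by (cases z) simp
    then show "z \<in> insert (s, Suc s) (map_prod ?t ?t ` inversions n p)"
      using sub[OF z] by (metis image_eqI insertCI)
  next
    fix z assume "z \<in> insert (s, Suc s) (map_prod ?t ?t ` inversions n p)"
    then consider "z = (s, Suc s)" | y where "y \<in> inversions n p" "z = map_prod ?t ?t y"
      by (elim insertE imageE)
    then show "z \<in> inversions n (p \<circ> ?t)"
    proof cases
      case 1
      then show ?thesis using assms by (auto simp: inversions_def)
    next
      case 2
      have "y \<noteq> (s, Suc s)" using 2(1) assms(2) by (auto simp: inversions_def)
      moreover have "p \<circ> ?t \<circ> ?t = p" by (simp add: comp_assoc)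
      ultimately show ?thesis using sub[of y "p \<circ> ?t"] 2 by simp
    qed
  qed
  have "(s, Suc s) \<notin> map_prod ?t ?t ` inversions n p"
    by (auto simp: inversions_def 1 split: if_splits)
  moreover have "inj_on (map_prod ?t ?t) (inversions n p)"
    by (rule inj_on_subset[OF map_prod_inj_on[of ?t UNIV ?t UNIV]]) auto
  ultimately show ?thesis by (simp add: eq card_image)
qed

lemma card_inversions_swap:
  assumes "s \<in> {1..<n}" "inj p"
  shows "card (inversions n (p \<circ> transpose s (Suc s))) =
    (if p s < p (Suc s) then Suc (card (inversions n p)) else card (inversions n p) - 1)"
    and "p (Suc s) < p s \<Longrightarrow> card (inversions n p) > 0"
proof -
  have *: "Suc (card (inversions n (p \<circ> transpose s (Suc s)))) = card (inversions n p)"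
    if "p (Suc s) < p s"
    using card_inversions_ascent[OF assms(1), of "p \<circ> transpose s (Suc s)"] that
    by (simp add: comp_assoc)
  have "p s \<noteq> p (Suc s)" using assms(2) by (simp add: inj_eq)
  then show "card (inversions n (p \<circ> transpose s (Suc s))) =
    (if p s < p (Suc s) then Suc (card (inversions n p)) else card (inversions n p) - 1)"
    using card_inversions_ascent[OF assms(1), of p] * by auto
  show "p (Suc s) < p s \<Longrightarrow> card (inversions n p) > 0" using * by auto
qed

text \<open>Each letter must create an inversion, so the partial products climb from
  \<open>p\<close> in the right weak order. Unlike a condition on the length, this form of
  reducedness passes directly to suffixes.\<close>

fun ascending :: "(nat \<Rightarrow> nat) \<Rightarrow> nat list \<Rightarrow> bool" where
  "ascending p [] = True"
| "ascending p (s # w) = (p s < p (Suc s) \<and> ascending (p \<circ> transpose s (Suc s)) w)"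

text \<open>One letter changes the number of inversions by exactly one, up or down, so the bound is
  attained only if all steps go up.\<close>

lemma card_inversions_word:
  assumes "simple_word n w" "inj p"
  shows "card (inversions n (p \<circ> word_perm w)) \<le> card (inversions n p) + length w"
    and "card (inversions n (p \<circ> word_perm w)) = card (inversions n p) + length w
      \<longleftrightarrow> ascending p w"
proof -
  have "card (inversions n (p \<circ> word_perm w)) \<le> card (inversions n p) + length w \<and>
    (card (inversions n (p \<circ> word_perm w)) = card (inversions n p) + length w
      \<longleftrightarrow> ascending p w)" using assms
  proof (induction w arbitrary: p)
    case (Cons s w)
    have "inj (p \<circ> transpose s (Suc s))" using Cons.prems by (simp add: inj_compose)
    note IH = Cons.IH[OF _ this]
    have "p \<circ> word_perm (s # w) = p \<circ> transpose s (Suc s) \<circ> word_perm w" by (simp add: comp_assoc)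
    moreover have "card (inversions n (p \<circ> transpose s (Suc s))) =
      (if p s < p (Suc s) then Suc (card (inversions n p)) else card (inversions n p) - 1)"
      "p (Suc s) < p s \<Longrightarrow> card (inversions n p) > 0"
      using card_inversions_swap[of s n p] Cons.prems by auto
    moreover have "p s \<noteq> p (Suc s)" using Cons.prems by (simp add: inj_eq)
    ultimately show ?case using IH Cons.prems
      by (cases "p s < p (Suc s)") (auto simp del: word_perm_Cons comp_apply simp flip: comp_def)
  qed simp
  then show "card (inversions n (p \<circ> word_perm w)) \<le> card (inversions n p) + length w"
    and "card (inversions n (p \<circ> word_perm w)) = card (inversions n p) + length w
      \<longleftrightarrow> ascending p w" by auto
qed

lemma increasing_permutation_id:
  assumes p: "p permutes {1..n}" and inc: "\<And>s. s \<in> {1..<n} \<Longrightarrow> p s < p (Suc s)"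
  shows "p = id"
proof
  fix x
  have ge: "x \<le> p x" if "x \<in> {1..n}" for x
    using that
  proof (induction x)
    case (Suc x)
    show ?case
    proof (cases "x = 0")
      case True
      then show ?thesis using permutes_in_image[OF p, of "Suc x"] Suc.prems by simp
    next
      case False
      then show ?thesis using Suc inc[of x] by auto
    qed
  qed simp
  have le: "p (n - k) \<le> n - k" if "k < n" for k
    using that
  proof (induction k)
    case 0
    then show ?case using permutes_in_image[OF p, of n] by auto
  next
    case (Suc k)
    moreover have "Suc (n - Suc k) = n - k" "n - Suc k \<in> {1..<n}" using Suc.prems by auto
    ultimately show ?case using inc[of "n - Suc k"] by simp
  qed
  show "p x = id x"
  proof (cases "x \<in> {1..n}")
    case True
    then show ?thesis using ge[of x] le[of "n - x"] by simp
  next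
    case False
    then show ?thesis using p by (simp add: permutes_def)
  qed
qed

lemma no_ascent_flip:
  assumes p: "p permutes {1..n}" and dec: "\<And>s. s \<in> {1..<n} \<Longrightarrow> \<not> p s < p (Suc s)"
  shows "p = flip n"
proof -
  have "flip n \<circ> p = id"
  proof (rule increasing_permutation_id)
    show "flip n \<circ> p permutes {1..n}" using p flip_permutes by (rule permutes_compose)
    fix s assume s: "s \<in> {1..<n}"
    have "p s \<noteq> p (Suc s)" using permutes_inj[OF p] by (simp add: inj_eq)
    moreover have "p s \<in> {1..n}" "p (Suc s) \<in> {1..n}"
      using s permutes_in_image[OF p] by auto
    ultimately show "(flip n \<circ> p) s < (flip n \<circ> p) (Suc s)"
      using dec[OF s] by (auto simp: flip_def)
  qed
  then have "flip n (flip n (p x)) = flip n x" for x by (metis comp_apply id_apply)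
  then show ?thesis by auto
qed

lemma compose_swap_permutes:
  assumes "p permutes {1..n}" "s \<in> {1..<n}"
  shows "p \<circ> transpose s (Suc s) permutes {1..n}"
  using assms by (intro permutes_compose[OF permutes_swap_id]) auto

text \<open>Going up along ascents must stop, as \<open>flip n\<close> has the most inversions, and
  it can only stop at \<open>flip n\<close>. This supplies the common completion in the proof of
  connectedness.\<close>

lemma ex_ascending_to_flip:
  assumes "p permutes {1..n}"
  shows "\<exists>w. simple_word n w \<and> ascending p w \<and> p \<circ> word_perm w = flip n"
  using assms
proof (induction "card (inversions n (flip n)) - card (inversions n p)" arbitrary: p rule: less_induct)
  case less
  show ?case
  proof (cases "\<exists>s\<in>{1..<n}. p s < p (Suc s)")
    case False
    then have "p = flip n" using no_ascent_flip less.prems by blast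
    then show ?thesis by (intro exI[of _ "[]"]) simp
  next
    case True
    then obtain s where s: "s \<in> {1..<n}" "p s < p (Suc s)" by blast
    let ?q = "p \<circ> transpose s (Suc s)"
    have "card (inversions n ?q) = Suc (card (inversions n p))"
      using s by (rule card_inversions_ascent)
    then have "card (inversions n (flip n)) - card (inversions n ?q)
        < card (inversions n (flip n)) - card (inversions n p)"
      using card_inversions_le[of n ?q] by simp
    then obtain w where "simple_word n w" "ascending ?q w" "?q \<circ> word_perm w = flip n"
      using less.hyps[OF _ compose_swap_permutes[OF less.prems s(1)]] by blast
    then show ?thesis using s by (intro exI[of _ "s # w"]) (auto simp: comp_assoc)
  qed
qed

lemma ex_word_of_permutation:
  assumes "p permutes {1..n}"
  shows "\<exists>w. simple_word n w \<and> word_perm w = p \<and> length w = card (inversions n p)"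
  using assms
proof (induction "card (inversions n p)" arbitrary: p rule: less_induct)
  case less
  show ?case
  proof (cases "\<exists>s\<in>{1..<n}. p (Suc s) < p s")
    case False
    have "p s < p (Suc s)" if "s \<in> {1..<n}" for s
      using False that permutes_inj[OF less.prems] by (metis inj_eq linorder_neqE_nat n_not_Suc_n)
    then have "p = id" using increasing_permutation_id less.prems by blast
    then show ?thesis by (intro exI[of _ "[]"]) simp
  next
    case True
    then obtain s where s: "s \<in> {1..<n}" "p (Suc s) < p s" by blast
    let ?q = "p \<circ> transpose s (Suc s)"
    have c: "card (inversions n p) = Suc (card (inversions n ?q))"
      using card_inversions_swap[OF s(1) permutes_inj[OF less.prems]] s(2) by simp
    then obtain w where "simple_word n w" "word_perm w = ?q" "length w = card (inversions n ?q)"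
      using less.hyps[OF _ compose_swap_permutes[OF less.prems s(1)]] by auto
    then show ?thesis using s c
      by (intro exI[of _ "w @ [s]"]) (auto simp: word_perm_append comp_assoc)
  qed
qed

definition flip_word :: "nat \<Rightarrow> nat list \<Rightarrow> bool" where
  "flip_word n w \<longleftrightarrow>
     simple_word n w \<and> word_perm w = flip n \<and> length w = card (inversions n (flip n))"

lemma flip_word_ascending: "flip_word n w \<Longrightarrow> ascending id w"
  using card_inversions_word(2)[of n w id] by (simp add: flip_word_def)

text \<open>The number of inversions bounds the length of \<open>flip n\<close> from below and that
  of \<open>p\<close> from above. A longest \<open>p\<close> therefore inverts every pair and has no
  ascent.\<close>

lemma flip_word_of_reduced_expression:
  assumes "longest_element n p" "reduced_expression n p w"
  shows "flip_word n w"
proof -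
  have p: "p permutes {1..n}" using assms by (simp add: longest_element_def)
  have w: "simple_word n w" "word_perm w = p" "length w = coxeter_length n p"
    using assms by (auto simp: reduced_expression_def)
  have "\<exists>v. simple_word n v \<and> word_perm v = flip n \<and> length v = coxeter_length n (flip n)"
    unfolding coxeter_length_def
    by (rule LeastI_ex) (use ex_word_of_permutation[OF flip_permutes] in blast)
  then have "card (inversions n (flip n)) \<le> coxeter_length n (flip n)"
    using card_inversions_word(1)[of n _ id] by fastforce
  also have "\<dots> \<le> coxeter_length n p"
    using assms flip_permutes by (simp add: longest_element_def)
  finally have 1: "card (inversions n (flip n)) \<le> coxeter_length n p" .
  have 2: "coxeter_length n p \<le> card (inversions n p)"
    unfolding coxeter_length_def by (rule Least_le) (use ex_word_of_permutation[OF p] in blast)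
  have 3: "inversions n p = inversions n (flip n)"
  proof (rule card_seteq)
    show "inversions n p \<subseteq> inversions n (flip n)"
      by (auto simp: inversions_flip) (auto simp: inversions_def)
  qed (use 1 2 in auto)
  have "p = flip n"
  proof (rule no_ascent_flip[OF p])
    fix s assume "s \<in> {1..<n}"
    then have "(s, Suc s) \<in> inversions n p" unfolding 3 inversions_flip by simp
    then show "\<not> p s < p (Suc s)" by (simp add: inversions_def)
  qed
  then show ?thesis using w 1 2 by (auto simp: flip_word_def)
qed

section \<open>Connecting the reduced words by moves\<close>

definition word_move :: "nat list \<Rightarrow> nat list \<Rightarrow> bool" where
  "word_move w w' \<longleftrightarrow> (\<exists>j. commutation_move w j w' \<or> braid_move w j w')"

lemma commutation_moveE:
  assumes "commutation_move w j w'"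
  obtains u s t v where "w = u @ s # t # v" "w' = u @ t # s # v" "j = length u"
    "s + 2 \<le> t \<or> t + 2 \<le> s"
proof -
  have j: "Suc j < length w" using assms by (simp add: commutation_move_def)
  then have w: "w = take j w @ w ! j # w ! Suc j # drop (Suc (Suc j)) w"
    by (simp add: Cons_nth_drop_Suc)
  have "w' = take j w @ w ! Suc j # w ! j # drop (Suc (Suc j)) w"
    using assms j by (subst (asm) w, simp add: commutation_move_def list_update_append nth_append)
  then show ?thesis using that[OF w] assms j by (simp add: commutation_move_def)
qed

lemma braid_moveE:
  assumes "braid_move w j w'"
  obtains u r t v where "w = u @ r # t # r # v" "w' = u @ t # r # t # v" "j = length u"
    "r = Suc t \<or> t = Suc r"
proof -
  have j: "j + 2 < length w" "w ! (j + 2) = w ! j" using assms by (auto simp: braid_move_def)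
  then have w: "w = take j w @ w ! j # w ! Suc j # w ! j # drop (j + 3) w"
    by (metis Cons_nth_drop_Suc Suc_lessD add.commute add_2_eq_Suc append_take_drop_id
        numeral_3_eq_3 add_Suc_right plus_1_eq_Suc numeral_2_eq_2 add_Suc add_0)
  have "w' = take j w @ w ! Suc j # w ! j # w ! Suc j # drop (j + 3) w"
    using assms j by (subst (asm) w, simp add: braid_move_def list_update_append nth_append)
  then show ?thesis using that[OF w] assms j by (simp add: braid_move_def)
qed

lemma commutation_moveI:
  "s + 2 \<le> t \<or> t + 2 \<le> s \<Longrightarrow> commutation_move (u @ s # t # v) (length u) (u @ t # s # v)"
  by (simp add: commutation_move_def list_update_append nth_append)

lemma braid_moveI:
  "r = Suc t \<or> t = Suc r \<Longrightarrow> braid_move (u @ r # t # r # v) (length u) (u @ t # r # t # v)"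
  by (auto simp: braid_move_def list_update_append nth_append)

lemma word_move_iff:
  "word_move w w' \<longleftrightarrow>
    (\<exists>u s t v. w = u @ s # t # v \<and> w' = u @ t # s # v \<and> (s + 2 \<le> t \<or> t + 2 \<le> s)) \<or>
    (\<exists>u r t v. w = u @ r # t # r # v \<and> w' = u @ t # r # t # v \<and> (r = Suc t \<or> t = Suc r))"
  unfolding word_move_def
  by (meson commutation_moveE braid_moveE commutation_moveI braid_moveI)

lemma word_move_Cons: "word_move w w' \<Longrightarrow> word_move (s # w) (s # w')"
  unfolding word_move_iff by (metis append_Cons)

lemma word_moves_Cons: "word_move\<^sup>*\<^sup>* w w' \<Longrightarrow> word_move\<^sup>*\<^sup>* (s # w) (s # w')"
  by (induction rule: rtranclp_induct) (auto intro: rtranclp.rtrancl_into_rtrancl word_move_Cons)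

lemma word_moves_length: "word_move\<^sup>*\<^sup>* w w' \<Longrightarrow> length w' = length w"
  by (induction rule: rtranclp_induct) (auto simp: word_move_iff)

lemma braid_relation:
  "transpose r (Suc r) \<circ> (transpose (Suc r) (Suc (Suc r)) \<circ> transpose r (Suc r)) =
   transpose (Suc r) (Suc (Suc r)) \<circ> (transpose r (Suc r) \<circ> transpose (Suc r) (Suc (Suc r)))"
  by (rule ext) (simp add: transpose_def)

lemma commutation_relation:
  "s + 2 \<le> t \<or> t + 2 \<le> s \<Longrightarrow>
   transpose s (Suc s) \<circ> transpose t (Suc t) = transpose t (Suc t) \<circ> transpose s (Suc s)"
  by (rule ext) (auto simp: transpose_def)

lemma word_perm_move:
  assumes "word_move w w'"
  shows "word_perm w' = word_perm w"
proof -
  from assms consider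
    u s t v where "w = u @ s # t # v" "w' = u @ t # s # v" "s + 2 \<le> t \<or> t + 2 \<le> s"
  | u r t v where "w = u @ r # t # r # v" "w' = u @ t # r # t # v" "r = Suc t \<or> t = Suc r"
    unfolding word_move_iff by blast
  then show ?thesis
  proof cases
    case (1 u s t v)
    have "transpose s (Suc s) \<circ> (transpose t (Suc t) \<circ> word_perm v)
        = transpose t (Suc t) \<circ> (transpose s (Suc s) \<circ> word_perm v)"
      using commutation_relation[OF 1(3)] by (metis comp_assoc)
    then show ?thesis using 1 by (simp add: word_perm_append)
  next
    case (2 u r t v)
    have "word_perm [r, t, r] = word_perm [t, r, t]"
      using 2(3) braid_relation[of t] braid_relation[of r] by auto
    then have "word_perm u \<circ> word_perm [r, t, r] \<circ> word_perm v
        = word_perm u \<circ> word_perm [t, r, t] \<circ> word_perm v" by simp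
    then show ?thesis using 2 by (simp only: flip: word_perm_append) simp
  qed
qed

lemma flip_word_move: "word_move w w' \<Longrightarrow> flip_word n w \<Longrightarrow> flip_word n w'"
  using word_perm_move[of w w'] unfolding flip_word_def word_move_iff by auto

lemma no_ascending_from_flip:
  "simple_word n w \<Longrightarrow> ascending (flip n) w \<Longrightarrow> w = []"
  by (cases w) (auto simp: flip_def split: if_splits)

text \<open>The argument of Tits. If the words start with different letters \<open>s\<close> and
  \<open>t\<close>, both are ascents of \<open>p\<close>, so both sides of the relation between
  \<open>s\<close> and \<open>t\<close> climb from \<open>p\<close>; they have a common completion
  \<open>z\<close> to \<open>flip n\<close>. The induction hypothesis connects the two words that
  start with \<open>s\<close> and the two that start with \<open>t\<close>, and a single move links
  the words in the middle.\<close>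

lemma ascending_words_connected:
  assumes "p permutes {1..n}"
    and "simple_word n w" "ascending p w" "p \<circ> word_perm w = flip n"
    and "simple_word n w'" "ascending p w'" "p \<circ> word_perm w' = flip n"
  shows "word_move\<^sup>*\<^sup>* w w'"
  using assms
proof (induction "length w" arbitrary: p w w' rule: less_induct)
  case less
  show ?case
  proof (cases "w = [] \<or> w' = []")
    case True
    then have "p = flip n" using less.prems by auto
    then show ?thesis using less.prems no_ascending_from_flip by blast
  next
    case False
    then obtain s u t v where w: "w = s # u" and w': "w' = t # v"
      by (meson neq_Nil_conv)
    let ?T = "\<lambda>s. transpose s (Suc s)"
    have s: "s \<in> {1..<n}" "p s < p (Suc s)" and t: "t \<in> {1..<n}" "p t < p (Suc t)"
      using less.prems w w' by auto
    have u: "simple_word n u" "ascending (p \<circ> ?T s) u" "p \<circ> ?T s \<circ> word_perm u = flip n"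
      and v: "simple_word n v" "ascending (p \<circ> ?T t) v" "p \<circ> ?T t \<circ> word_perm v = flip n"
      using less.prems w w' by (auto simp: comp_assoc)
    note ps = compose_swap_permutes[OF less.prems(1) s(1)]
    note pt = compose_swap_permutes[OF less.prems(1) t(1)]
    note IHs = less.hyps[OF _ ps u] and IHt = less.hyps[OF _ pt _ _ _ v]
    consider "s = t" | "s + 2 \<le> t \<or> t + 2 \<le> s" | "s = Suc t \<or> t = Suc s" by linarith
    then show ?thesis
    proof cases
      case 1
      then show ?thesis using IHs v w w' by (auto intro: word_moves_Cons)
    next
      case 2
      obtain z where z: "simple_word n z" "ascending (p \<circ> ?T s \<circ> ?T t) z"
        "p \<circ> ?T s \<circ> ?T t \<circ> word_perm z = flip n"
        using ex_ascending_to_flip[OF compose_swap_permutes[OF ps t(1)]] by blast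
      have c: "p \<circ> ?T s \<circ> ?T t = p \<circ> ?T t \<circ> ?T s"
        using commutation_relation[OF 2] by (simp add: comp_assoc)
      note z' = z(2,3)[unfolded c]
      have st: "(p \<circ> ?T s) t < (p \<circ> ?T s) (Suc t)" "(p \<circ> ?T t) s < (p \<circ> ?T t) (Suc s)"
        using 2 s t by (auto simp: transpose_def)
      have m1: "word_move\<^sup>*\<^sup>* u (t # z)"
        using z st t w by (intro IHs) (auto simp: comp_assoc)
      \<comment> \<open>Moves preserve the length, so \<open>s # z\<close> is short enough for the
        induction hypothesis.\<close>
      have "length (s # z) = length u" using word_moves_length[OF m1] by simp
      then have m2: "word_move\<^sup>*\<^sup>* (s # z) v"
        using z(1) z' st s w by (intro IHt) (auto simp: comp_assoc)
      have "word_move (s # t # z) (t # s # z)"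
        unfolding word_move_iff using 2 by (metis append_Nil)
      then have "word_move\<^sup>*\<^sup>* (s # u) (t # s # z)"
        using word_moves_Cons[OF m1, of s] by (rule rtranclp.rtrancl_into_rtrancl[rotated])
      then show ?thesis using word_moves_Cons[OF m2, of t] w w' by auto
    next
      case 3
      have c: "?T s \<circ> (?T t \<circ> ?T s) = ?T t \<circ> (?T s \<circ> ?T t)"
        using 3 braid_relation[of s] braid_relation[of t] by auto
      obtain z where z: "simple_word n z" "ascending (p \<circ> ?T s \<circ> ?T t \<circ> ?T s) z"
        "p \<circ> ?T s \<circ> ?T t \<circ> ?T s \<circ> word_perm z = flip n"
        using ex_ascending_to_flip[OF compose_swap_permutes[OF compose_swap_permutes[OF ps t(1)] s(1)]]
        by blast
      have c': "p \<circ> ?T s \<circ> ?T t \<circ> ?T s = p \<circ> ?T t \<circ> ?T s \<circ> ?T t"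
        using c by (simp add: comp_assoc)
      note z' = z(2,3)[unfolded c']
      have st: "(p \<circ> ?T s) t < (p \<circ> ?T s) (Suc t)" "(p \<circ> ?T t) s < (p \<circ> ?T t) (Suc s)"
        "(p \<circ> ?T s \<circ> ?T t) s < (p \<circ> ?T s \<circ> ?T t) (Suc s)"
        "(p \<circ> ?T t \<circ> ?T s) t < (p \<circ> ?T t \<circ> ?T s) (Suc t)"
        using 3 s t by (auto simp: transpose_def)
      have m1: "word_move\<^sup>*\<^sup>* u (t # s # z)"
        using z st s t w by (intro IHs) (auto simp: comp_assoc)
      have "length (s # t # z) = length u" using word_moves_length[OF m1] by simp
      then have m2: "word_move\<^sup>*\<^sup>* (s # t # z) v"
        using z(1) z' st s t w by (intro IHt) (auto simp: comp_assoc)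
      have "word_move (s # t # s # z) (t # s # t # z)"
        unfolding word_move_iff using 3 by (metis append_Nil)
      then have "word_move\<^sup>*\<^sup>* (s # u) (t # s # t # z)"
        using word_moves_Cons[OF m1, of s] by (rule rtranclp.rtrancl_into_rtrancl[rotated])
      then show ?thesis using word_moves_Cons[OF m2, of t] w w' by auto
    qed
  qed
qed

lemma flip_words_connected:
  assumes "flip_word n w" "flip_word n w'"
  shows "word_move\<^sup>*\<^sup>* w w'"
  using assms flip_word_ascending[OF assms(1)] flip_word_ascending[OF assms(2)]
  by (intro ascending_words_connected[of id n]) (auto simp: flip_word_def permutes_id)

section \<open>Laurent polynomials\<close>

definition monom_eval :: "(face \<Rightarrow> complex) \<Rightarrow> face_vec \<Rightarrow> complex" where
  "monom_eval X u = (\<Prod>F\<in>Poly_Mapping.keys u. X F powi Poly_Mapping.lookup u F)"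

lemma monom_eval_superset:
  "finite A \<Longrightarrow> Poly_Mapping.keys u \<subseteq> A \<Longrightarrow>
    monom_eval X u = (\<Prod>F\<in>A. X F powi Poly_Mapping.lookup u F)"
  unfolding monom_eval_def by (rule prod.mono_neutral_left) (auto simp: in_keys_iff)

lemma monom_eval_0 [simp]: "monom_eval X 0 = 1"
  by (simp add: monom_eval_def)

lemma monom_eval_basis [simp]: "monom_eval X (basis_vec F) = X F"
  by (simp add: monom_eval_def)

lemma monom_eval_add:
  assumes "\<And>F. X F \<noteq> 0"
  shows "monom_eval X (u + v) = monom_eval X u * monom_eval X v"
proof -
  let ?A = "Poly_Mapping.keys u \<union> Poly_Mapping.keys v"
  have "monom_eval X (u + v) = (\<Prod>F\<in>?A. X F powi Poly_Mapping.lookup (u + v) F)"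
    using Poly_Mapping.keys_add[of u v] by (intro monom_eval_superset) auto
  also have "\<dots> = monom_eval X u * monom_eval X v"
    using assms by (simp add: monom_eval_superset[of ?A] lookup_add power_int_add prod.distrib)
  finally show ?thesis .
qed

lemma monom_eval_uminus: "monom_eval X (- u) = inverse (monom_eval X u)"
  by (simp add: monom_eval_def power_int_minus prod_inversef[symmetric] o_def)

lemma monom_eval_diff:
  "(\<And>F. X F \<noteq> 0) \<Longrightarrow> monom_eval X (u - v) = monom_eval X u * inverse (monom_eval X v)"
  using monom_eval_add[of X u "- v"] by (simp add: monom_eval_uminus)

lemma monom_eval_sum:
  "(\<And>F. X F \<noteq> 0) \<Longrightarrow> monom_eval X (sum g A) = (\<Prod>a\<in>A. monom_eval X (g a))"
  by (induction A rule: infinite_finite_induct) (auto simp: monom_eval_add)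

lemma laurent_eval_superset:
  assumes "finite A" "Poly_Mapping.keys f \<subseteq> A"
  shows "laurent_eval f X = (\<Sum>u\<in>A. of_int (Poly_Mapping.lookup f u) * monom_eval X u)"
  unfolding laurent_eval_def monom_eval_def using assms
  by (intro sum.mono_neutral_left) (auto simp: in_keys_iff)

lemma laurent_eval_0 [simp]: "laurent_eval 0 X = 0"
  by (simp add: laurent_eval_def)

lemma laurent_eval_monom [simp]: "laurent_eval (laurent_monom u) X = monom_eval X u"
  by (simp add: laurent_eval_def monom_eval_def)

lemma laurent_eval_add: "laurent_eval (f + g) X = laurent_eval f X + laurent_eval g X"
proof -
  let ?A = "Poly_Mapping.keys f \<union> Poly_Mapping.keys g"
  have "laurent_eval (f + g) X
      = (\<Sum>u\<in>?A. of_int (Poly_Mapping.lookup (f + g) u) * monom_eval X u)"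
    using Poly_Mapping.keys_add[of f g] by (intro laurent_eval_superset) auto
  also have "\<dots> = laurent_eval f X + laurent_eval g X"
    by (simp add: laurent_eval_superset[of ?A] lookup_add algebra_simps sum.distrib)
  finally show ?thesis .
qed

lemma laurent_eval_sum: "laurent_eval (sum g A) X = (\<Sum>a\<in>A. laurent_eval (g a) X)"
  by (induction A rule: infinite_finite_induct) (auto simp: laurent_eval_add)

lemma monom_eval_mult: "monom_eval (\<lambda>F. X F * Y F) u = monom_eval X u * monom_eval Y u"
  by (simp add: monom_eval_def power_int_mult_distrib prod.distrib)

text \<open>Independence of characters: multiplying the argument by a point that separates two of
  the monomials eliminates one of them.\<close>

lemma monom_eval_independent:
  fixes c :: "face_vec \<Rightarrow> complex"
  assumes "finite A"
    and "\<And>a. (\<And>F. a F > 0) \<Longrightarrow> (\<Sum>u\<in>A. c u * monom_eval (\<lambda>F. complex_of_real (a F)) u) = 0"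
    and "u \<in> A"
  shows "c u = 0"
  using assms
proof (induction "card A" arbitrary: A c u rule: less_induct)
  case less
  let ?e = "\<lambda>a. monom_eval (\<lambda>F. complex_of_real (a F))"
  have IH: "c v = 0" if v: "v \<in> A" "v \<noteq> u'" and u': "u' \<in> A" for v u'
  proof -
    obtain F where F: "Poly_Mapping.lookup v F \<noteq> Poly_Mapping.lookup u' F"
      using v(2) poly_mapping_eqI by metis
    \<comment> \<open>Doubling one coordinate at which the exponents differ separates the two
      monomials, and it keeps positive points positive.\<close>
    define b :: "face \<Rightarrow> real" where "b = (\<lambda>E. if E = F then 2 else 1)"
    have b: "?e b t = 2 powi Poly_Mapping.lookup t F" for t
    proof -
      have "?e b t = (\<Prod>E\<in>insert F (Poly_Mapping.keys t). complex_of_real (b E) powi Poly_Mapping.lookup t E)"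
        by (rule monom_eval_superset) auto
      also have "\<dots> = (\<Prod>E\<in>{F}. complex_of_real (b E) powi Poly_Mapping.lookup t E)"
        by (rule prod.mono_neutral_right) (auto simp: b_def)
      finally show ?thesis by (simp add: b_def)
    qed
    have ne: "?e b v \<noteq> ?e b u'"
    proof
      assume "?e b v = ?e b u'"
      then have "complex_of_real (2 powi Poly_Mapping.lookup v F) = complex_of_real (2 powi Poly_Mapping.lookup u' F)"
        by (simp add: b)
      then have "(2::real) powi Poly_Mapping.lookup v F = 2 powi Poly_Mapping.lookup u' F"
        using of_real_eq_iff by blast
      then show False using F power_int_strict_increasing[of _ _ "2::real"]
        by (metis linorder_neqE less_irrefl one_less_numeral_iff semiring_norm(76))
    qed
    have "(?e b v - ?e b u') * c v = 0"
    proof (rule less.hyps[of "A - {u'}" "\<lambda>t. (?e b t - ?e b u') * c t"])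
      show "card (A - {u'}) < card A" using u' less.prems(1) by (intro card_Diff1_less)
      fix a :: "face \<Rightarrow> real" assume a: "\<And>F. a F > 0"
      have "(\<Sum>t\<in>A. c t * ?e (\<lambda>F. b F * a F) t) = 0"
        using a by (intro less.prems(2)) (auto simp: b_def)
      moreover have "(\<Sum>t\<in>A. c t * ?e a t) = 0" using a by (rule less.prems(2))
      ultimately have "(\<Sum>t\<in>A. c t * ?e (\<lambda>F. b F * a F) t) - ?e b u' * (\<Sum>t\<in>A. c t * ?e a t) = 0"
        by simp
      also have "(\<Sum>t\<in>A. c t * ?e (\<lambda>F. b F * a F) t) - ?e b u' * (\<Sum>t\<in>A. c t * ?e a t)
          = (\<Sum>t\<in>A. (?e b t - ?e b u') * c t * ?e a t)"
        by (simp add: monom_eval_mult sum_distrib_left sum_subtractf algebra_simps)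
      also have "\<dots> = (\<Sum>t\<in>A - {u'}. (?e b t - ?e b u') * c t * ?e a t)"
        using less.prems(1) by (intro sum.mono_neutral_right) auto
      finally show "(\<Sum>t\<in>A - {u'}. (?e b t - ?e b u') * c t * ?e a t) = 0" .
    qed (use v less.prems(1) in auto)
    then show ?thesis using ne by simp
  qed
  show ?case
  proof (cases "A = {u}")
    case True
    have "(\<Sum>t\<in>A. c t * ?e (\<lambda>F. 1) t) = 0" by (rule less.prems(2)) auto
    then show ?thesis using True by (simp add: monom_eval_def)
  next
    case False
    then obtain v where "v \<in> A" "v \<noteq> u" using less.prems(3) by blast
    then show ?thesis using IH[of u v] less.prems(3) by blast
  qed
qed

text \<open>Positive points are the right test set: \<open>1 + X (Cr j)\<close> does not vanish
  there, so the identity attached to a braid move is available at all of them.\<close>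

lemma laurent_eqI:
  assumes "\<And>a. (\<And>F. a F > 0) \<Longrightarrow>
    laurent_eval f (\<lambda>F. complex_of_real (a F)) = laurent_eval g (\<lambda>F. complex_of_real (a F))"
  shows "f = g"
proof (rule poly_mapping_eqI)
  fix u
  let ?A = "insert u (Poly_Mapping.keys f \<union> Poly_Mapping.keys g)"
  have "complex_of_int (Poly_Mapping.lookup f u - Poly_Mapping.lookup g u) = 0"
  proof (rule monom_eval_independent[of ?A])
    fix a :: "face \<Rightarrow> real" assume "\<And>F. a F > 0"
    then have "laurent_eval f (\<lambda>F. complex_of_real (a F)) = laurent_eval g (\<lambda>F. complex_of_real (a F))"
      by (rule assms)
    moreover have "laurent_eval f X = (\<Sum>u\<in>?A. of_int (Poly_Mapping.lookup f u) * monom_eval X u)"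
      "laurent_eval g X = (\<Sum>u\<in>?A. of_int (Poly_Mapping.lookup g u) * monom_eval X u)" for X
      by (rule laurent_eval_superset; auto)+
    ultimately show "(\<Sum>u\<in>?A. complex_of_int (Poly_Mapping.lookup f u - Poly_Mapping.lookup g u) *
        monom_eval (\<lambda>F. complex_of_real (a F)) u) = 0"
      by (simp only: of_int_diff left_diff_distrib sum_subtractf) simp
  qed auto
  then show "Poly_Mapping.lookup f u = Poly_Mapping.lookup g u" by simp
qed

text \<open>Nonnegative coefficients cannot cancel; this lets the tropicalization see every summand
  of the superpotential.\<close>

lemma keys_nonneg_add:
  fixes f g :: laurent
  assumes "\<And>u. Poly_Mapping.lookup f u \<ge> 0" "\<And>u. Poly_Mapping.lookup g u \<ge> 0"
  shows "Poly_Mapping.keys (f + g) = Poly_Mapping.keys f \<union> Poly_Mapping.keys g"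
  using assms by (auto simp: in_keys_iff lookup_add) (smt (verit))+

lemma lookup_monom_sum_nonneg: "Poly_Mapping.lookup (\<Sum>a\<in>A. laurent_monom (u a)) v \<ge> 0"
  by (induction A rule: infinite_finite_induct) (auto simp: lookup_add lookup_single when_def)

lemma keys_monom_sum:
  "finite A \<Longrightarrow> Poly_Mapping.keys (\<Sum>a\<in>A. laurent_monom (u a)) = u ` A"
proof (induction A rule: finite_induct)
  case (insert a A)
  have "Poly_Mapping.lookup (laurent_monom (u a)) v \<ge> 0" for v
    by (auto simp: lookup_single when_def)
  then show ?case using insert by (simp add: keys_nonneg_add lookup_monom_sum_nonneg)
qed simp

lemma pairing_superset:
  "finite A \<Longrightarrow> Poly_Mapping.keys u \<subseteq> A \<Longrightarrow>
    pairing u x = (\<Sum>F\<in>A. of_int (Poly_Mapping.lookup u F) * x F)"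
  unfolding pairing_def by (rule sum.mono_neutral_left) (auto simp: in_keys_iff)

lemma pairing_add: "pairing (u + v) x = pairing u x + pairing v x"
proof -
  let ?A = "Poly_Mapping.keys u \<union> Poly_Mapping.keys v"
  have "pairing (u + v) x = (\<Sum>F\<in>?A. of_int (Poly_Mapping.lookup (u + v) F) * x F)"
    using Poly_Mapping.keys_add[of u v] by (intro pairing_superset) auto
  then show ?thesis
    by (simp add: pairing_superset[of ?A] lookup_add algebra_simps sum.distrib)
qed

lemma trop_nonneg_iff:
  "trop f x \<ge> 0 \<longleftrightarrow> (\<forall>u\<in>Poly_Mapping.keys f. pairing u x \<ge> 0)"
  by (simp add: trop_def le_INF_iff)

section \<open>Histories of particles\<close>

text \<open>A configuration of particles at the heights of the diagram is encoded by its profile, which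
  gives for each level \<open>r\<close> the number of particles above this level. At a crossing of level \<open>s\<close>, a
  particle at height \<open>s\<close> may hop to height \<open>Suc s\<close> if this is free. A history lists the profiles in all
  columns. The profiles are compared backwards, so \<open>hop_preds s M\<close> consists of the possible
  profiles before the crossing.\<close>

type_synonym profile = "nat \<Rightarrow> int"

definition hop_preds :: "nat \<Rightarrow> profile \<Rightarrow> profile set" where
  "hop_preds s M = insert M
     (if M (s - 1) = M s \<and> M s = M (Suc s) + 1 then {M(s := M s - 1)} else {})"

definition histories :: "profile \<Rightarrow> nat list \<Rightarrow> profile \<Rightarrow> profile list set" where
  "histories N w M = {h. length h = Suc (length w) \<and> h ! 0 = N \<and> h ! length w = M \<and>
     (\<forall>j<length w. h ! j \<in> hop_preds (w ! j) (h ! Suc j))}"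

text \<open>The number of particles above a face is constant along the face, since only the
  crossings at its ends can change it. It is read in the leftmost column, which is column 0 or the
  column after the left endpoint.\<close>

definition history_weight ::
    "nat \<Rightarrow> (face \<Rightarrow> complex) \<Rightarrow> nat list \<Rightarrow> profile list \<Rightarrow> complex" where
  "history_weight n X w h = (\<Prod>r\<in>{1..<n}. X (Unb r) powi (h ! 0) r) *
     (\<Prod>k<length w. X (Cr k) powi (h ! Suc k) (w ! k))"

definition history_sum ::
    "nat \<Rightarrow> (face \<Rightarrow> complex) \<Rightarrow> profile \<Rightarrow> nat list \<Rightarrow> profile \<Rightarrow> complex" where
  "history_sum n X N w M = (\<Sum>h\<in>histories N w M. history_weight n X w h)"

lemma finite_hop_preds [simp]: "finite (hop_preds s M)"
  by (simp add: hop_preds_def)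

lemma histories_Nil: "histories N [] M = (if N = M then {[M]} else {})"
  by (auto simp: histories_def length_Suc_conv)

lemma histories_snoc:
  "histories N (w @ [s]) M = (\<Union>M0\<in>hop_preds s M. (\<lambda>h. h @ [M]) ` histories N w M0)"
proof (intro set_eqI iffI)
  fix h assume h: "h \<in> histories N (w @ [s]) M"
  then have l: "length h = Suc (Suc (length w))" by (simp add: histories_def)
  have e: "h = take (Suc (length w)) h @ [M]"
    using h l take_Suc_conv_app_nth[of "Suc (length w)" h] by (simp add: histories_def)
  moreover have "h ! length w \<in> hop_preds s M"
    using h unfolding histories_def by (auto simp: nth_append dest: spec[of _ "length w"])
  moreover have "take (Suc (length w)) h \<in> histories N w (h ! length w)"
    using h l unfolding histories_def by (auto simp: nth_append split: if_splits)
  ultimately show "h \<in> (\<Union>M0\<in>hop_preds s M. (\<lambda>h. h @ [M]) ` histories N w M0)" by blast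
next
  fix h assume "h \<in> (\<Union>M0\<in>hop_preds s M. (\<lambda>h. h @ [M]) ` histories N w M0)"
  then show "h \<in> histories N (w @ [s]) M"
    unfolding histories_def by (auto simp: nth_append less_Suc_eq)
qed

lemma finite_histories [simp]: "finite (histories N w M)"
  by (induction w arbitrary: M rule: rev_induct) (auto simp: histories_Nil histories_snoc)

lemma history_weight_snoc:
  "length h = Suc (length w) \<Longrightarrow> history_weight n X (w @ [s]) (h @ [M]) =
    history_weight n X w h * X (Cr (length w)) powi M s"
  by (simp add: history_weight_def nth_append)

lemma history_sum_Nil:
  "history_sum n X N [] M = (if N = M then \<Prod>r\<in>{1..<n}. X (Unb r) powi N r else 0)"
  by (simp add: history_sum_def histories_Nil history_weight_def)

text \<open>Transfer rule of a single crossing: appending a letter leaves the earlier faces and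
  their exponents alone and adds one face.\<close>

lemma history_sum_snoc:
  "history_sum n X N (w @ [s]) M =
    X (Cr (length w)) powi M s * (\<Sum>M0\<in>hop_preds s M. history_sum n X N w M0)"
proof -
  have "history_sum n X N (w @ [s]) M =
    (\<Sum>M0\<in>hop_preds s M. \<Sum>h\<in>(\<lambda>h. h @ [M]) ` histories N w M0. history_weight n X (w @ [s]) h)"
    unfolding history_sum_def histories_snoc
    by (rule sum.UNION_disjoint) (auto, auto simp: histories_def)
  also have "\<dots> = (\<Sum>M0\<in>hop_preds s M. history_sum n X N w M0 * X (Cr (length w)) powi M s)"
  proof (rule sum.cong[OF refl])
    fix M0
    have "(\<Sum>h\<in>(\<lambda>h. h @ [M]) ` histories N w M0. history_weight n X (w @ [s]) h)
      = (\<Sum>h\<in>histories N w M0. history_weight n X (w @ [s]) (h @ [M]))"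
      by (rule sum.reindex_cong[of "\<lambda>h. h @ [M]"]) (auto simp: inj_on_def)
    also have "\<dots> = history_sum n X N w M0 * X (Cr (length w)) powi M s"
      unfolding history_sum_def sum_distrib_right
      by (rule sum.cong[OF refl], rule history_weight_snoc) (simp add: histories_def)
    finally show "(\<Sum>h\<in>(\<lambda>h. h @ [M]) ` histories N w M0. history_weight n X (w @ [s]) h)
      = history_sum n X N w M0 * X (Cr (length w)) powi M s" .
  qed
  finally show ?thesis by (simp add: sum_distrib_right[symmetric] mult.commute)
qed

lemma history_sum_cong:
  assumes "\<And>r. X (Unb r) = Y (Unb r)" "\<And>k. k < length w \<Longrightarrow> X (Cr k) = Y (Cr k)"
  shows "history_sum n X N w M = history_sum n Y N w M"
  unfolding history_sum_def history_weight_def using assms by auto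

text \<open>The face of level \<open>r\<close> that is still open at the right end of
  \<open>w\<close>. For a prefix of a longer word this is \<open>left_face\<close>, but it obeys a
  recursion in the last letter.\<close>

definition cur_face :: "nat list \<Rightarrow> nat \<Rightarrow> face" where
  "cur_face w r = (if \<exists>k<length w. w ! k = r then Cr (Max {k. k < length w \<and> w ! k = r}) else Unb r)"

lemma cur_face_Nil [simp]: "cur_face [] r = Unb r"
  by (simp add: cur_face_def)

lemma cur_face_snoc: "cur_face (w @ [s]) r = (if s = r then Cr (length w) else cur_face w r)"
proof (cases "s = r")
  case True
  have "Max {k. k < length (w @ [s]) \<and> (w @ [s]) ! k = r} = length w"
    using True by (intro Max_eqI) auto
  then show ?thesis using True by (auto simp: cur_face_def intro: exI[of _ "length w"])
next
  case False
  have "k < length (w @ [s]) \<and> (w @ [s]) ! k = r \<longleftrightarrow> k < length w \<and> w ! k = r" for k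
    using False by (auto simp: nth_append less_Suc_eq)
  then show ?thesis using False by (simp only: cur_face_def if_False)
qed

lemma left_face_eq_cur_face: "j \<le> length w \<Longrightarrow> left_face w j = cur_face (take j w) (w ! j)"
proof -
  assume "j \<le> length w"
  then have "k < length (take j w) \<and> take j w ! k = w ! j \<longleftrightarrow> k < j \<and> w ! k = w ! j" for k
    by auto
  then show ?thesis by (simp only: cur_face_def left_face_def)
qed

lemma cur_face_cases:
  obtains "cur_face w r = Unb r" | k where "cur_face w r = Cr k" "k < length w" "w ! k = r"
proof (cases "\<exists>k<length w. w ! k = r")
  case True
  then have "Max {k. k < length w \<and> w ! k = r} \<in> {k. k < length w \<and> w ! k = r}"
    by (intro Max_in) auto
  then show ?thesis using that True by (auto simp: cur_face_def)
qed (use that in \<open>simp add: cur_face_def\<close>)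

lemma cur_face_inj: "cur_face w r = cur_face w s \<longleftrightarrow> r = s"
  by (metis cur_face_cases face.distinct(1) face.inject)

lemma cur_face_neq_Cr: "length w \<le> k \<Longrightarrow> cur_face w r \<noteq> Cr k"
  by (metis cur_face_cases face.distinct(1) face.inject(2) leD)

lemma hop_preds_other: "M0 \<in> hop_preds s M \<Longrightarrow> r \<noteq> s \<Longrightarrow> M0 r = M r"
  by (auto simp: hop_preds_def split: if_splits)

text \<open>After the last crossing of level \<open>r\<close> nothing changes at this level, so
  every history that ends in \<open>M\<close> has the exponent \<open>M r\<close> at the open
  face.\<close>

lemma history_sum_scale:
  assumes "r \<in> {1..<n}" "\<And>F. F \<noteq> cur_face w r \<Longrightarrow> Y F = X F"
    "Y (cur_face w r) = c * X (cur_face w r)"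
  shows "history_sum n Y N w M = c powi M r * history_sum n X N w M"
  using assms(2,3)
proof (induction w arbitrary: M Y rule: rev_induct)
  case Nil
  have "(\<Prod>i\<in>{1..<n}. Y (Unb i) powi N i) =
      Y (Unb r) powi N r * (\<Prod>i\<in>{1..<n} - {r}. Y (Unb i) powi N i)"
    using assms(1) by (intro prod.remove) auto
  also have "(\<Prod>i\<in>{1..<n} - {r}. Y (Unb i) powi N i) = (\<Prod>i\<in>{1..<n} - {r}. X (Unb i) powi N i)"
    using Nil by (intro prod.cong) auto
  also have "Y (Unb r) powi N r = c powi N r * X (Unb r) powi N r"
    using Nil by (simp add: power_int_mult_distrib)
  also have "c powi N r * X (Unb r) powi N r * (\<Prod>i\<in>{1..<n} - {r}. X (Unb i) powi N i) =
      c powi N r * (X (Unb r) powi N r * (\<Prod>i\<in>{1..<n} - {r}. X (Unb i) powi N i))"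
    by simp
  also have "X (Unb r) powi N r * (\<Prod>i\<in>{1..<n} - {r}. X (Unb i) powi N i) =
      (\<Prod>i\<in>{1..<n}. X (Unb i) powi N i)"
    using assms(1) by (intro prod.remove[symmetric]) auto
  finally show ?case by (auto simp: history_sum_Nil)
next
  case (snoc s w)
  show ?case
  proof (cases "s = r")
    case True
    have "history_sum n Y N w M0 = history_sum n X N w M0" for M0
      using snoc.prems True by (intro history_sum_cong) (auto simp: cur_face_snoc)
    then show ?thesis
      using snoc.prems True by (simp add: history_sum_snoc cur_face_snoc power_int_mult_distrib)
  next
    case False
    have "(\<Sum>M0\<in>hop_preds s M. history_sum n Y N w M0) =
        (\<Sum>M0\<in>hop_preds s M. c powi M r * history_sum n X N w M0)"
    proof (rule sum.cong[OF refl])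
      fix M0 assume "M0 \<in> hop_preds s M"
      then show "history_sum n Y N w M0 = c powi M r * history_sum n X N w M0"
        using snoc False hop_preds_other[of M0 s M r] by (simp add: cur_face_snoc)
    qed
    moreover have "Y (Cr (length w)) = X (Cr (length w))"
      using snoc.prems(1)[of "Cr (length w)"] False cur_face_neq_Cr[of w "length w" r]
      by (auto simp: cur_face_snoc)
    ultimately show ?thesis by (simp add: history_sum_snoc sum_distrib_left mult_ac)
  qed
qed

section \<open>Invariance of the history sums under the moves\<close>

definition is_profile :: "profile \<Rightarrow> bool" where
  "is_profile M \<longleftrightarrow> (\<forall>r. M r = M (Suc r) \<or> M r = M (Suc r) + 1)"

lemma is_profile_hop_preds:
  assumes "is_profile M" "M0 \<in> hop_preds s M" "s \<ge> 1"
  shows "is_profile M0"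
  unfolding is_profile_def
proof
  fix r
  show "M0 r = M0 (Suc r) \<or> M0 r = M0 (Suc r) + 1"
    using assms(1)[unfolded is_profile_def, THEN spec, of r] assms(2,3)
    by (cases "Suc r = s") (auto simp: hop_preds_def split: if_splits)
qed

lemma sum_hop_preds:
  "sum f (hop_preds s M) =
    f M + (if M (s - 1) = M s \<and> M s = M (Suc s) + 1 then f (M(s := M s - 1)) else 0)"
proof -
  have "M \<noteq> M(s := M s - 1)" by (metis fun_upd_same less_irrefl diff_less_eq less_add_one)
  then show ?thesis unfolding hop_preds_def
    by (cases "M (s - 1) = M s \<and> M s = M (Suc s) + 1") (simp_all only: if_True if_False, simp_all)
qed

text \<open>The local identity behind the invariance of the superpotential: three consecutive crossings
  of levels \<open>m\<close>, \<open>Suc m\<close> only see the profile at the four levels from \<open>m - 1\<close> to \<open>m + 2\<close>.\<close>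

lemma braid_identity:
  fixes g :: "profile \<Rightarrow> complex" and y :: complex
  assumes "is_profile M" "y \<noteq> 0" "1 + y \<noteq> 0" "r = Suc t \<or> t = Suc r" "r \<ge> 1" "t \<ge> 1"
  shows "inverse (1 + inverse y) powi M r * (1 + y) powi M t *
      (\<Sum>M2\<in>hop_preds r M. \<Sum>M1\<in>hop_preds t M2. inverse y powi M1 r *
        (\<Sum>M0\<in>hop_preds r M1. (1 + y) powi M0 r * inverse (1 + inverse y) powi M0 t * g M0))
    = (\<Sum>M2\<in>hop_preds t M. \<Sum>M1\<in>hop_preds r M2. y powi M1 t * (\<Sum>M0\<in>hop_preds t M1. g M0))"
proof -
  define c where "c = 1 + y"
  have c: "c \<noteq> 0" using assms(3) by (simp add: c_def)
  have yy: "inverse (1 + inverse y) = y / c" using assms(2,3) by (simp add: c_def field_simps)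
  \<comment> \<open>With the smaller level as reference, the two orders of \<open>r\<close> and
    \<open>t\<close> share one computation.\<close>
  define m where "m = min r t"
  have m: "m \<ge> 1" "r = m \<and> t = Suc m \<or> r = Suc m \<and> t = m" using assms unfolding m_def by auto
  \<comment> \<open>The profile exceeds its value \<open>z\<close> above both crossings by at most
    3, so all powers become small powers of \<open>y\<close> and \<open>c\<close> times the nonzero
    constants \<open>p\<close> and \<open>q\<close>.\<close>
  define z where "z = M (Suc (Suc m))"
  define p where "p = y powi z"
  define q where "q = c powi z"
  have [simp]: "p \<noteq> 0" "q \<noteq> 0" "y \<noteq> 0" "c \<noteq> 0" using c assms(2) by (simp_all add: p_def q_def)
  have pw: "y powi z = p" "y powi (1 + z) = y * p" "y powi (2 + z) = y * y * p" "y powi (3 + z) = y * y * y * p"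
    "c powi z = q" "c powi (1 + z) = c * q" "c powi (2 + z) = c * c * q" "c powi (3 + z) = c * c * c * q"
    by (simp_all add: p_def q_def power_int_add power2_eq_square power3_eq_cube)
  have M3 [simp]: "M (Suc (Suc m)) = z" by (simp add: z_def)
  have ms [simp]: "m - Suc 0 \<noteq> m" "Suc (m - Suc 0) = m" "m \<noteq> m - Suc 0" "m - Suc 0 \<noteq> Suc m"
    using m by auto
  have tw: "f(Suc m := a, m := b) = f(m := b, Suc m := a)" for f :: profile and a b
    by (rule fun_upd_twist) simp
  have Mvals: "M (m - Suc 0) = M m \<or> M (m - Suc 0) = 1 + M m"
    "M m = M (Suc m) \<or> M m = 1 + M (Suc m)" "M (Suc m) = z \<or> M (Suc m) = 1 + z"
  proof -
    have P: "M i = M (Suc i) \<or> M i = 1 + M (Suc i)" for i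
      using assms(1) unfolding is_profile_def by (metis add.commute)
    show "M (m - Suc 0) = M m \<or> M (m - Suc 0) = 1 + M m" using P[of "m - Suc 0"] by (simp only: ms)
    show "M m = M (Suc m) \<or> M m = 1 + M (Suc m)" by (rule P)
    show "M (Suc m) = z \<or> M (Suc m) = 1 + z" using P[of "Suc m"] by (simp only: M3)
  qed
  \<comment> \<open>Eight occupation patterns of the heights \<open>m\<close>, \<open>m + 1\<close>,
    \<open>m + 2\<close>, for each of the two orders of the levels; every case is a rational
    identity in \<open>y\<close>.\<close>
  show ?thesis
    unfolding yy c_def[symmetric] sum_hop_preds using m(2) Mvals
    apply (elim disjE conjE)
    apply (simp_all add: tw power_int_divide_distrib power_int_inverse pw)
    apply (simp_all add: divide_simps)
    apply (simp_all add: c_def algebra_simps)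
    done
qed

text \<open>Both sides obey the same transfer rule on the common suffix. Profiles stay profiles when
  followed backwards, so equality on profiles is enough.\<close>

lemma history_sum_suffix:
  assumes "\<And>M. is_profile M \<Longrightarrow> history_sum n X N u M = history_sum n Y N u' M"
    and "length u' = length u" "simple_word m v" "\<And>k. length u \<le> k \<Longrightarrow> X (Cr k) = Y (Cr k)"
    and "is_profile M"
  shows "history_sum n X N (u @ v) M = history_sum n Y N (u' @ v) M"
  using assms(3,5)
proof (induction v arbitrary: M rule: rev_induct)
  case (snoc s v)
  have "sum (history_sum n X N (u @ v)) (hop_preds s M) =
      sum (history_sum n Y N (u' @ v)) (hop_preds s M)"
    using snoc is_profile_hop_preds[of M _ s] by (intro sum.cong) auto
  then show ?case
    using assms(2,4) unfolding append_assoc[symmetric] history_sum_snoc by simp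
qed (use assms(1) in simp)

context
  fixes u v :: "nat list" and r t :: nat
  assumes rt: "r = Suc t \<or> t = Suc r"
begin

text \<open>As \<open>r\<close> and \<open>t\<close> differ, the two neighbours to the left of the
  mutated face are open faces of the prefix \<open>u\<close>, under the same names in both
  words.\<close>

lemma mutation_coords_braid:
  "mutation_coords (u @ r # t # r # v) (length u) (u @ t # r # t # v) X' =
    (\<lambda>E. if E = Cr (length u) then inverse (X' (Cr (length u)))
     else if E = cur_face u r then X' E * (1 + X' (Cr (length u)))
     else if E = Cr (length u + 1) then X' (Cr (length u + 2)) * (1 + X' (Cr (length u)))
     else if E = Cr (length u + 2) then X' (Cr (length u + 1)) * inverse (1 + inverse (X' (Cr (length u))))
     else if E = cur_face u t then X' E * inverse (1 + inverse (X' (Cr (length u))))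
     else X' E)"
proof -
  let ?w = "u @ r # t # r # v" and ?w' = "u @ t # r # t # v" and ?j = "length u"
  have ne: "r \<noteq> t" using rt by auto
  have "left_face ?w ?j = cur_face u r" "left_face ?w' ?j = cur_face u t"
    by (simp_all add: left_face_eq_cur_face)
  moreover have "left_face ?w (?j + 1) = cur_face (u @ [r]) t" "left_face ?w' (?j + 1) = cur_face (u @ [t]) r"
    by (simp_all add: left_face_eq_cur_face nth_append)
  ultimately show ?thesis
    using ne unfolding mutation_coords_def by (intro ext) (simp add: cur_face_snoc)
qed

text \<open>Apart from the three crossings, the mutation only rescales the two open faces of
  \<open>u\<close>, which is the situation of \<open>history_sum_scale\<close>.\<close>

lemma mutation_coords_values:
  fixes X' :: "face \<Rightarrow> complex"
  defines "X \<equiv> mutation_coords (u @ r # t # r # v) (length u) (u @ t # r # t # v) X'"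
    and "y \<equiv> X' (Cr (length u))"
  shows "X (Cr (length u)) = inverse y"
    and "X (Cr (Suc (length u))) = (1 + y) * X' (Cr (Suc (Suc (length u))))"
    and "X (Cr (Suc (Suc (length u)))) = inverse (1 + inverse y) * X' (Cr (Suc (length u)))"
    and "length u + 3 \<le> k \<Longrightarrow> X (Cr k) = X' (Cr k)"
    and "F \<notin> Cr ` {length u..length u + 2} \<Longrightarrow> X F =
      (X'(cur_face u t := inverse (1 + inverse y) * X' (cur_face u t),
        cur_face u r := (1 + y) * X' (cur_face u r))) F"
proof -
  have ne: "r \<noteq> t" using rt by auto
  have cf: "cur_face u s \<noteq> Cr (length u)" "cur_face u s \<noteq> Cr (length u + 1)"
    "cur_face u s \<noteq> Cr (length u + 2)" for s by (simp_all add: cur_face_neq_Cr)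
  show "X (Cr (length u)) = inverse y"
    "X (Cr (Suc (length u))) = (1 + y) * X' (Cr (Suc (Suc (length u))))"
    "X (Cr (Suc (Suc (length u)))) = inverse (1 + inverse y) * X' (Cr (Suc (length u)))"
    unfolding X_def y_def mutation_coords_braid using cf[of r] cf[of t] by auto
  show "length u + 3 \<le> k \<Longrightarrow> X (Cr k) = X' (Cr k)"
    unfolding X_def mutation_coords_braid
    using cur_face_neq_Cr[of u k r] cur_face_neq_Cr[of u k t] by auto
  assume "F \<notin> Cr ` {length u..length u + 2}"
  then show "X F = (X'(cur_face u t := inverse (1 + inverse y) * X' (cur_face u t),
      cur_face u r := (1 + y) * X' (cur_face u r))) F"
    unfolding X_def y_def mutation_coords_braid
    using ne by (auto simp: cur_face_inj mult.commute)
qed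

text \<open>Rescaling the open faces of \<open>u\<close> gives the inner powers of \<open>?a\<close>
  and \<open>?b\<close>, and the two neighbours to the right give the outer ones. What remains for
  the three crossings in the middle is \<open>braid_identity\<close>.\<close>

lemma history_sum_braid:
  assumes "simple_word n (u @ r # t # r # v)" "\<And>F. X' F \<noteq> 0" "1 + X' (Cr (length u)) \<noteq> 0"
    and "is_profile M"
  shows "history_sum n (mutation_coords (u @ r # t # r # v) (length u) (u @ t # r # t # v) X')
      N (u @ r # t # r # v) M = history_sum n X' N (u @ t # r # t # v) M"
proof -
  define X where "X = mutation_coords (u @ r # t # r # v) (length u) (u @ t # r # t # v) X'"
  define y where "y = X' (Cr (length u))"
  let ?a = "1 + y" and ?b = "inverse (1 + inverse y)"
  have ne: "r \<noteq> t" using rt by auto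
  have rt': "r \<in> {1..<n}" "t \<in> {1..<n}" and v: "simple_word n v" using assms(1) by auto
  note vals = mutation_coords_values[where X' = X', folded X_def y_def]
  have prefix: "history_sum n X N u M0 = ?a powi M0 r * ?b powi M0 t * history_sum n X' N u M0" for M0
  proof -
    let ?Y = "X'(cur_face u t := ?b * X' (cur_face u t))"
    let ?Z = "?Y(cur_face u r := ?a * X' (cur_face u r))"
    have "history_sum n X N u M0 = history_sum n ?Z N u M0"
      by (rule history_sum_cong; rule vals(5)) auto
    also have "\<dots> = ?a powi M0 r * history_sum n ?Y N u M0"
      by (rule history_sum_scale[OF rt'(1)]) (auto simp: cur_face_inj ne)
    also have "history_sum n ?Y N u M0 = ?b powi M0 t * history_sum n X' N u M0"
      by (rule history_sum_scale[OF rt'(2)]) auto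
    finally show ?thesis by simp
  qed
  have yn: "y \<noteq> 0" "1 + y \<noteq> 0" using assms(2,3) by (auto simp: y_def)
  have M2: "M2 t = M t" if "M2 \<in> hop_preds r M" for M2 M using hop_preds_other[OF that] ne by simp
  have M2': "M2 r = M r" if "M2 \<in> hop_preds t M" for M2 M using hop_preds_other[OF that] ne by simp
  have mid: "history_sum n X N (u @ [r, t, r]) M = history_sum n X' N (u @ [t, r, t]) M" if "is_profile M" for M
  proof -
    let ?x = "X' (Cr (Suc (length u)))" and ?z = "X' (Cr (Suc (Suc (length u))))"
    have e: "u @ [a, b, c] = ((u @ [a]) @ [b]) @ [c]" for a b c by simp
    have "history_sum n X N (u @ [r, t, r]) M = X (Cr (Suc (Suc (length u)))) powi M r *
      (\<Sum>M2\<in>hop_preds r M. X (Cr (Suc (length u))) powi M2 t * (\<Sum>M1\<in>hop_preds t M2. X (Cr (length u)) powi M1 r *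
        (\<Sum>M0\<in>hop_preds r M1. history_sum n X N u M0)))"
      unfolding e history_sum_snoc by simp
    also have "\<dots> = ?x powi M r * ?b powi M r *
      (\<Sum>M2\<in>hop_preds r M. ?z powi M t * ?a powi M t * (\<Sum>M1\<in>hop_preds t M2. inverse y powi M1 r *
        (\<Sum>M0\<in>hop_preds r M1. ?a powi M0 r * ?b powi M0 t * history_sum n X' N u M0)))"
      unfolding prefix vals(1-3) by (simp add: M2 power_int_mult_distrib mult_ac)
    also have "\<dots> = ?x powi M r * ?z powi M t * (?b powi M r * ?a powi M t *
      (\<Sum>M2\<in>hop_preds r M. \<Sum>M1\<in>hop_preds t M2. inverse y powi M1 r *
        (\<Sum>M0\<in>hop_preds r M1. ?a powi M0 r * ?b powi M0 t * history_sum n X' N u M0)))"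
      by (simp add: sum_distrib_left[symmetric] mult_ac)
    also have "\<dots> = ?x powi M r * ?z powi M t *
      (\<Sum>M2\<in>hop_preds t M. \<Sum>M1\<in>hop_preds r M2. y powi M1 t *
        (\<Sum>M0\<in>hop_preds t M1. history_sum n X' N u M0))"
      by (subst braid_identity[OF that yn rt]) (use rt' in auto)
    also have "\<dots> = ?z powi M t * (\<Sum>M2\<in>hop_preds t M. ?x powi M r * (\<Sum>M1\<in>hop_preds r M2. y powi M1 t *
        (\<Sum>M0\<in>hop_preds t M1. history_sum n X' N u M0)))"
      by (simp add: sum_distrib_left[symmetric] mult_ac)
    also have "\<dots> = ?z powi M t * (\<Sum>M2\<in>hop_preds t M. ?x powi M2 r * (\<Sum>M1\<in>hop_preds r M2. y powi M1 t *
        (\<Sum>M0\<in>hop_preds t M1. history_sum n X' N u M0)))"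
      by (simp add: M2')
    also have "\<dots> = history_sum n X' N (u @ [t, r, t]) M"
      unfolding e history_sum_snoc by (simp add: y_def)
    finally show ?thesis .
  qed
  have "history_sum n X N ((u @ [r, t, r]) @ v) M = history_sum n X' N ((u @ [t, r, t]) @ v) M"
    by (rule history_sum_suffix[OF mid _ v vals(4) assms(4)]) auto
  then show ?thesis by (simp add: X_def)
qed

end

text \<open>A hop at level \<open>s\<close> reads the levels \<open>s - 1\<close>, \<open>s\<close>,
  \<open>s + 1\<close> and changes only \<open>s\<close>, so hops at levels of distance at least two
  do not see each other.\<close>

lemma history_sum_commutation:
  assumes "s + 2 \<le> t \<or> t + 2 \<le> s" "simple_word n (u @ s # t # v)" "is_profile M"
  shows "history_sum n (commutation_coords (length u) X) N (u @ s # t # v) M =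
    history_sum n X N (u @ t # s # v) M"
proof -
  let ?Y = "commutation_coords (length u) X"
  have Y: "?Y (Cr k) = X (Cr (if k = length u then Suc (length u) else if k = Suc (length u) then length u else k))"
    "?Y (Unb k) = X (Unb k)" for k
    by (auto simp: commutation_coords_def transpose_def)
  have prefix: "history_sum n ?Y N u M0 = history_sum n X N u M0" for M0
    by (rule history_sum_cong) (auto simp: Y)
  have mid: "history_sum n ?Y N (u @ [s, t]) M = history_sum n X N (u @ [t, s]) M" for M
  proof -
    have e: "u @ [a, b] = (u @ [a]) @ [b]" for a b by simp
    let ?x = "X (Cr (length u))" and ?z = "X (Cr (Suc (length u)))"
    have st: "s \<noteq> t" using assms(1) by auto
    have "history_sum n ?Y N (u @ [s, t]) M = ?x powi M t * ?z powi M s *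
        (\<Sum>M1\<in>hop_preds t M. \<Sum>M0\<in>hop_preds s M1. history_sum n X N u M0)"
      unfolding e history_sum_snoc prefix using st hop_preds_other[of _ t M s]
      by (simp add: Y sum_distrib_left mult_ac)
    also have "(\<Sum>M1\<in>hop_preds t M. \<Sum>M0\<in>hop_preds s M1. history_sum n X N u M0) =
        (\<Sum>M1\<in>hop_preds s M. \<Sum>M0\<in>hop_preds t M1. history_sum n X N u M0)"
    proof -
      have "M(t := a, s := b) = M(s := b, t := a)" for a b using st by (rule fun_upd_twist[symmetric])
      moreover have "s \<noteq> t - 1" "s \<noteq> Suc t" "t \<noteq> s - 1" "t \<noteq> Suc s" using assms(1) assms(2) by auto
      ultimately show ?thesis using st by (simp add: sum_hop_preds)
    qed
    also have "?x powi M t * ?z powi M s *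
        (\<Sum>M1\<in>hop_preds s M. \<Sum>M0\<in>hop_preds t M1. history_sum n X N u M0) =
      history_sum n X N (u @ [t, s]) M"
      unfolding e history_sum_snoc using st hop_preds_other[of _ s M t]
      by (simp add: sum_distrib_left mult_ac)
    finally show ?thesis .
  qed
  have "history_sum n ?Y N ((u @ [s, t]) @ v) M = history_sum n X N ((u @ [t, s]) @ v) M"
    by (rule history_sum_suffix[where m = n, OF mid _ _ _ assms(3)]) (use assms(2) in \<open>auto simp: Y\<close>)
  then show ?thesis by simp
qed

section \<open>The level sums\<close>

definition level_sum :: "(face \<Rightarrow> complex) \<Rightarrow> nat list \<Rightarrow> nat \<Rightarrow> complex" where
  "level_sum X w i = (\<Sum>k<length (level_crossings w i). monom_eval X (level_vec w i k))"

text \<open>State of the recursion for \<open>level_sum\<close>: a new crossing of level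
  \<open>i\<close> adds the current product to the sum and then extends the product by its
  face.\<close>

definition level_prod :: "(face \<Rightarrow> complex) \<Rightarrow> nat list \<Rightarrow> nat \<Rightarrow> complex" where
  "level_prod X w i = monom_eval X (level_vec w i (length (level_crossings w i)))"

lemma level_crossings_Nil [simp]: "level_crossings [] i = []"
  by (simp add: level_crossings_def)

lemma level_crossings_snoc:
  "level_crossings (w @ [s]) i = level_crossings w i @ (if s = i then [length w] else [])"
proof -
  have "filter (\<lambda>j. (w @ [s]) ! j = i) [0..<length w] = filter (\<lambda>j. w ! j = i) [0..<length w]"
    by (rule filter_cong) (auto simp: nth_append)
  then show ?thesis by (simp add: level_crossings_def)
qed

lemma level_vec_snoc:
  "k \<le> length (level_crossings w i) \<Longrightarrow> level_vec (w @ [s]) i k = level_vec w i k"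
  by (simp add: level_vec_def level_crossings_snoc)

lemma level_sum_Nil [simp]: "level_sum X [] i = 0"
  by (simp add: level_sum_def)

lemma level_prod_Nil [simp]: "level_prod X [] i = inverse (X (Unb i))"
  by (simp add: level_prod_def level_vec_def monom_eval_uminus)

lemma level_sum_snoc:
  "level_sum X (w @ [s]) i = level_sum X w i + (if s = i then level_prod X w i else 0)"
proof -
  have "(\<Sum>k<length (level_crossings w i). monom_eval X (level_vec (w @ [s]) i k)) = level_sum X w i"
    unfolding level_sum_def by (intro sum.cong) (auto simp: level_vec_snoc)
  then show ?thesis
    by (cases "s = i")
      (simp_all add: level_sum_def level_prod_def level_vec_snoc level_crossings_snoc)
qed

lemma level_prod_snoc:
  assumes "\<And>F. X F \<noteq> 0"
  shows "level_prod X (w @ [s]) i =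
    level_prod X w i * (if s = i then inverse (X (Cr (length w))) else 1)"
proof (cases "s = i")
  case True
  have "level_vec (w @ [s]) i (length (level_crossings (w @ [s]) i)) =
      level_vec w i (length (level_crossings w i)) - basis_vec (Cr (length w))"
    using True by (simp add: level_vec_def level_crossings_snoc)
  then show ?thesis using True assms by (simp add: level_prod_def monom_eval_diff)
qed (simp add: level_prod_def level_vec_snoc level_crossings_snoc)

lemma level_cong:
  assumes "\<And>F. X F \<noteq> 0" "\<And>F. Y F \<noteq> 0" "\<And>r. X (Unb r) = Y (Unb r)"
    and "\<And>k. k < length w \<Longrightarrow> X (Cr k) = Y (Cr k)"
  shows "level_sum X w i = level_sum Y w i \<and> level_prod X w i = level_prod Y w i"
  using assms(4)
  by (induction w rule: rev_induct) (auto simp: level_sum_snoc level_prod_snoc assms(1-3))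

text \<open>The monomials of \<open>level_sum\<close> stop short of the open face, so rescaling it
  affects only the full product.\<close>

lemma level_scale:
  assumes "\<And>F. X F \<noteq> 0" "\<And>F. Y F \<noteq> 0" "\<And>F. F \<noteq> cur_face w r \<Longrightarrow> Y F = X F"
    "Y (cur_face w r) = c * X (cur_face w r)"
  shows "level_sum Y w i = level_sum X w i \<and>
    level_prod Y w i = (if i = r then inverse c else 1) * level_prod X w i"
  using assms(3,4)
proof (induction w rule: rev_induct)
  case Nil
  then show ?case by auto
next
  case (snoc s w)
  show ?case
  proof (cases "s = r")
    case True
    then have "level_sum Y w i = level_sum X w i \<and> level_prod Y w i = level_prod X w i"
      using snoc.prems by (intro level_cong assms(1,2)) (auto simp: cur_face_snoc)
    then show ?thesis
      using True snoc.prems by (auto simp: level_sum_snoc level_prod_snoc assms(1,2) cur_face_snoc)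
  next
    case False
    then have "Y (Cr (length w)) = X (Cr (length w))"
      using snoc.prems(1)[of "Cr (length w)"] cur_face_neq_Cr[of w "length w" r]
      by (auto simp: cur_face_snoc)
    then show ?thesis
      using False snoc by (auto simp: level_sum_snoc level_prod_snoc assms(1,2) cur_face_snoc)
  qed
qed

lemma level_suffix:
  assumes "\<And>F. X F \<noteq> 0" "\<And>F. Y F \<noteq> 0"
    and "level_sum X u i = level_sum Y u' i \<and> level_prod X u i = level_prod Y u' i"
    and "length u' = length u" "\<And>k. length u \<le> k \<Longrightarrow> X (Cr k) = Y (Cr k)"
  shows "level_sum X (u @ v) i = level_sum Y (u' @ v) i \<and> level_prod X (u @ v) i = level_prod Y (u' @ v) i"
proof (induction v rule: rev_induct)
  case (snoc s v)
  then show ?case using assms(1,2,4,5)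
    unfolding append_assoc[symmetric]
    by (auto simp: level_sum_snoc level_prod_snoc simp del: append_assoc)
qed (use assms(3) in simp)

lemma mutation_coords_nonzero:
  assumes "\<And>F. X' F \<noteq> 0" "1 + X' (Cr j) \<noteq> 0"
  shows "mutation_coords w j w' X' F \<noteq> 0"
proof -
  have "1 + inverse (X' (Cr j)) \<noteq> 0"
    using assms assms(1)[of "Cr j"] by (simp add: field_simps add.commute)
  then show ?thesis using assms by (auto simp: mutation_coords_def)
qed

text \<open>Let \<open>P\<close> be the product of the prefix in the new coordinates. On level
  \<open>r\<close> the two old terms \<open>P / (1 + y)\<close> and \<open>P * y / (1 + y)\<close>
  merge into \<open>P\<close>; on level \<open>t\<close> the old term \<open>P * (1 + 1 / y)\<close>
  splits into \<open>P\<close> and \<open>P / y\<close>.\<close>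

lemma level_sum_braid:
  assumes "r = Suc t \<or> t = Suc r" "\<And>F. X' F \<noteq> 0" "1 + X' (Cr (length u)) \<noteq> 0"
  shows "level_sum (mutation_coords (u @ r # t # r # v) (length u) (u @ t # r # t # v) X')
      (u @ r # t # r # v) i = level_sum X' (u @ t # r # t # v) i"
proof -
  define X where "X = mutation_coords (u @ r # t # r # v) (length u) (u @ t # r # t # v) X'"
  define y where "y = X' (Cr (length u))"
  let ?a = "1 + y" and ?b = "inverse (1 + inverse y)"
  have ne: "r \<noteq> t" using assms(1) by auto
  note vals = mutation_coords_values[where u = u and v = v and X' = X', OF assms(1), folded X_def y_def]
  have Xn: "X F \<noteq> 0" for F unfolding X_def by (rule mutation_coords_nonzero) fact+
  have yn: "y \<noteq> 0" "1 + y \<noteq> 0" "1 + inverse y \<noteq> 0"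
    using assms(2,3) by (auto simp: y_def field_simps add.commute)
  have prefix: "level_sum X u i = level_sum X' u i \<and> level_prod X u i =
      (if i = r then inverse ?a else 1) * ((if i = t then inverse ?b else 1) * level_prod X' u i)"
  proof -
    let ?Y = "X'(cur_face u t := ?b * X' (cur_face u t))"
    let ?Z = "?Y(cur_face u r := ?a * X' (cur_face u r))"
    have n: "?Y F \<noteq> 0" "?Z F \<noteq> 0" for F using yn assms(2) by auto
    have "level_sum X u i = level_sum ?Z u i \<and> level_prod X u i = level_prod ?Z u i"
      by (rule level_cong[OF Xn n(2)]; rule vals(5)) auto
    moreover have "level_sum ?Z u i = level_sum ?Y u i \<and>
        level_prod ?Z u i = (if i = r then inverse ?a else 1) * level_prod ?Y u i"
      by (rule level_scale[OF n]) (auto simp: cur_face_inj ne)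
    moreover have "level_sum ?Y u i = level_sum X' u i \<and>
        level_prod ?Y u i = (if i = t then inverse ?b else 1) * level_prod X' u i"
      by (rule level_scale[OF assms(2) n(1)]) auto
    ultimately show ?thesis by simp
  qed
  have e: "u @ [a, b, c] = ((u @ [a]) @ [b]) @ [c]" for a b c by simp
  have "level_sum X (u @ [r, t, r]) i = level_sum X' (u @ [t, r, t]) i \<and>
      level_prod X (u @ [r, t, r]) i = level_prod X' (u @ [t, r, t]) i"
  proof -
    have inv2: "inverse (X (Cr (Suc (length u)))) = inverse ?a * inverse (X' (Cr (Suc (Suc (length u)))))"
      unfolding vals(2) by (rule inverse_mult_distrib)
    have ab: "inverse ?a * y * inverse ?b = 1" "inverse ?a * inverse ?b = inverse y"
      "inverse ?a + inverse ?a * y = 1"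
    proof -
      have "y + y * y \<noteq> 0" using yn by (simp add: distrib_left[of y 1 y, simplified, symmetric])
      then show "inverse ?a * y * inverse ?b = 1" "inverse ?a * inverse ?b = inverse y"
        "inverse ?a + inverse ?a * y = 1"
        using yn by (simp_all add: field_simps)
    qed
    have ab': "inverse ?b = 1 + inverse y" by simp
    consider "i = r" | "i = t" | "i \<noteq> r" "i \<noteq> t" by blast
    then show ?thesis
    proof cases
      case 1
      have "level_prod X' u i * inverse (X' (Cr (Suc (length u)))) * (inverse ?a * y * inverse ?b)
        = level_prod X' u i * inverse (X' (Cr (Suc (length u))))" unfolding ab by simp
      moreover have "level_prod X' u i * (inverse ?a + inverse ?a * y) = level_prod X' u i"
        unfolding ab by simp
      ultimately show ?thesis unfolding e level_sum_snoc level_prod_snoc[OF Xn] level_prod_snoc[OF assms(2)]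
        using 1 ne prefix vals(1-3) by (simp add: algebra_simps)
    next
      case 2
      have "level_prod X' u i * inverse (X' (Cr (Suc (Suc (length u))))) * (inverse ?a * inverse ?b)
        = level_prod X' u i * inverse (X' (Cr (Suc (Suc (length u))))) * inverse y" unfolding ab by simp
      moreover have "level_prod X' u i * inverse ?b = level_prod X' u i + level_prod X' u i * inverse y"
        unfolding ab' by (simp add: algebra_simps)
      ultimately show ?thesis unfolding e level_sum_snoc level_prod_snoc[OF Xn] level_prod_snoc[OF assms(2)]
        using 2 ne prefix vals(1) inv2 by (simp add: algebra_simps flip: y_def)
    next
      case 3
      then show ?thesis unfolding e level_sum_snoc level_prod_snoc[OF Xn] level_prod_snoc[OF assms(2)]
        using prefix by simp
    qed
  qed
  then have "level_sum X ((u @ [r, t, r]) @ v) i = level_sum X' ((u @ [t, r, t]) @ v) i \<and>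
      level_prod X ((u @ [r, t, r]) @ v) i = level_prod X' ((u @ [t, r, t]) @ v) i"
    by (rule level_suffix[OF Xn assms(2)]) (auto simp: vals(4))
  then show ?thesis by (simp add: X_def)
qed

lemma level_sum_commutation:
  assumes "s + 2 \<le> t \<or> t + 2 \<le> s" "\<And>F. X F \<noteq> 0"
  shows "level_sum (commutation_coords (length u) X) (u @ s # t # v) i = level_sum X (u @ t # s # v) i"
proof -
  let ?Y = "commutation_coords (length u) X"
  have Y: "?Y (Cr k) = X (Cr (if k = length u then Suc (length u) else if k = Suc (length u) then length u else k))"
    "?Y (Unb k) = X (Unb k)" for k
    by (auto simp: commutation_coords_def transpose_def)
  have Yn: "?Y F \<noteq> 0" for F using assms(2) by (simp add: commutation_coords_def)
  have e: "u @ [a, b] = (u @ [a]) @ [b]" for a b by simp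
  have "level_sum ?Y u i = level_sum X u i \<and> level_prod ?Y u i = level_prod X u i"
    by (rule level_cong[OF Yn assms(2)]) (auto simp: Y)
  then have "level_sum ?Y (u @ [s, t]) i = level_sum X (u @ [t, s]) i \<and>
      level_prod ?Y (u @ [s, t]) i = level_prod X (u @ [t, s]) i"
    unfolding e level_sum_snoc level_prod_snoc[OF Yn] level_prod_snoc[OF assms(2)]
    using assms(1) by (auto simp: Y)
  then have "level_sum ?Y ((u @ [s, t]) @ v) i = level_sum X ((u @ [t, s]) @ v) i \<and>
      level_prod ?Y ((u @ [s, t]) @ v) i = level_prod X ((u @ [t, s]) @ v) i"
    by (rule level_suffix[OF Yn assms(2)]) (auto simp: Y)
  then show ?thesis by simp
qed

section \<open>Deficits\<close>

lemma height_0 [simp]: "height w 0 a = a"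
  by (simp add: height_def)

lemma height_Suc:
  "j < length w \<Longrightarrow> height w (Suc j) a = transpose (w ! j) (Suc (w ! j)) (height w j a)"
  by (simp add: height_def take_Suc_conv_app_nth)

lemma word_perm_take_Suc:
  "j < length w \<Longrightarrow>
    word_perm (take (Suc j) w) = word_perm (take j w) \<circ> transpose (w ! j) (Suc (w ! j))"
  by (simp add: take_Suc_conv_app_nth word_perm_append)

text \<open>The product of the first \<open>c\<close> letters sends a height to the line found there
  in column \<open>c\<close>, so it is the inverse of \<open>height w c\<close>.\<close>

lemma height_word_perm [simp]: "height w c (word_perm (take c w) h) = h"
proof -
  have "fold (\<lambda>s. transpose s (Suc s)) u (word_perm u h) = h" for u
    by (induction u arbitrary: h rule: rev_induct) (auto simp: word_perm_append)
  then show ?thesis by (simp add: height_def)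
qed

lemma word_perm_height [simp]: "word_perm (take c w) (height w c a) = a"
proof -
  have "word_perm u (fold (\<lambda>s. transpose s (Suc s)) u a) = a" for u
    by (induction u arbitrary: a rule: rev_induct) (auto simp: word_perm_append)
  then show ?thesis by (simp add: height_def)
qed

lemma height_eq_iff: "height w c a = h \<longleftrightarrow> a = word_perm (take c w) h"
  by (metis height_word_perm word_perm_height)

lemma simple_word_take: "simple_word n w \<Longrightarrow> simple_word n (take c w)"
  by (auto simp: simple_word_def dest: in_set_takeD)

lemma simple_word_nth: "simple_word n w \<Longrightarrow> j < length w \<Longrightarrow> w ! j \<in> {1..<n}"
  unfolding simple_word_def using nth_mem by blast

lemma word_perm_take_in:
  "simple_word n w \<Longrightarrow> word_perm (take c w) h \<in> {1..n} \<longleftrightarrow> h \<in> {1..n}"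
  by (rule permutes_in_image[OF word_perm_permutes[OF simple_word_take]])

lemma height_in: "simple_word n w \<Longrightarrow> height w c a \<in> {1..n} \<longleftrightarrow> a \<in> {1..n}"
  by (metis word_perm_height word_perm_take_in)

lemma ascending_nth:
  "ascending p w \<Longrightarrow> j < length w \<Longrightarrow>
    p (word_perm (take j w) (w ! j)) < p (word_perm (take j w) (Suc (w ! j)))"
proof (induction w arbitrary: p j)
  case (Cons s w)
  show ?case
  proof (cases j)
    case 0
    then show ?thesis using Cons.prems by simp
  next
    case (Suc k)
    then have "ascending (p \<circ> transpose s (Suc s)) w" "k < length w" using Cons.prems by auto
    from Cons.IH[OF this] show ?thesis using Suc by simp
  qed
qed simp

text \<open>Reducedness seen in the diagram: of two crossing lines, the one coming from below has
  the smaller index.\<close>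

lemma flip_word_crossing_less:
  "flip_word n w \<Longrightarrow> j < length w \<Longrightarrow>
    word_perm (take j w) (w ! j) < word_perm (take j w) (Suc (w ! j))"
  using ascending_nth[of id w j] flip_word_ascending by auto

definition count_above :: "nat list \<Rightarrow> nat \<Rightarrow> nat set \<Rightarrow> profile" where
  "count_above w c S r = int (card {a \<in> S. r < height w c a})"

lemma count_above_Suc_level:
  assumes "finite S"
  shows "count_above w c S r =
    count_above w c S (Suc r) + of_bool (word_perm (take c w) (Suc r) \<in> S)"
proof -
  let ?b = "word_perm (take c w) (Suc r)"
  have *: "r < height w c a \<longleftrightarrow> a = ?b \<or> Suc r < height w c a" for a
    unfolding height_eq_iff[symmetric] by linarith
  have "{a \<in> S. r < height w c a} =
      (if ?b \<in> S then insert ?b {a \<in> S. Suc r < height w c a} else {a \<in> S. Suc r < height w c a})"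
    unfolding * by auto
  moreover have "?b \<notin> {a \<in> S. Suc r < height w c a}" by simp
  ultimately show ?thesis using assms by (simp add: count_above_def)
qed

lemma count_above_Suc_column:
  assumes "j < length w" "r \<noteq> w ! j"
  shows "count_above w (Suc j) S r = count_above w j S r"
proof -
  have "r < height w (Suc j) a \<longleftrightarrow> r < height w j a" for a
    using assms by (auto simp: height_Suc transpose_def)
  then show ?thesis by (simp add: count_above_def)
qed

lemma count_above_crossing:
  assumes "j < length w" "finite S"
  shows "count_above w (Suc j) S (w ! j) = count_above w j S (w ! j)
    + of_bool (word_perm (take j w) (w ! j) \<in> S) - of_bool (word_perm (take j w) (Suc (w ! j)) \<in> S)"
  using count_above_Suc_level[OF assms(2), of w "Suc j" "w ! j"]
    count_above_Suc_level[OF assms(2), of w j "w ! j"]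
    count_above_Suc_column[OF assms(1), of "Suc (w ! j)" S] assms(1)
  by (simp add: word_perm_take_Suc)

lemma is_profile_count_above: "finite S \<Longrightarrow> is_profile (count_above w c S)"
  unfolding is_profile_def by (metis add.right_neutral count_above_Suc_level of_bool_eq(1,2))

section \<open>Comparison of histories with the base lines\<close>

definition base_profile :: "nat list \<Rightarrow> nat \<Rightarrow> nat \<Rightarrow> profile" where
  "base_profile w i c = count_above w c {1..i}"

definition start_profile :: "nat \<Rightarrow> profile" where
  "start_profile i r = int (i - r)"

text \<open>The next two are the profiles of the right ends of the lines \<open>1, \<dots>, i\<close> and of the lines
  \<open>1, \<dots>, i - 1, i + 1\<close>, respectively.\<close>

definition top_profile :: "nat \<Rightarrow> nat \<Rightarrow> profile" where
  "top_profile n i r = int (min i (n - r))"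

definition end_profile :: "nat \<Rightarrow> nat \<Rightarrow> profile" where
  "end_profile n i = (top_profile n i)(n - i := int i - 1)"

lemma is_profile_top: "is_profile (top_profile n i)"
  by (auto simp: is_profile_def top_profile_def)

lemma is_profile_end:
  assumes "i \<in> {1..<n}"
  shows "is_profile (end_profile n i)"
  unfolding is_profile_def
proof
  fix r
  consider "r = n - i" | "Suc r = n - i" | "r \<noteq> n - i" "Suc r \<noteq> n - i" by blast
  then show "end_profile n i r = end_profile n i (Suc r) \<or> end_profile n i r = end_profile n i (Suc r) + 1"
  proof cases
    case 3
    then show ?thesis
      using is_profile_top[of n i] by (auto simp: is_profile_def end_profile_def)
  qed (use assms in \<open>auto simp: end_profile_def top_profile_def\<close>)
qed

lemma base_profile_0: "base_profile w i 0 = start_profile i"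
proof
  fix r
  have "{a \<in> {1..i}. r < height w 0 a} = {Suc r..i}" by auto
  then show "base_profile w i 0 r = start_profile i r"
    by (simp add: base_profile_def count_above_def start_profile_def)
qed

lemma end_height_flip_word:
  assumes "flip_word n w"
  shows "height w (length w) a = flip n a"
  using assms by (simp add: height_eq_iff flip_word_def)

lemma base_profile_end:
  assumes "flip_word n w" "i \<le> n"
  shows "base_profile w i (length w) = top_profile n i"
proof
  fix r
  have "{a \<in> {1..i}. r < height w (length w) a} = {1..min i (n - r)}"
    using assms by (auto simp: end_height_flip_word flip_def)
  then show "base_profile w i (length w) r = top_profile n i r"
    by (simp add: base_profile_def count_above_def top_profile_def)
qed

lemma in_hop_preds_iff:
  "M0 \<in> hop_preds s M \<longleftrightarrow> M0 = M \<or> M0 = M(s := M s - 1) \<and> M (s - 1) = M s \<and> M s = M (Suc s) + 1"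
  by (auto simp: hop_preds_def)

context
  fixes n i :: nat and w :: "nat list"
  assumes w: "flip_word n w" and i: "i \<le> n"
begin

lemma base_levels:
  assumes "j < length w"
  shows "base_profile w i j (w ! j - 1) = base_profile w i j (w ! j) + of_bool (word_perm (take j w) (w ! j) \<le> i)"
    and "base_profile w i j (w ! j) =
      base_profile w i j (Suc (w ! j)) + of_bool (word_perm (take j w) (Suc (w ! j)) \<le> i)"
proof -
  have s: "simple_word n w" "w ! j \<in> {1..<n}"
    using w assms simple_word_nth by (auto simp: flip_word_def)
  have "word_perm (take j w) (w ! j) \<in> {1..n}" "word_perm (take j w) (Suc (w ! j)) \<in> {1..n}"
    using s word_perm_take_in[OF s(1)] by auto
  then show "base_profile w i j (w ! j - 1) = base_profile w i j (w ! j) + of_bool (word_perm (take j w) (w ! j) \<le> i)"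
    and "base_profile w i j (w ! j) =
      base_profile w i j (Suc (w ! j)) + of_bool (word_perm (take j w) (Suc (w ! j)) \<le> i)"
    using s count_above_Suc_level[of "{1..i}" w j "w ! j - 1"] count_above_Suc_level[of "{1..i}" w j "w ! j"]
    by (auto simp: base_profile_def)
qed

lemma base_step:
  assumes "j < length w"
  shows "base_profile w i (Suc j) = (base_profile w i j)(w ! j := base_profile w i j (w ! j) +
    of_bool (word_perm (take j w) (w ! j) \<le> i \<and> i < word_perm (take j w) (Suc (w ! j))))"
proof
  fix r
  have s: "simple_word n w" "w ! j \<in> {1..<n}"
    using w assms simple_word_nth by (auto simp: flip_word_def)
  have "word_perm (take j w) (w ! j) \<in> {1..n}" "word_perm (take j w) (Suc (w ! j)) \<in> {1..n}"
    using s word_perm_take_in[OF s(1)] by auto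
  then show "base_profile w i (Suc j) r = ((base_profile w i j)(w ! j := base_profile w i j (w ! j) +
    of_bool (word_perm (take j w) (w ! j) \<le> i \<and> i < word_perm (take j w) (Suc (w ! j))))) r"
    using flip_word_crossing_less[OF w assms] assms
      count_above_crossing[OF assms, of "{1..i}"] count_above_Suc_column[OF assms, of r "{1..i}"]
    by (auto simp: base_profile_def)
qed

text \<open>The fourth combination, with a base line only on top, is impossible because the lower
  line has the smaller index.\<close>

lemma base_cases:
  assumes "j < length w"
  obtains (hop) "word_perm (take j w) (w ! j) \<le> i" "i < word_perm (take j w) (Suc (w ! j))"
      "base_profile w i j (w ! j - 1) = base_profile w i j (w ! j) + 1"
      "base_profile w i j (w ! j) = base_profile w i j (Suc (w ! j))"
      "base_profile w i (Suc j) = (base_profile w i j)(w ! j := base_profile w i j (w ! j) + 1)"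
  | (full) "word_perm (take j w) (Suc (w ! j)) \<le> i"
      "base_profile w i j (w ! j - 1) = base_profile w i j (w ! j) + 1"
      "base_profile w i j (w ! j) = base_profile w i j (Suc (w ! j)) + 1"
      "base_profile w i (Suc j) = base_profile w i j"
  | (empty) "i < word_perm (take j w) (w ! j)"
      "base_profile w i j (w ! j - 1) = base_profile w i j (w ! j)"
      "base_profile w i j (w ! j) = base_profile w i j (Suc (w ! j))"
      "base_profile w i (Suc j) = base_profile w i j"
proof -
  let ?a = "word_perm (take j w) (w ! j)" and ?b = "word_perm (take j w) (Suc (w ! j))"
  have "?a < ?b" using flip_word_crossing_less[OF w assms] .
  then consider "?a \<le> i" "i < ?b" | "?a \<le> i" "?b \<le> i" | "i < ?a" "i < ?b" by linarith
  then show ?thesis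
  proof cases
    case 1
    then show ?thesis using hop base_levels[OF assms] base_step[OF assms] by simp
  next
    case 2
    then have "base_profile w i (Suc j) = base_profile w i j" using base_step[OF assms] by simp
    then show ?thesis using 2 full base_levels[OF assms] by simp
  next
    case 3
    then have "base_profile w i (Suc j) = base_profile w i j" using base_step[OF assms] by simp
    then show ?thesis using 3 empty base_levels[OF assms] by simp
  qed
qed

text \<open>The base lines hop whenever they can. If \<open>h\<close> hops where they stand still,
  the bound at a neighbouring level shows that \<open>h\<close> was strictly below them: at the
  level above if both lines are base lines, at the level below if neither is.\<close>

lemma history_le_base:
  assumes h0: "h 0 = start_profile i"
    and step: "\<And>j. j < length w \<Longrightarrow> h j \<in> hop_preds (w ! j) (h (Suc j)) \<or>
      word_perm (take j w) (w ! j) \<le> i \<and> i < word_perm (take j w) (Suc (w ! j)) \<and>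
      h (Suc j) = (h j)(w ! j := h j (w ! j) - 1)"
    and c: "c \<le> length w"
  shows "h c r \<le> base_profile w i c r"
proof -
  have "\<forall>r. h c r \<le> base_profile w i c r" using c
  proof (induction c)
    case 0
    then show ?case by (simp add: h0 base_profile_0)
  next
    case (Suc j)
    then have j: "j < length w" and IH: "\<And>r. h j r \<le> base_profile w i j r" by auto
    let ?s = "w ! j"
    note IHs = IH[of "?s - 1"] IH[of ?s] IH[of "Suc ?s"]
    have s1: "?s - 1 \<noteq> ?s" using w simple_word_nth[of n w j] j by (auto simp: flip_word_def)
    have "h (Suc j) ?s \<le> base_profile w i (Suc j) ?s"
      using step[OF j] unfolding in_hop_preds_iff
    proof (elim disjE conjE)
      assume "h j = h (Suc j)"
      then show ?thesis using IHs by (cases rule: base_cases[OF j]) auto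
    next
      assume *: "h j = (h (Suc j))(?s := h (Suc j) ?s - 1)"
        "h (Suc j) (?s - 1) = h (Suc j) ?s" "h (Suc j) ?s = h (Suc j) (Suc ?s) + 1"
      have "h j (?s - 1) = h (Suc j) ?s" "h j (Suc ?s) = h (Suc j) ?s - 1"
        using * s1 by (simp_all add: fun_upd_def)
      then show ?thesis using IHs by (cases rule: base_cases[OF j]) auto
    next
      assume "h (Suc j) = (h j)(?s := h j ?s - 1)"
      then show ?thesis using IHs by (cases rule: base_cases[OF j]) auto
    qed
    moreover have "h (Suc j) r \<le> base_profile w i (Suc j) r" if "r \<noteq> ?s" for r
    proof -
      have "h (Suc j) r = h j r" using step[OF j] hop_preds_other that by fastforce
      moreover have "base_profile w i (Suc j) r = base_profile w i j r"
        using base_step[OF j] that by simp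
      ultimately show ?thesis using IH by simp
    qed
    ultimately show ?case by metis
  qed
  then show ?thesis by simp
qed

text \<open>The deficit of a history with respect to the base lines is nonnegative when followed from the
  left, and at most one when followed from the right. Downward steps are allowed here, but the two
  bounds exclude them.\<close>

lemma deficit_bounds:
  assumes h0: "h 0 = start_profile i"
    and step: "\<And>j. j < length w \<Longrightarrow> h j \<in> hop_preds (w ! j) (h (Suc j)) \<or>
      word_perm (take j w) (w ! j) \<le> i \<and> i < word_perm (take j w) (Suc (w ! j)) \<and>
      h (Suc j) = (h j)(w ! j := h j (w ! j) - 1)"
    and hl: "\<And>r. top_profile n i r - h (length w) r \<le> 1"
    and c: "c \<le> length w"
  shows "0 \<le> base_profile w i c r - h c r \<and> base_profile w i c r - h c r \<le> 1"
proof
  show "0 \<le> base_profile w i c r - h c r" using history_le_base[OF h0 step c] by simp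
  have "\<forall>r. base_profile w i c r - h c r \<le> 1" using c
  proof (induction c rule: inc_induct)
    case base
    have "base_profile w i (length w) = top_profile n i"
      using base_profile_end[OF w] i by simp
    then show ?case using hl by simp
  next
    case (step j)
    then have j: "j < length w" and IH: "\<And>r. base_profile w i (Suc j) r - h (Suc j) r \<le> 1" by auto
    let ?s = "w ! j"
    have s1: "?s - 1 \<noteq> ?s" using w simple_word_nth[of n w j] j by (auto simp: flip_word_def)
    note IHs = IH[of "?s - 1"] IH[of ?s] IH[of "Suc ?s"]
    have "base_profile w i j ?s - h j ?s \<le> 1"
      using assms(2)[OF j] unfolding in_hop_preds_iff
    proof (elim disjE conjE)
      assume "h j = h (Suc j)"
      then show ?thesis using IHs by (cases rule: base_cases[OF j]) auto
    next
      assume *: "h j = (h (Suc j))(?s := h (Suc j) ?s - 1)"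
        "h (Suc j) (?s - 1) = h (Suc j) ?s" "h (Suc j) ?s = h (Suc j) (Suc ?s) + 1"
      \<comment> \<open>If \<open>h\<close> hops and the base lines do not, the bound comes from a
        neighbouring level, in mirror image of \<open>history_le_base\<close>: the level below if
        both lines are base lines, the level above if neither is.\<close>
      have "h j ?s = h (Suc j) ?s - 1" using * by simp
      then show ?thesis using IHs *(2,3) s1 by (cases rule: base_cases[OF j]) auto
    next
      assume "h (Suc j) = (h j)(?s := h j ?s - 1)"
      then show ?thesis using IHs by (cases rule: base_cases[OF j]) auto
    qed
    moreover have "base_profile w i j r - h j r \<le> 1" if "r \<noteq> ?s" for r
    proof -
      have "h (Suc j) r = h j r" using assms(2)[OF j] hop_preds_other that by fastforce
      moreover have "base_profile w i (Suc j) r = base_profile w i j r"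
        using base_step[OF j] that by simp
      ultimately show ?thesis using IH[of r] by simp
    qed
    ultimately show ?case by metis
  qed
  then show "base_profile w i c r - h c r \<le> 1" by simp
qed

text \<open>Followed from the right end, a hop missed by \<open>h\<close> would place it above the
  base lines, against \<open>history_le_base\<close>, and a hop that only \<open>h\<close> makes is
  excluded by the occupation of the two heights.\<close>

lemma no_deficit:
  assumes h0: "h 0 = start_profile i"
    and step: "\<And>j. j < length w \<Longrightarrow> h j \<in> hop_preds (w ! j) (h (Suc j))"
    and hl: "h (length w) = top_profile n i"
    and c: "c \<le> length w"
  shows "h c = base_profile w i c"
  using c
proof (induction c rule: inc_induct)
  case base
  show ?case using base_profile_end[OF w, of i] i hl by simp
next
  case (step j)
  then have j: "j < length w" and IH: "h (Suc j) = base_profile w i (Suc j)" by auto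
  let ?s = "w ! j"
  have s1: "?s - 1 \<noteq> ?s" using w simple_word_nth[of n w j] j by (auto simp: flip_word_def)
  have le: "h j ?s \<le> base_profile w i j ?s"
    using history_le_base[of h j ?s] h0 assms(2) j by simp
  from assms(2)[OF j] show ?case unfolding in_hop_preds_iff
  proof (elim disjE conjE)
    assume "h j = h (Suc j)"
    then show ?thesis using IH le by (cases rule: base_cases[OF j]) auto
  next
    assume *: "h j = (h (Suc j))(?s := h (Suc j) ?s - 1)"
      "h (Suc j) (?s - 1) = h (Suc j) ?s" "h (Suc j) ?s = h (Suc j) (Suc ?s) + 1"
    show ?thesis
      by (cases rule: base_cases[OF j]) (use * IH s1 in auto)
  qed
qed

lemma base_in_hop_preds:
  assumes "j < length w"
  shows "base_profile w i j \<in> hop_preds (w ! j) (base_profile w i (Suc j))"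
proof -
  have s1: "w ! j - 1 \<noteq> w ! j" using w simple_word_nth[of n w j] assms by (auto simp: flip_word_def)
  then show ?thesis
    by (cases rule: base_cases[OF assms]) (auto simp: in_hop_preds_iff)
qed

text \<open>This generalized minor is a single monomial, so dividing by it is harmless on the
  torus.\<close>

lemma histories_top:
  "histories (start_profile i) w (top_profile n i) = {map (base_profile w i) [0..<Suc (length w)]}"
proof (intro set_eqI iffI)
  fix h assume h: "h \<in> histories (start_profile i) w (top_profile n i)"
  show "h \<in> {map (base_profile w i) [0..<Suc (length w)]}"
    using no_deficit[of "(!) h"] h unfolding histories_def
    by (auto intro!: nth_equalityI simp del: upt_Suc)
next
  fix h assume "h \<in> {map (base_profile w i) [0..<Suc (length w)]}"
  then show "h \<in> histories (start_profile i) w (top_profile n i)"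
    using base_in_hop_preds base_profile_0[of w i] base_profile_end[OF w, of i] i
    by (auto simp: histories_def simp del: upt_Suc)
qed

text \<open>For histories with end \<open>end_profile\<close> this is the exponent of their weight
  relative to the base lines. The deficit is 0 or 1, and it vanishes at the faces unbounded to the
  left, as all these histories start with the same profile.\<close>

definition gp_vec :: "profile list \<Rightarrow> face_vec" where
  "gp_vec h = - (\<Sum>c\<in>{c. c < length w \<and> (h ! Suc c) (w ! c) < base_profile w i (Suc c) (w ! c)}.
     basis_vec (Cr c))"

lemma history_deficit:
  assumes "h \<in> histories (start_profile i) w (end_profile n i)" "c \<le> length w"
  shows "(h ! c) r = base_profile w i c r \<or> (h ! c) r = base_profile w i c r - 1"
proof -
  have "0 \<le> base_profile w i c r - (h ! c) r \<and> base_profile w i c r - (h ! c) r \<le> 1"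
    using assms i
    by (intro deficit_bounds) (auto simp: histories_def end_profile_def top_profile_def)
  then show ?thesis by auto
qed

lemma gp_vec_eval:
  assumes "h \<in> histories (start_profile i) w (end_profile n i)" and X: "\<And>F. X F \<noteq> 0"
  shows "monom_eval X (gp_vec h) =
    history_weight n X w h / history_weight n X w (map (base_profile w i) [0..<Suc (length w)])"
proof -
  let ?B = "base_profile w i"
  let ?A = "{c. c < length w \<and> (h ! Suc c) (w ! c) < ?B (Suc c) (w ! c)}"
  have h0: "h ! 0 = start_profile i" using assms(1) by (simp add: histories_def)
  have "monom_eval X (gp_vec h) = (\<Prod>c\<in>?A. inverse (X (Cr c)))"
    by (simp add: gp_vec_def monom_eval_uminus monom_eval_sum X prod_inversef[symmetric] o_def)
  also have "\<dots> = (\<Prod>c<length w. if c \<in> ?A then inverse (X (Cr c)) else 1)"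
  proof -
    have "?A = {..<length w} \<inter> ?A" by auto
    then show ?thesis using prod.inter_restrict[of "{..<length w}" "\<lambda>c. inverse (X (Cr c))" ?A] by simp
  qed
  also have "\<dots> = (\<Prod>c<length w. X (Cr c) powi (h ! Suc c) (w ! c) / X (Cr c) powi (?B (Suc c) (w ! c)))"
  proof (rule prod.cong[OF refl])
    fix c assume "c \<in> {..<length w}"
    then have "(h ! Suc c) (w ! c) = ?B (Suc c) (w ! c) \<or> (h ! Suc c) (w ! c) = ?B (Suc c) (w ! c) - 1"
      using history_deficit[OF assms(1), of "Suc c"] by simp
    then show "(if c \<in> ?A then inverse (X (Cr c)) else 1) =
        X (Cr c) powi (h ! Suc c) (w ! c) / X (Cr c) powi (?B (Suc c) (w ! c))"
      using \<open>c \<in> {..<length w}\<close> X by (auto simp: power_int_diff inverse_eq_divide)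
  qed
  also have "\<dots> = history_weight n X w h / history_weight n X w (map ?B [0..<Suc (length w)])"
    using X by (simp add: history_weight_def h0 base_profile_0 prod_dividef del: upt_Suc)
  finally show ?thesis .
qed

lemma gp_sum_eval:
  assumes X: "\<And>F. X F \<noteq> 0"
  shows "(\<Sum>h\<in>histories (start_profile i) w (end_profile n i). monom_eval X (gp_vec h)) =
    history_sum n X (start_profile i) w (end_profile n i) / history_sum n X (start_profile i) w (top_profile n i)"
  using gp_vec_eval[OF _ X] by (simp add: history_sum_def histories_top sum_divide_distrib del: upt_Suc)

lemma history_sum_top_nonzero:
  assumes X: "\<And>F. X F \<noteq> 0"
  shows "history_sum N X (start_profile i) w (top_profile n i) \<noteq> 0"
  using X by (simp add: history_sum_def histories_top history_weight_def del: upt_Suc)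

end

section \<open>The candidate for the superpotential and its invariance\<close>

definition explicit_superpotential :: "nat \<Rightarrow> nat list \<Rightarrow> laurent" where
  "explicit_superpotential n w = (\<Sum>i\<in>{1..<n}.
     (\<Sum>h\<in>histories (start_profile i) w (end_profile n i). laurent_monom (gp_vec i w h)) +
     (\<Sum>k<length (level_crossings w i). laurent_monom (level_vec w i k)))"

lemma explicit_superpotential_eval:
  assumes "flip_word n w" "\<And>F. X F \<noteq> 0"
  shows "laurent_eval (explicit_superpotential n w) X = (\<Sum>i\<in>{1..<n}.
    history_sum n X (start_profile i) w (end_profile n i) / history_sum n X (start_profile i) w (top_profile n i)
    + level_sum X w i)"
  unfolding explicit_superpotential_def laurent_eval_sum laurent_eval_add laurent_eval_monom
    level_sum_def[symmetric]
  using gp_sum_eval[OF assms(1) _ assms(2)] by (intro sum.cong) (auto simp: less_imp_le)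

lemma explicit_superpotential_commutation:
  assumes "flip_word n w" "commutation_move w j w'" "\<And>F. X' F \<noteq> 0"
  shows "laurent_eval (explicit_superpotential n w') X' =
    laurent_eval (explicit_superpotential n w) (commutation_coords j X')"
proof -
  have w': "flip_word n w'" using flip_word_move assms(1,2) by (auto simp: word_move_def)
  have n: "commutation_coords j X' F \<noteq> 0" for F using assms(3) by (simp add: commutation_coords_def)
  obtain u s t v where *: "w = u @ s # t # v" "w' = u @ t # s # v" "j = length u"
    "s + 2 \<le> t \<or> t + 2 \<le> s" using commutation_moveE[OF assms(2)] .
  have sw: "simple_word n (u @ s # t # v)" using assms(1) * by (simp add: flip_word_def)
  show ?thesis
    unfolding explicit_superpotential_eval[OF w' assms(3)] explicit_superpotential_eval[OF assms(1) n]
    unfolding * using history_sum_commutation[where u = u and v = v and X = X', OF *(4) sw]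
      level_sum_commutation[where u = u and v = v and X = X', OF *(4) assms(3)]
    by (intro sum.cong) (simp_all add: is_profile_top is_profile_end)
qed

lemma explicit_superpotential_braid:
  assumes "flip_word n w" "braid_move w j w'" "\<And>F. X' F \<noteq> 0" "1 + X' (Cr j) \<noteq> 0"
  shows "laurent_eval (explicit_superpotential n w') X' =
    laurent_eval (explicit_superpotential n w) (mutation_coords w j w' X')"
proof -
  have w': "flip_word n w'" using flip_word_move assms(1,2) by (auto simp: word_move_def)
  have n: "mutation_coords w j w' X' F \<noteq> 0" for F using mutation_coords_nonzero assms(3,4) by blast
  obtain u r t v where *: "w = u @ r # t # r # v" "w' = u @ t # r # t # v" "j = length u"
    "r = Suc t \<or> t = Suc r" using braid_moveE[OF assms(2)] .
  have sw: "simple_word n (u @ r # t # r # v)" using assms(1) * by (simp add: flip_word_def)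
  have y: "1 + X' (Cr (length u)) \<noteq> 0" using assms(4) * by simp
  show ?thesis
    unfolding explicit_superpotential_eval[OF w' assms(3)] explicit_superpotential_eval[OF assms(1) n]
    unfolding * using history_sum_braid[where u = u and v = v and X' = X', OF *(4) sw assms(3) y]
      level_sum_braid[where u = u and v = v and X' = X', OF *(4) assms(3) y]
    by (intro sum.cong) (simp_all add: is_profile_top is_profile_end)
qed

section \<open>The initial word\<close>

lemma initial_word_Suc: "initial_word (Suc m) = initial_word m @ rev [1..<Suc m]"
  by (cases m) (auto simp: initial_word_def)

lemma initial_word_0 [simp]: "initial_word 0 = []"
  by (simp add: initial_word_def)

declare upt_Suc [simp del]

lemma rev_upt_snoc: "a \<le> m \<Longrightarrow> rev [a..<Suc m] = rev [Suc a..<Suc m] @ [a]"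
  by (subst upt_conv_Cons) auto

lemma word_perm_descending:
  "a \<le> Suc m \<Longrightarrow> word_perm (rev [a..<Suc m]) h =
    (if h = a then Suc m else if a < h \<and> h \<le> Suc m then h - 1 else h)"
proof (induction a arbitrary: h rule: inc_induct)
  case (step a)
  then show ?case by (auto simp: rev_upt_snoc word_perm_append transpose_def)
qed auto

lemma flip_word_initial: "flip_word n (initial_word n)"
proof (induction n)
  case 0
  have "inversions 0 (flip 0) = {}" by (auto simp: inversions_def)
  then show ?case by (auto simp: flip_word_def flip_def)
next
  case (Suc m)
  have "word_perm (initial_word (Suc m)) = flip (Suc m)"
  proof
    fix h show "word_perm (initial_word (Suc m)) h = flip (Suc m) h"
      using Suc by (auto simp: initial_word_Suc word_perm_append word_perm_descending flip_word_def)
        (auto simp: flip_def)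
  qed
  moreover have "simple_word (Suc m) (initial_word (Suc m))"
    using Suc by (auto simp: initial_word_Suc flip_word_def simple_word_def)
  ultimately show ?case
    using Suc by (simp add: flip_word_def card_inversions_flip initial_word_Suc)
qed

lemma height_order_persists:
  assumes "flip_word n w" "a < b" "height w j b < height w j a" "j \<le> c" "c \<le> length w"
  shows "height w c b < height w c a"
  using assms(4,5)
proof (induction c rule: dec_induct)
  case (step t)
  then have t: "t < length w" and lt: "height w t b < height w t a" by auto
  have "\<not> (height w t b = w ! t \<and> height w t a = Suc (w ! t))"
    using flip_word_crossing_less[OF assms(1) t] assms(2) by (auto simp: height_eq_iff)
  then show ?case using lt by (auto simp: height_Suc[OF t] transpose_def)
qed (use assms(3) in simp)

text \<open>After a crossing the line with the smaller index stays on top, whereas a second crossing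
  would need it below. This gives the definite description in \<open>crossing_face\<close> its
  value.\<close>

lemma crosses_unique:
  assumes "flip_word n w" "crosses w j a b" "crosses w j' a b"
  shows "j = j'"
proof -
  have *: False if "a < b" "crosses w j a b" "crosses w j' a b" "j < j'" for a b j j'
  proof -
    have j: "j < length w" "j' < length w" using that by (auto simp: crosses_def)
    have 1: "height w k a = w ! k \<and> height w k b = Suc (w ! k)" if "crosses w k a b" for k
      using that flip_word_crossing_less[OF assms(1), of k] \<open>a < b\<close>
      by (auto simp: crosses_def doubleton_eq_iff height_eq_iff)
    have "height w (Suc j) b < height w (Suc j) a"
      using 1[OF that(2)] by (simp add: height_Suc[OF j(1)])
    then have "height w j' b < height w j' a"
      using height_order_persists[OF assms(1) that(1), of "Suc j" j'] that(4) j by simp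
    then show False using 1[OF that(3)] by simp
  qed
  have "crosses w j b a" "crosses w j' b a" "a \<noteq> b"
    using assms(2,3) by (auto simp: crosses_def insert_commute)
  then show ?thesis using *[of a b j j'] *[of a b j' j] *[of b a j j'] *[of b a j' j] assms(2,3)
    by (meson linorder_neqE_nat)
qed

lemma initial_word_split:
  "m < n \<Longrightarrow> \<exists>v. initial_word n = initial_word m @ rev [1..<Suc m] @ v"
proof (induction n)
  case (Suc n)
  then show ?case by (cases "m = n") (auto simp: initial_word_Suc)
qed simp

text \<open>The first \<open>m\<close> lines have already been reversed by
  \<open>initial_word m\<close>. In the block of levels \<open>m, ..., 1\<close> line
  \<open>Suc m\<close> then runs down through them and meets line \<open>k\<close> at the
  \<open>k\<close>-th crossing.\<close>

lemma crossing_face_initial: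
  assumes "1 \<le> k" "k \<le> m" "m < n"
  shows "crossing_face (initial_word n) k (Suc m) = Cr (length (initial_word m) + (k - 1))"
proof -
  let ?j = "length (initial_word m) + (k - 1)" and ?s = "Suc m - k" and ?w = "initial_word n"
  obtain k' where k': "k = Suc k'" using assms by (cases k) auto
  obtain v where v: "?w = initial_word m @ rev [1..<Suc m] @ v"
    using initial_word_split[OF assms(3)] by blast
  have j: "?j < length ?w" using assms by (simp add: v k')
  have s: "?w ! ?j = ?s" using assms by (simp add: v k' nth_append rev_nth nth_upt)
  have t: "take ?j ?w = initial_word m @ rev [Suc ?s..<Suc m]"
    using assms by (simp add: v k' take_rev drop_upt)
  have "word_perm (take ?j ?w) = flip m \<circ> word_perm (rev [Suc ?s..<Suc m])"
    using flip_word_initial[of m] unfolding t by (simp add: word_perm_append flip_word_def)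
  then have wp: "word_perm (take ?j ?w) h = flip m (word_perm (rev [Suc ?s..<Suc m]) h)" for h
    by simp
  have "word_perm (rev [Suc ?s..<Suc m]) ?s = ?s" "word_perm (rev [Suc ?s..<Suc m]) (Suc ?s) = Suc m"
    using assms by (simp_all add: word_perm_descending)
  then have "word_perm (take ?j ?w) ?s = k" "word_perm (take ?j ?w) (Suc ?s) = Suc m"
    unfolding wp using assms by (auto simp: flip_def)
  then have "height ?w ?j k = ?s" "height ?w ?j (Suc m) = Suc ?s"
    by (simp_all only: height_eq_iff)
  then have c: "crosses ?w ?j k (Suc m)" using j s by (simp add: crosses_def)
  show ?thesis unfolding crossing_face_def
    by (rule arg_cong[of _ _ Cr], rule the_equality, rule c) (erule crosses_unique[OF flip_word_initial _ c])
qed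

lemma level_crossings_append:
  "level_crossings (u @ v) i = level_crossings u i @ map ((+) (length u)) (level_crossings v i)"
  by (induction v rule: rev_induct)
    (auto simp: level_crossings_snoc simp flip: append_assoc)

lemma level_crossings_descending:
  "a \<le> Suc m \<Longrightarrow> level_crossings (rev [a..<Suc m]) i = (if a \<le> i \<and> i \<le> m then [m - i] else [])"
  by (induction a rule: inc_induct) (auto simp: rev_upt_snoc level_crossings_snoc)

lemma level_crossings_initial:
  "1 \<le> i \<Longrightarrow> level_crossings (initial_word n) i =
    map (\<lambda>m. length (initial_word m) + (m - i)) [i..<n]"
proof (induction n)
  case (Suc n)
  then show ?case
    by (auto simp: initial_word_Suc[of n] level_crossings_append level_crossings_descending upt_Suc[of i n])
qed simp

lemma level_vec_initial:
  assumes "1 \<le> i" "k < n - i"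
  shows "level_vec (initial_word n) i k =
    - basis_vec (Unb i) - (\<Sum>j\<in>{1..k}. basis_vec (crossing_face (initial_word n) j (i + j)))"
proof -
  have "take k (level_crossings (initial_word n) i) = map (\<lambda>m. length (initial_word m) + (m - i)) [i..<i + k]"
    using assms by (simp add: level_crossings_initial take_map take_upt)
  then have "(\<Sum>j\<leftarrow>take k (level_crossings (initial_word n) i). basis_vec (Cr j)) =
      (\<Sum>m\<in>{i..<i + k}. basis_vec (Cr (length (initial_word m) + (m - i))))"
    by (simp add: o_def sum_list_distinct_conv_sum_set)
  also have "\<dots> = (\<Sum>j\<in>{1..k}. basis_vec (Cr (length (initial_word (i + j - 1)) + (j - 1))))"
    by (rule sum.reindex_bij_witness[of _ "\<lambda>j. i + j - 1" "\<lambda>m. m - i + 1"]) auto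
  also have "\<dots> = (\<Sum>j\<in>{1..k}. basis_vec (crossing_face (initial_word n) j (i + j)))"
  proof (rule sum.cong[OF refl])
    fix j assume "j \<in> {1..k}"
    show "basis_vec (Cr (length (initial_word (i + j - 1)) + (j - 1))) =
        basis_vec (crossing_face (initial_word n) j (i + j))"
    proof -
      have "1 \<le> j" "j \<le> i + j - 1" "i + j - 1 < n" "Suc (i + j - 1) = i + j"
        using assms \<open>j \<in> {1..k}\<close> by auto
      then show ?thesis using crossing_face_initial[of j "i + j - 1" n] by (simp only:)
    qed
  qed
  finally show ?thesis by (simp add: level_vec_def)
qed

text \<open>The possible profiles before the crossings of levels \<open>m, \<dots>, k\<close>, in this order. When the crossing
  of level \<open>r\<close> is reached, the levels above \<open>r\<close> have their final values and the level below \<open>r\<close> has its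
  initial one.\<close>

definition block_preds :: "nat \<Rightarrow> nat \<Rightarrow> profile \<Rightarrow> profile set" where
  "block_preds k m M = {M0. (\<forall>r. r \<notin> {k..m} \<longrightarrow> M0 r = M r) \<and>
     (\<forall>r\<in>{k..m}. M r = M0 r \<or> M r = M0 r + 1 \<and> M0 (r - 1) = M r \<and> M (Suc r) = M0 r)}"

lemma block_preds_step:
  assumes "1 \<le> k" "k \<le> m"
  shows "block_preds k m M = (\<Union>M1\<in>hop_preds k M. block_preds (Suc k) m M1)"
proof (intro set_eqI iffI)
  fix M0 assume M0: "M0 \<in> block_preds k m M"
  have k: "M k = M0 k \<or> M k = M0 k + 1 \<and> M0 (k - 1) = M k \<and> M (Suc k) = M0 k"
    using M0 assms by (auto simp: block_preds_def)
  have k1: "M0 (k - 1) = M (k - 1)" using M0 assms by (auto simp: block_preds_def)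
  have "M(k := M0 k) \<in> hop_preds k M"
    using k k1 by (auto simp: in_hop_preds_iff)
  moreover have "M0 \<in> block_preds (Suc k) m (M(k := M0 k))"
    using M0 unfolding block_preds_def by auto
  ultimately show "M0 \<in> (\<Union>M1\<in>hop_preds k M. block_preds (Suc k) m M1)" by blast
next
  fix M0 assume "M0 \<in> (\<Union>M1\<in>hop_preds k M. block_preds (Suc k) m M1)"
  then obtain M1 where M1: "M1 \<in> hop_preds k M" "M0 \<in> block_preds (Suc k) m M1" by blast
  have o: "M1 r = M r" if "r \<noteq> k" for r using hop_preds_other M1(1) that by blast
  have k: "M0 k = M1 k" "M0 (k - 1) = M (k - 1)"
    using M1(2) o[of "k - 1"] assms by (auto simp: block_preds_def)
  have "M0 r = M r" if "r \<notin> {k..m}" for r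
    using M1(2) o[of r] that assms by (auto simp: block_preds_def)
  moreover have "M r = M0 r \<or> M r = M0 r + 1 \<and> M0 (r - 1) = M r \<and> M (Suc r) = M0 r" if "r \<in> {k..m}" for r
  proof (cases "r = k")
    case True
    then show ?thesis using k M1(1) assms unfolding in_hop_preds_iff by auto
  next
    case False
    then have "r \<in> {Suc k..m}" using that by auto
    then have "M1 r = M0 r \<or> M1 r = M0 r + 1 \<and> M0 (r - 1) = M1 r \<and> M1 (Suc r) = M0 r"
      using M1(2) unfolding block_preds_def by blast
    moreover have "Suc r \<noteq> k" using \<open>r \<in> {Suc k..m}\<close> by auto
    ultimately show ?thesis using o[of r] o[of "Suc r"] False by simp
  qed
  ultimately show "M0 \<in> block_preds k m M" by (simp add: block_preds_def)
qed

lemma history_sum_block: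
  assumes "1 \<le> k" "k \<le> Suc m"
  shows "finite (block_preds k m M) \<and>
    history_sum n X N (u @ rev [k..<Suc m]) M =
      (\<Prod>r\<in>{k..m}. X (Cr (length u + (m - r))) powi M r) * (\<Sum>M0\<in>block_preds k m M. history_sum n X N u M0)"
  using assms(2,1)
proof (induction k arbitrary: M rule: inc_induct)
  case base
  have "block_preds (Suc m) m M = {M}" by (auto simp: block_preds_def)
  then show ?case by simp
next
  case (step k)
  then have k: "1 \<le> k" "k \<le> m" by auto
  let ?G = "history_sum n X N" and ?P = "\<lambda>M. \<Prod>r\<in>{Suc k..m}. X (Cr (length u + (m - r))) powi M r"
  note IH = step.IH[OF le_SucI[OF k(1)]]
  have fin: "finite (block_preds k m M)"
    unfolding block_preds_step[OF k] using IH by auto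
  have "u @ rev [k..<Suc m] = (u @ rev [Suc k..<Suc m]) @ [k]"
    using k by (simp add: rev_upt_snoc)
  then have "?G (u @ rev [k..<Suc m]) M = X (Cr (length u + (m - k))) powi M k *
      (\<Sum>M1\<in>hop_preds k M. ?G (u @ rev [Suc k..<Suc m]) M1)"
    by (simp only: history_sum_snoc) simp
  also have "\<dots> = X (Cr (length u + (m - k))) powi M k *
      (\<Sum>M1\<in>hop_preds k M. ?P M * (\<Sum>M0\<in>block_preds (Suc k) m M1. ?G u M0))"
  proof (intro arg_cong[of _ _ "\<lambda>x. _ * x"] sum.cong[OF refl])
    fix M1 assume "M1 \<in> hop_preds k M"
    then have "?P M1 = ?P M" using hop_preds_other by (intro prod.cong) fastforce+
    then show "?G (u @ rev [Suc k..<Suc m]) M1 = ?P M * (\<Sum>M0\<in>block_preds (Suc k) m M1. ?G u M0)"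
      using IH[of M1] by simp
  qed
  also have "(\<Sum>M1\<in>hop_preds k M. ?P M * (\<Sum>M0\<in>block_preds (Suc k) m M1. ?G u M0)) =
      ?P M * (\<Sum>M0\<in>block_preds k m M. ?G u M0)"
  proof -
    have "(\<Sum>M0\<in>block_preds k m M. ?G u M0) =
      (\<Sum>M1\<in>hop_preds k M. \<Sum>M0\<in>block_preds (Suc k) m M1. ?G u M0)"
      unfolding block_preds_step[OF k]
    proof (rule sum.UNION_disjoint)
      show "\<forall>M1\<in>hop_preds k M. \<forall>M2\<in>hop_preds k M. M1 \<noteq> M2 \<longrightarrow>
          block_preds (Suc k) m M1 \<inter> block_preds (Suc k) m M2 = {}"
      proof (intro ballI impI equals0I)
        fix M1 M2 M0 assume *: "M1 \<in> hop_preds k M" "M2 \<in> hop_preds k M" "M1 \<noteq> M2"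
          "M0 \<in> block_preds (Suc k) m M1 \<inter> block_preds (Suc k) m M2"
        \<comment> \<open>The profile before the remaining block keeps the value at level
          \<open>k\<close>, so the intermediate profile can be recovered from it.\<close>
        have "M0 k = M1 k" "M0 k = M2 k" using *(4) by (auto simp: block_preds_def)
        then have "M1 = M2" using *(1,2) hop_preds_other by (intro ext) metis
        then show False using *(3) by simp
      qed
    qed (use IH in auto)
    then show ?thesis by (simp add: sum_distrib_left)
  qed
  also have "X (Cr (length u + (m - k))) powi M k * (?P M * (\<Sum>M0\<in>block_preds k m M. ?G u M0)) =
      (\<Prod>r\<in>{k..m}. X (Cr (length u + (m - r))) powi M r) * (\<Sum>M0\<in>block_preds k m M. ?G u M0)"
    using k by (subst (2) prod.atLeast_Suc_atMost) (auto simp: mult_ac)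
  finally show ?case using fin by simp
qed

text \<open>The prefix is itself a reduced word for \<open>m\<close> lines, so the base lines bound
  its histories; this discards the members of \<open>block_preds\<close> that no history
  reaches.\<close>

lemma history_sum_initial_support:
  assumes "history_sum n X (start_profile i) (initial_word m) M \<noteq> 0" "i \<le> m"
  shows "M r \<le> top_profile m i r"
proof -
  have "histories (start_profile i) (initial_word m) M \<noteq> {}"
    using assms(1) by (auto simp: history_sum_def)
  then obtain h where h: "h \<in> histories (start_profile i) (initial_word m) M" by blast
  have "(h ! length (initial_word m)) r \<le> base_profile (initial_word m) i (length (initial_word m)) r"
    using h by (intro history_le_base[OF flip_word_initial assms(2)]) (auto simp: histories_def)
  then show ?thesis using h by (simp add: base_profile_end[OF flip_word_initial assms(2)] histories_def)
qed

lemma block_preds_top: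
  assumes "1 \<le> i" "i \<le> m"
  shows "{M0 \<in> block_preds 1 m (top_profile (Suc m) i). \<forall>r. M0 r \<le> top_profile m i r} = {top_profile m i}"
proof (intro set_eqI iffI)
  fix M0 assume "M0 \<in> {M0 \<in> block_preds 1 m (top_profile (Suc m) i). \<forall>r. M0 r \<le> top_profile m i r}"
  then have a: "r \<notin> {1..m} \<Longrightarrow> M0 r = top_profile (Suc m) i r"
    and b: "r \<in> {1..m} \<Longrightarrow> top_profile (Suc m) i r = M0 r \<or> top_profile (Suc m) i r = M0 r + 1 \<and>
      M0 (r - 1) = top_profile (Suc m) i r \<and> top_profile (Suc m) i (Suc r) = M0 r"
    and c: "M0 r \<le> top_profile m i r" for r by (auto simp: block_preds_def)
  have "M0 r = top_profile m i r" for r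
    using a[of r] b[of r] c[of r] assms by (cases "r \<in> {1..m}") (auto simp: top_profile_def)
  then show "M0 \<in> {top_profile m i}" by auto
next
  fix M0 assume "M0 \<in> {top_profile m i}"
  then show "M0 \<in> {M0 \<in> block_preds 1 m (top_profile (Suc m) i). \<forall>r. M0 r \<le> top_profile m i r}"
    using assms by (auto simp: block_preds_def top_profile_def)
qed

text \<open>The only freedom is whether the hop at level \<open>m - i\<close> has happened before or
  happens in the present block. For \<open>i = m\<close> this level is 0 and there is no
  choice.\<close>

lemma block_preds_end:
  assumes "1 \<le> i" "i \<le> m"
  shows "{M0 \<in> block_preds 1 m (end_profile (Suc m) i). \<forall>r. M0 r \<le> top_profile m i r} =
    {top_profile m i} \<union> (if i < m then {end_profile m i} else {})"
proof (intro set_eqI iffI)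
  fix M0 assume "M0 \<in> {M0 \<in> block_preds 1 m (end_profile (Suc m) i). \<forall>r. M0 r \<le> top_profile m i r}"
  then have a: "r \<notin> {1..m} \<Longrightarrow> M0 r = end_profile (Suc m) i r"
    and b: "r \<in> {1..m} \<Longrightarrow> end_profile (Suc m) i r = M0 r \<or> end_profile (Suc m) i r = M0 r + 1 \<and>
      M0 (r - 1) = end_profile (Suc m) i r \<and> end_profile (Suc m) i (Suc r) = M0 r"
    and c: "M0 r \<le> top_profile m i r" for r by (auto simp: block_preds_def)
  have e: "end_profile (Suc m) i r = (if r = Suc m - i then int i - 1 else int (min i (Suc m - r)))" for r
    by (simp add: end_profile_def top_profile_def)
  have t: "top_profile m i r = int (min i (m - r))" for r
    by (simp add: top_profile_def)
  have 1: "M0 r = top_profile m i r" if r: "r \<noteq> m - i" for r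
  proof (cases "r \<in> {1..m}")
    case False
    then show ?thesis using a[of r] assms by (auto simp: e t)
  next
    case True
    consider "r < m - i" | "r = Suc m - i" | "r > Suc m - i" using r assms by fastforce
    then show ?thesis
    proof cases
      case 1
      then have "end_profile (Suc m) i r = int i" "end_profile (Suc m) i (Suc r) = int i" "top_profile m i r = int i"
        by (simp_all add: e t)
      then show ?thesis using b[OF True] by linarith
    next
      case 2
      then have "end_profile (Suc m) i r = int i - 1" "end_profile (Suc m) i (Suc r) = int i - 1"
        "top_profile m i r = int i - 1"
        using assms by (simp_all add: e t)
      then show ?thesis using b[OF True] by linarith
    next
      case 3
      then have "end_profile (Suc m) i r = int (m - r) + 1" "top_profile m i r = int (m - r)"
        using True assms by (simp_all add: e t)
      then show ?thesis using b[OF True] c[of r] by linarith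
    qed
  qed
  have 2: "M0 (m - i) = top_profile m i (m - i) \<or> i < m \<and> M0 (m - i) = int i - 1"
  proof (cases "i = m")
    case True
    then show ?thesis using a[of 0] e[of 0] t[of 0] assms by simp
  next
    case False
    then have "m - i \<in> {1..m}" "end_profile (Suc m) i (m - i) = int i" "top_profile m i (m - i) = int i"
      using assms by (auto simp: e t)
    then show ?thesis using b[of "m - i"] False assms(2) by linarith
  qed
  from 2 show "M0 \<in> {top_profile m i} \<union> (if i < m then {end_profile m i} else {})"
  proof
    assume "M0 (m - i) = top_profile m i (m - i)"
    then have "M0 = top_profile m i" using 1 by (intro ext) metis
    then show ?thesis by simp
  next
    assume *: "i < m \<and> M0 (m - i) = int i - 1"
    then have "M0 = end_profile m i" using 1 by (intro ext) (simp add: end_profile_def)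
    then show ?thesis using * by simp
  qed
next
  fix M0 assume M0: "M0 \<in> {top_profile m i} \<union> (if i < m then {end_profile m i} else {})"
  have e: "end_profile (Suc m) i r = (if r = Suc m - i then int i - 1 else int (min i (Suc m - r)))" for r
    by (simp add: end_profile_def top_profile_def)
  have m: "M0 r = int (min i (m - r)) \<or> r = m - i \<and> i < m \<and> M0 r = int i - 1" for r
  proof (cases "M0 = top_profile m i")
    case True
    then show ?thesis by (simp add: top_profile_def)
  next
    case False
    then have "i < m" "M0 = end_profile m i" using M0 by (auto split: if_splits)
    then show ?thesis by (simp add: end_profile_def top_profile_def)
  qed
  have m': "M0 r = int (min i (m - r))" if "r \<noteq> m - i" for r
    using m[of r] that by simp
  have 1: "M0 r = end_profile (Suc m) i r" if "r \<notin> {1..m}" for r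
    using m[of r] that assms by (auto simp: e)
  have 2: "end_profile (Suc m) i r = M0 r \<or> end_profile (Suc m) i r = M0 r + 1 \<and>
      M0 (r - 1) = end_profile (Suc m) i r \<and> end_profile (Suc m) i (Suc r) = M0 r" if r: "r \<in> {1..m}" for r
  proof -
    consider "r < m - i" | "r = m - i" "i < m" | "r = Suc m - i" | "r > Suc m - i" using r assms by fastforce
    then show ?thesis
    proof cases
      case 1
      then show ?thesis using m'[of r] by (auto simp: e)
    next
      case 2
      have "M0 (r - 1) = int i" using m'[of "r - 1"] 2 r by auto
      then show ?thesis using 2 m[of r] by (auto simp: e)
    next
      case 3
      then show ?thesis using m'[of r] assms by (auto simp: e)
    next
      case 4
      then show ?thesis using m'[of r] m'[of "r - 1"] r assms by (auto simp: e)
    qed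
  qed
  have "M0 r \<le> top_profile m i r" for r
    using m[of r] assms by (auto simp: top_profile_def)
  then show "M0 \<in> {M0 \<in> block_preds 1 m (end_profile (Suc m) i). \<forall>r. M0 r \<le> top_profile m i r}"
    using 1 2 unfolding block_preds_def by blast
qed

lemma history_sum_initial_step:
  fixes n :: nat and X :: "face \<Rightarrow> complex"
  defines "G \<equiv> \<lambda>i m. history_sum n X (start_profile i) (initial_word m)"
    and "P \<equiv> \<lambda>m M. \<Prod>r\<in>{1..m}. X (Cr (length (initial_word m) + (m - r))) powi (M r :: int)"
  assumes "1 \<le> i" "i \<le> m"
  shows "G i (Suc m) (top_profile (Suc m) i) = P m (top_profile (Suc m) i) * G i m (top_profile m i)"
    and "G i (Suc m) (end_profile (Suc m) i) = P m (end_profile (Suc m) i) *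
      (G i m (top_profile m i) + (if i < m then G i m (end_profile m i) else 0))"
proof -
  have *: "G i (Suc m) M = P m M * (\<Sum>M0\<in>{M0 \<in> block_preds 1 m M. \<forall>r. M0 r \<le> top_profile m i r}. G i m M0)" for M
  proof -
    have "finite (block_preds 1 m M)" "G i (Suc m) M = P m M * (\<Sum>M0\<in>block_preds 1 m M. G i m M0)"
      using history_sum_block[of 1 m M n X "start_profile i" "initial_word m"]
      unfolding G_def P_def by (auto simp: initial_word_Suc)
    moreover have "(\<Sum>M0\<in>block_preds 1 m M. G i m M0) =
        (\<Sum>M0\<in>{M0 \<in> block_preds 1 m M. \<forall>r. M0 r \<le> top_profile m i r}. G i m M0)"
      using calculation(1) history_sum_initial_support[OF _ assms(4)]
      by (intro sum.mono_neutral_right) (auto simp: G_def)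
    ultimately show ?thesis by simp
  qed
  show "G i (Suc m) (top_profile (Suc m) i) = P m (top_profile (Suc m) i) * G i m (top_profile m i)"
    unfolding * block_preds_top[OF assms(3,4)] by simp
  have "top_profile m i \<noteq> end_profile m i" if "i < m"
  proof
    assume "top_profile m i = end_profile m i"
    from fun_cong[OF this, of "m - i"] show False
      using that by (simp add: top_profile_def end_profile_def)
  qed
  then show "G i (Suc m) (end_profile (Suc m) i) = P m (end_profile (Suc m) i) *
      (G i m (top_profile m i) + (if i < m then G i m (end_profile m i) else 0))"
    unfolding * block_preds_end[OF assms(3,4)] by simp
qed

text \<open>The two end profiles differ by one at the single level \<open>Suc m - i\<close>, whose
  crossing in the last block is that of the lines \<open>i\<close> and \<open>Suc m\<close>. The
  block therefore contributes one inverse coordinate to the quotient.\<close>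

lemma gp_ratio_initial_step:
  assumes "1 \<le> i" "i \<le> m" and X: "\<And>F. X F \<noteq> 0"
  shows "history_sum n X (start_profile i) (initial_word (Suc m)) (end_profile (Suc m) i) /
      history_sum n X (start_profile i) (initial_word (Suc m)) (top_profile (Suc m) i) =
    inverse (X (Cr (length (initial_word m) + (i - 1)))) * (1 + (if i < m then
      history_sum n X (start_profile i) (initial_word m) (end_profile m i) /
      history_sum n X (start_profile i) (initial_word m) (top_profile m i) else 0))"
proof -
  let ?G = "history_sum n X (start_profile i) (initial_word m)"
  let ?T = "top_profile (Suc m) i" and ?E = "end_profile (Suc m) i"
  let ?P = "\<lambda>M. \<Prod>r\<in>{1..m}. X (Cr (length (initial_word m) + (m - r))) powi (M r :: int)"
  have T: "?G (top_profile m i) \<noteq> 0"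
    by (rule history_sum_top_nonzero[OF flip_word_initial assms(2)]) (rule X)
  have "?P ?E / ?P ?T = (\<Prod>r\<in>{1..m}. X (Cr (length (initial_word m) + (m - r))) powi (?E r) /
      X (Cr (length (initial_word m) + (m - r))) powi (?T r))"
    by (rule prod_dividef[symmetric])
  also have "\<dots> = (\<Prod>r\<in>{1..m}. if r = Suc m - i then inverse (X (Cr (length (initial_word m) + (m - r)))) else 1)"
  proof (rule prod.cong[OF refl])
    fix r assume "r \<in> {1..m}"
    have "?T (Suc m - i) = int i" using assms by (simp add: top_profile_def)
    then show "X (Cr (length (initial_word m) + (m - r))) powi (?E r) /
        X (Cr (length (initial_word m) + (m - r))) powi (?T r) =
      (if r = Suc m - i then inverse (X (Cr (length (initial_word m) + (m - r)))) else 1)"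
      using X by (auto simp: end_profile_def power_int_diff inverse_eq_divide)
  qed
  also have "\<dots> = inverse (X (Cr (length (initial_word m) + (i - 1))))"
    using assms by (subst prod.delta) (auto simp: Suc_diff_le)
  finally have P: "?P ?E / ?P ?T = inverse (X (Cr (length (initial_word m) + (i - 1))))" .
  have alg: "p * (t + x) / (q * t) = p / q * (1 + x / t)" if "q \<noteq> 0" "t \<noteq> 0" for p q t x :: complex
    using that by (simp add: field_simps)
  have "?P ?T \<noteq> 0" using X by simp
  then show ?thesis
    unfolding P[symmetric] history_sum_initial_step[OF assms(1,2)] using T
    by (subst alg) auto
qed

text \<open>The recursion in \<open>m\<close> is Horner's scheme for the nested products in Magee's
  formula.\<close>

lemma gp_ratio_initial:
  assumes "1 \<le> i" "i \<le> m" and X: "\<And>F. X F \<noteq> 0"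
  shows "history_sum n X (start_profile i) (initial_word (Suc m)) (end_profile (Suc m) i) /
      history_sum n X (start_profile i) (initial_word (Suc m)) (top_profile (Suc m) i) =
    (\<Sum>k\<in>{0..m - i}. \<Prod>j\<in>{0..k}. inverse (X (Cr (length (initial_word (m - j)) + (i - 1)))))"
  using assms(2)
proof (induction m rule: dec_induct)
  case base
  then show ?case using gp_ratio_initial_step[where n = n and X = X, OF assms(1) order_refl X] by simp
next
  case (step m)
  let ?f = "\<lambda>m. inverse (X (Cr (length (initial_word m) + (i - 1))))"
  have "history_sum n X (start_profile i) (initial_word (Suc (Suc m))) (end_profile (Suc (Suc m)) i) /
      history_sum n X (start_profile i) (initial_word (Suc (Suc m))) (top_profile (Suc (Suc m)) i) =
    ?f (Suc m) * (1 + (\<Sum>k\<in>{0..m - i}. \<Prod>j\<in>{0..k}. ?f (m - j)))"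
    using gp_ratio_initial_step[OF assms(1) le_SucI[OF step.hyps(1)], where n = n and X = X, OF X] step.hyps(1)
    unfolding step.IH by simp
  also have "\<dots> = (\<Sum>k\<in>{0..Suc (m - i)}. \<Prod>j\<in>{0..k}. ?f (Suc m - j))"
    by (simp add: sum.atLeast0_atMost_Suc_shift prod.atLeast0_atMost_Suc_shift
        sum_distrib_left distrib_left del: sum.cl_ivl_Suc prod.cl_ivl_Suc)
  also have "Suc (m - i) = Suc m - i" using step.hyps(1) by simp
  finally show ?case .
qed

lemma initial_superpotential_eval:
  assumes X: "\<And>F. X F \<noteq> 0"
  shows "laurent_eval (initial_superpotential n) X = laurent_eval (explicit_superpotential n (initial_word n)) X"
proof -
  let ?w = "initial_word n"
  let ?e = "\<lambda>k m. basis_vec (crossing_face ?w k m)"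
  have "(\<Sum>k\<in>{0..n - 1 - i}. monom_eval X (- basis_vec (Unb i) - (\<Sum>j\<in>{1..k}. ?e j (i + j)))) = level_sum X ?w i"
    (is "?L = _")
    and "(\<Sum>k\<in>{0..n - 1 - i}. monom_eval X (- (\<Sum>j\<in>{0..k}. ?e i (n - j)))) =
      history_sum n X (start_profile i) ?w (end_profile n i) / history_sum n X (start_profile i) ?w (top_profile n i)"
    (is "?R = _")
    if i: "i \<in> {1..<n}" for i
  proof -
    obtain m where m: "n = Suc m" "i \<le> m" using i by (cases n) auto
    have "length (level_crossings ?w i) = n - i" using i by (simp add: level_crossings_initial)
    then have "level_sum X ?w i = (\<Sum>k<n - i. monom_eval X (level_vec ?w i k))"
      by (simp add: level_sum_def)
    also have "\<dots> = ?L"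
      by (rule sum.cong) (use i level_vec_initial[of i _ n] in auto)
    finally show "?L = level_sum X ?w i" by simp
    have "?R = (\<Sum>k\<in>{0..m - i}. \<Prod>j\<in>{0..k}. inverse (X (Cr (length (initial_word (m - j)) + (i - 1)))))"
    proof (rule sum.cong)
      fix k assume k: "k \<in> {0..m - i}"
      have "monom_eval X (- (\<Sum>j\<in>{0..k}. ?e i (n - j))) = (\<Prod>j\<in>{0..k}. inverse (X (crossing_face ?w i (n - j))))"
        by (simp add: monom_eval_uminus monom_eval_sum X prod_inversef[symmetric] o_def)
      also have "\<dots> = (\<Prod>j\<in>{0..k}. inverse (X (Cr (length (initial_word (m - j)) + (i - 1)))))"
      proof (rule prod.cong[OF refl])
        fix j assume "j \<in> {0..k}"
        then have "crossing_face ?w i (Suc (m - j)) = Cr (length (initial_word (m - j)) + (i - 1))"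
          using i k m by (intro crossing_face_initial) auto
        moreover have "n - j = Suc (m - j)" using \<open>j \<in> {0..k}\<close> k m by auto
        ultimately show "inverse (X (crossing_face ?w i (n - j))) =
            inverse (X (Cr (length (initial_word (m - j)) + (i - 1))))" by simp
      qed
      finally show "monom_eval X (- (\<Sum>j\<in>{0..k}. ?e i (n - j))) =
          (\<Prod>j\<in>{0..k}. inverse (X (Cr (length (initial_word (m - j)) + (i - 1)))))" .
    qed (use m in simp)
    then show "?R = history_sum n X (start_profile i) ?w (end_profile n i) /
        history_sum n X (start_profile i) ?w (top_profile n i)"
      using gp_ratio_initial[where n = n and X = X, OF _ m(2) X] i m by simp
  qed
  note * = this
  have "laurent_eval (initial_superpotential n) X = (\<Sum>i\<in>{1..<n}.
      (\<Sum>k\<in>{0..n - 1 - i}. monom_eval X (- basis_vec (Unb i) - (\<Sum>j\<in>{1..k}. ?e j (i + j)))) +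
      (\<Sum>k\<in>{0..n - 1 - i}. monom_eval X (- (\<Sum>j\<in>{0..k}. ?e i (n - j)))))"
    by (simp only: initial_superpotential_def Let_def laurent_eval_sum laurent_eval_add laurent_eval_monom)
  also have "\<dots> = laurent_eval (explicit_superpotential n ?w) X"
    unfolding explicit_superpotential_eval[OF flip_word_initial X]
    by (rule sum.cong[OF refl]) (simp only: * add.commute)
  finally show ?thesis .
qed

lemma initial_superpotential_explicit:
  "initial_superpotential n = explicit_superpotential n (initial_word n)"
  by (rule laurent_eqI, rule initial_superpotential_eval) (metis less_irrefl of_real_eq_0_iff)

text \<open>In one direction, every chain of moves leads to the same polynomial, by evaluation at
  positive points; in the other, some chain of moves reaches \<open>w\<close>. Together they give
  the definite description its value.\<close>

lemma superpotential_expr_iff: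
  assumes "flip_word n w"
  shows "superpotential_expr n w f \<longleftrightarrow> f = explicit_superpotential n w"
proof
  assume "superpotential_expr n w f"
  then have "flip_word n w \<and> f = explicit_superpotential n w"
  proof induction
    case initial
    then show ?case by (simp add: flip_word_initial initial_superpotential_explicit)
  next
    case (commutation w f j w' f')
    then have w: "flip_word n w" "f = explicit_superpotential n w" by auto
    have "f' = explicit_superpotential n w'"
    proof (rule laurent_eqI)
      fix a :: "face \<Rightarrow> real" assume "\<And>F. a F > 0"
      then have a: "complex_of_real (a F) \<noteq> 0" for F by (metis less_irrefl of_real_eq_0_iff)
      show "laurent_eval f' (\<lambda>F. complex_of_real (a F)) =
          laurent_eval (explicit_superpotential n w') (\<lambda>F. complex_of_real (a F))"
        using explicit_superpotential_commutation[where X' = "\<lambda>F. complex_of_real (a F)", OF w(1) commutation.hyps(2) a]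
          commutation.hyps(3)[of "\<lambda>F. complex_of_real (a F)"] a w(2) by simp
    qed
    moreover have "flip_word n w'"
      using flip_word_move w(1) commutation.hyps(2) by (auto simp: word_move_def)
    ultimately show ?case by blast
  next
    case (braid w f j w' f')
    then have w: "flip_word n w" "f = explicit_superpotential n w" by auto
    have "f' = explicit_superpotential n w'"
    proof (rule laurent_eqI)
      fix a :: "face \<Rightarrow> real" assume pos: "\<And>F. a F > 0"
      then have a: "complex_of_real (a F) \<noteq> 0" for F by (metis less_irrefl of_real_eq_0_iff)
      have "1 + a (Cr j) \<noteq> 0" using pos[of "Cr j"] by simp
      then have a1: "1 + complex_of_real (a (Cr j)) \<noteq> 0"
        by (metis of_real_1 of_real_add of_real_eq_0_iff)
      show "laurent_eval f' (\<lambda>F. complex_of_real (a F)) =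
          laurent_eval (explicit_superpotential n w') (\<lambda>F. complex_of_real (a F))"
        using explicit_superpotential_braid[where X' = "\<lambda>F. complex_of_real (a F)", OF w(1) braid.hyps(2) a a1]
          braid.hyps(3)[of "\<lambda>F. complex_of_real (a F)"] a a1 w(2) by simp
    qed
    moreover have "flip_word n w'"
      using flip_word_move w(1) braid.hyps(2) by (auto simp: word_move_def)
    ultimately show ?case by blast
  qed
  then show "f = explicit_superpotential n w" by blast
next
  have "word_move\<^sup>*\<^sup>* (initial_word n) w"
    using flip_words_connected flip_word_initial assms by blast
  then have "flip_word n w \<and> superpotential_expr n w (explicit_superpotential n w)"
  proof (induction rule: rtranclp_induct)
    case base
    then show ?case
      using superpotential_expr.initial[of n] by (simp add: initial_superpotential_explicit flip_word_initial)
  next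
    case (step w w')
    then obtain j where "commutation_move w j w' \<or> braid_move w j w'" by (auto simp: word_move_def)
    then have "superpotential_expr n w' (explicit_superpotential n w')"
    proof
      assume m: "commutation_move w j w'"
      show ?thesis
        using step.IH explicit_superpotential_commutation[OF _ m]
        by (intro superpotential_expr.commutation[OF _ m]) auto
    next
      assume m: "braid_move w j w'"
      show ?thesis
        using step.IH explicit_superpotential_braid[OF _ m]
        by (intro superpotential_expr.braid[OF _ m]) auto
    qed
    then show ?case using step flip_word_move by blast
  qed
  then show "superpotential_expr n w f" if "f = explicit_superpotential n w" using that by blast
qed

lemma superpotential_explicit: "flip_word n w \<Longrightarrow> superpotential n w = explicit_superpotential n w"
  unfolding superpotential_def by (rule the_equality) (simp_all add: superpotential_expr_iff)

section \<open>GP-paths as histories\<close>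

definition lower_line :: "nat list \<Rightarrow> nat \<Rightarrow> nat" where
  "lower_line w j = word_perm (take j w) (w ! j)"

definition upper_line :: "nat list \<Rightarrow> nat \<Rightarrow> nat" where
  "upper_line w j = word_perm (take j w) (Suc (w ! j))"

text \<open>Lines up to \<open>i\<close> run to the left, so they arrive at crossing
  \<open>j\<close> from column \<open>Suc j\<close>; the others arrive from column
  \<open>j\<close>.\<close>

definition in_piece :: "nat \<Rightarrow> nat \<Rightarrow> nat \<Rightarrow> nat \<times> nat" where
  "in_piece i j d = (if d \<le> i then Suc j else j, d)"

definition out_piece :: "nat \<Rightarrow> nat \<Rightarrow> nat \<Rightarrow> nat \<times> nat" where
  "out_piece i j d = (if d \<le> i then j else Suc j, d)"

lemma in_piece_inject [simp]: "in_piece i j d = in_piece i j' d' \<longleftrightarrow> j = j' \<and> d = d'"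
  by (auto simp: in_piece_def)

lemma out_piece_inject [simp]: "out_piece i j d = out_piece i j' d' \<longleftrightarrow> j = j' \<and> d = d'"
  by (auto simp: out_piece_def)

lemma snd_piece [simp]: "snd (in_piece i j d) = d" "snd (out_piece i j d) = d"
  by (auto simp: in_piece_def out_piece_def)

lemma crosses_iff:
  "crosses w j d e \<longleftrightarrow> j < length w \<and>
    (d = lower_line w j \<and> e = upper_line w j \<or> d = upper_line w j \<and> e = lower_line w j)"
  by (auto simp: crosses_def doubleton_eq_iff height_eq_iff lower_line_def upper_line_def)

text \<open>Rigor for reduced words: if the two lines run in the same direction, exactly one
  straight passage is forbidden, that of the lower line to the left or that of the upper line to the
  right.\<close>

definition turns_at :: "nat list \<Rightarrow> nat \<Rightarrow> nat \<Rightarrow> nat \<Rightarrow> nat \<Rightarrow> bool" where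
  "turns_at w i j d e \<longleftrightarrow> (if d \<in> {lower_line w j, upper_line w j}
     then e \<in> {lower_line w j, upper_line w j} \<and>
       \<not> (upper_line w j \<le> i \<and> d = lower_line w j \<and> e = lower_line w j) \<and>
       \<not> (i < lower_line w j \<and> d = upper_line w j \<and> e = upper_line w j)
     else d = e)"

lemma rigorous_step_iff:
  assumes "\<And>j. j < length w \<Longrightarrow> lower_line w j < upper_line w j"
  shows "rigorous_step w i P Q \<longleftrightarrow>
    (\<exists>j<length w. \<exists>d e. P = in_piece i j d \<and> Q = out_piece i j e \<and> turns_at w i j d e)"
proof -
  have l: "leaves_at i P j \<longleftrightarrow> P = in_piece i j (snd P)" for j
    by (cases P) (auto simp: leaves_at_def in_piece_def)
  have e: "enters_at i Q j \<longleftrightarrow> Q = out_piece i j (snd Q)" for j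
    by (cases Q) (auto simp: enters_at_def out_piece_def)
  have t: "d = e \<and> \<not> straight_forbidden w i j d \<or> crosses w j d e \<longleftrightarrow> turns_at w i j d e"
    if "j < length w" for j d e
    using assms[OF that] that unfolding straight_forbidden_def crosses_iff turns_at_def by auto
  show ?thesis unfolding rigorous_step_def l e
    by (metis t snd_piece)
qed

definition lines_at :: "nat \<Rightarrow> nat \<Rightarrow> (nat \<times> nat) set \<Rightarrow> nat \<Rightarrow> nat set" where
  "lines_at n i U c = {a \<in> {1..n}. (a \<le> i) \<noteq> ((c, a) \<in> U)}"

text \<open>Conservation and rigor at every crossing, as satisfied by the set of pieces of a GP-path.\<close>

definition balanced :: "nat \<Rightarrow> nat list \<Rightarrow> nat \<Rightarrow> (nat \<times> nat) set \<Rightarrow> bool" where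
  "balanced n w i U \<longleftrightarrow> (\<forall>j<length w. let a = lower_line w j; b = upper_line w j in
     (\<forall>d\<in>{1..n} - {a, b}. in_piece i j d \<in> U \<longleftrightarrow> out_piece i j d \<in> U) \<and>
     card (U \<inter> {in_piece i j a, in_piece i j b}) = card (U \<inter> {out_piece i j a, out_piece i j b}) \<and>
     (b \<le> i \<and> in_piece i j a \<in> U \<longrightarrow> out_piece i j b \<in> U) \<and>
     (i < a \<and> in_piece i j b \<in> U \<longrightarrow> out_piece i j a \<in> U))"

lemma card_Int_two: "x \<noteq> y \<Longrightarrow> card (U \<inter> {x, y}) = of_bool (x \<in> U) + of_bool (y \<in> U)"
  by (simp add: Int_insert_right)

lemma count_above_split:
  assumes "finite S" "a \<noteq> b"
  shows "count_above w c S r = count_above w c (S - {a, b}) r +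
    of_bool (a \<in> S \<and> r < height w c a) + of_bool (b \<in> S \<and> r < height w c b)"
proof -
  let ?T = "{x \<in> S - {a, b}. r < height w c x}"
  have "{x \<in> S. r < height w c x} = ?T \<union> {x \<in> {a, b}. x \<in> S \<and> r < height w c x}" by auto
  moreover have "card (?T \<union> {x \<in> {a, b}. x \<in> S \<and> r < height w c x}) =
      card ?T + card {x \<in> {a, b}. x \<in> S \<and> r < height w c x}"
    using assms by (intro card_Un_disjoint) auto
  moreover have "{x \<in> {a, b}. x \<in> S \<and> r < height w c x} =
      (if a \<in> S \<and> r < height w c a then {a} else {}) \<union> (if b \<in> S \<and> r < height w c b then {b} else {})"
    by auto
  ultimately show ?thesis using assms(2) by (auto simp: count_above_def)
qed

text \<open>In this form, conservation at a crossing is a statement on cardinalities under a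
  bijection.\<close>

lemma path_successor:
  assumes "ps \<noteq> []" "distinct ps" "successively R ps"
  shows "\<exists>f. bij_betw f (set ps - {last ps}) (set ps - {hd ps}) \<and> (\<forall>P\<in>set ps - {last ps}. R P (f P))"
  using assms
proof (induction ps)
  case (Cons x ps)
  show ?case
  proof (cases ps)
    case Nil
    then show ?thesis by (auto simp: bij_betw_def)
  next
    case (Cons y r)
    then obtain f where f: "bij_betw f (set ps - {last ps}) (set ps - {hd ps})"
      "\<forall>P\<in>set ps - {last ps}. R P (f P)"
      using Cons.IH Cons.prems by auto
    have x: "x \<notin> set ps" "R x y" using Cons.prems Cons by auto
    have e: "set (x # ps) - {last (x # ps)} = (set ps - {last ps}) \<union> {x}"
      "set (x # ps) - {hd (x # ps)} = (set ps - {hd ps}) \<union> {y}"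
      using x Cons by auto
    have "bij_betw (f(x := y)) (set ps - {last ps}) (set ps - {hd ps})"
      using f(1) x(1) by (subst bij_betw_cong[of _ _ f]) auto
    then have "bij_betw (f(x := y)) (set (x # ps) - {last (x # ps)}) (set (x # ps) - {hd (x # ps)})"
      unfolding e using notIn_Un_bij_betw[of x "set ps - {last ps}" "f(x := y)" "set ps - {hd ps}"] x Cons
      by simp
    moreover have "\<forall>P\<in>set (x # ps) - {last (x # ps)}. R P ((f(x := y)) P)"
      unfolding e using f(2) x by auto
    ultimately show ?thesis by blast
  qed
qed simp

text \<open>Iterate a successor from \<open>s\<close>. A first repetition is impossible, as the
  relation is injective and \<open>s\<close> has no predecessor; by finiteness the orbit must stop,
  and it can only stop at \<open>t\<close>.\<close>

lemma successor_path:
  assumes fin: "finite U" and s: "s \<in> U" and t: "t \<in> U"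
    and succ: "\<And>P. P \<in> U \<Longrightarrow> P \<noteq> t \<Longrightarrow> \<exists>Q\<in>U. R P Q"
    and inj: "\<And>P P' Q.
      P \<in> U \<Longrightarrow> P' \<in> U \<Longrightarrow> Q \<in> U \<Longrightarrow> R P Q \<Longrightarrow> R P' Q \<Longrightarrow> P = P'"
    and src: "\<And>P. P \<in> U \<Longrightarrow> \<not> R P s"
  shows "\<exists>ps. ps \<noteq> [] \<and> distinct ps \<and> successively R ps \<and> set ps \<subseteq> U \<and> hd ps = s \<and> last ps = t"
proof -
  define f where "f P = (SOME Q. Q \<in> U \<and> R P Q)" for P
  have f: "f P \<in> U \<and> R P (f P)" if "P \<in> U" "P \<noteq> t" for P
    unfolding f_def by (rule someI_ex) (use succ[OF that] in blast)
  define g where "g k = (f ^^ k) s" for k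
  have g: "g 0 = s" "g (Suc k) = f (g k)" for k by (auto simp: g_def)
  have gU: "g k \<in> U" if "\<forall>m<k. g m \<noteq> t" for k
    using that by (induction k) (use f s in \<open>auto simp: g\<close>)
  have ginj: "a = b" if "\<forall>m<k. g m \<noteq> t" "a \<le> k" "b \<le> k" "g a = g b" for a b k
    using that(2-4)
  proof (induction a arbitrary: b)
    case 0
    show ?case
    proof (cases b)
      case (Suc b')
      then have "g b' \<in> U" "g b' \<noteq> t" using gU[of b'] that(1) 0 by auto
      then have "R (g b') s" using f[of "g b'"] 0 Suc by (simp add: g)
      then show ?thesis using src \<open>g b' \<in> U\<close> by blast
    qed simp
  next
    case (Suc a)
    have a: "g a \<in> U" "g a \<noteq> t" using gU[of a] that(1) Suc.prems by auto
    show ?case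
    proof (cases b)
      case 0
      then show ?thesis using f[OF a] src[OF a(1)] Suc.prems by (simp add: g)
    next
      case (Suc b')
      have b: "g b' \<in> U" "g b' \<noteq> t" using gU[of b'] that(1) Suc.prems Suc by auto
      have "g a = g b'"
        using inj[OF a(1) b(1), of "f (g a)"] f[OF a] f[OF b] Suc.prems Suc by (simp add: g)
      then show ?thesis using Suc.IH[of b'] Suc.prems Suc by simp
    qed
  qed
  have "\<exists>k. g k = t"
  proof (rule ccontr)
    assume "\<nexists>k. g k = t"
    then have n: "\<forall>m<k. g m \<noteq> t" for k by blast
    have "inj g" using ginj[OF n] by (metis injI nle_le)
    moreover have "range g \<subseteq> U" using gU[OF n] by blast
    ultimately show False using fin by (meson finite_subset infinite_UNIV_nat finite_imageD)
  qed
  then obtain k where k: "g k = t" "\<forall>m<k. g m \<noteq> t"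
    using exists_least_iff[of "\<lambda>k. g k = t"] by blast
  let ?ps = "map g [0..<Suc k]"
  have "distinct ?ps"
    unfolding distinct_map using ginj[OF k(2)] by (auto intro!: inj_onI)
  moreover have "successively R ?ps"
    using f gU k(2) unfolding successively_conv_nth
    by (auto simp: g nth_upt simp del: upt_Suc)
  moreover have "set ?ps \<subseteq> U" using gU k(2) by (auto simp: less_Suc_eq_le)
  moreover have "hd ?ps = s" by (simp add: hd_map upt_conv_Cons g)
  moreover have "last ?ps = t" by (simp add: last_map k)
  ultimately show ?thesis by (intro exI[of _ ?ps]) (auto simp: upt_Suc)
qed

context
  fixes n i :: nat and w :: "nat list"
  assumes w: "flip_word n w" and i: "i \<in> {1..<n}"
begin

lemma i_le: "i \<le> n"
  using i by simp

lemma crossing_lines: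
  assumes "j < length w"
  shows "lower_line w j < upper_line w j" "lower_line w j \<in> {1..n}" "upper_line w j \<in> {1..n}"
    and "w ! j \<in> {1..<n}"
proof -
  have s: "simple_word n w" "w ! j \<in> {1..<n}"
    using w assms simple_word_nth by (auto simp: flip_word_def)
  show "w ! j \<in> {1..<n}" by fact
  show "lower_line w j < upper_line w j"
    unfolding lower_line_def upper_line_def by (rule flip_word_crossing_less[OF w assms])
  show "lower_line w j \<in> {1..n}" "upper_line w j \<in> {1..n}"
    unfolding lower_line_def upper_line_def word_perm_take_in[OF s(1)] using s(2) by auto
qed

lemma step_iff:
  "rigorous_step w i P Q \<longleftrightarrow>
    (\<exists>j<length w. \<exists>d e. P = in_piece i j d \<and> Q = out_piece i j e \<and> turns_at w i j d e)"
  by (rule rigorous_step_iff) (rule crossing_lines)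

lemma crossing_heights:
  assumes "j < length w"
  shows "height w j (lower_line w j) = w ! j" "height w j (upper_line w j) = Suc (w ! j)"
    "height w (Suc j) (lower_line w j) = Suc (w ! j)" "height w (Suc j) (upper_line w j) = w ! j"
    "d \<notin> {lower_line w j, upper_line w j} \<Longrightarrow> height w (Suc j) d = height w j d"
    "d \<notin> {lower_line w j, upper_line w j} \<Longrightarrow> height w j d \<noteq> w ! j \<and> height w j d \<noteq> Suc (w ! j)"
proof -
  show 1: "height w j (lower_line w j) = w ! j" "height w j (upper_line w j) = Suc (w ! j)"
    by (simp_all add: lower_line_def upper_line_def)
  show "height w (Suc j) (lower_line w j) = Suc (w ! j)" "height w (Suc j) (upper_line w j) = w ! j"
    by (simp_all add: height_Suc[OF assms] 1)
  show 2: "height w j d \<noteq> w ! j \<and> height w j d \<noteq> Suc (w ! j)" if "d \<notin> {lower_line w j, upper_line w j}"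
    using that unfolding height_eq_iff by (auto simp: lower_line_def upper_line_def)
  show "height w (Suc j) d = height w j d" if "d \<notin> {lower_line w j, upper_line w j}"
    using 2[OF that] by (simp add: height_Suc[OF assms] transpose_def)
qed

lemma finite_lines_at [simp]: "finite (lines_at n i U c)"
  by (simp add: lines_at_def)

text \<open>The symmetric difference with the base lines reverses the pieces running to the left, so
  conservation of the flow through a crossing becomes conservation of the number of particles. Rigor
  restricts the steps downwards.\<close>

lemma balanced_step:
  assumes "balanced n w i U" "j < length w"
  defines "M \<equiv> \<lambda>c. count_above w c (lines_at n i U c)"
  shows "M j \<in> hop_preds (w ! j) (M (Suc j)) \<or>
    lower_line w j \<le> i \<and> i < upper_line w j \<and> M (Suc j) = (M j)(w ! j := M j (w ! j) - 1)"
proof -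
  let ?a = "lower_line w j" and ?b = "upper_line w j" and ?s = "w ! j"
  let ?S = "lines_at n i U"
  note ab = crossing_lines[OF assms(2)]
  note ht = crossing_heights[OF assms(2)]
  have bal: "\<And>d. d \<in> {1..n} - {?a, ?b} \<Longrightarrow> in_piece i j d \<in> U \<longleftrightarrow> out_piece i j d \<in> U"
    "card (U \<inter> {in_piece i j ?a, in_piece i j ?b}) = card (U \<inter> {out_piece i j ?a, out_piece i j ?b})"
    "?b \<le> i \<Longrightarrow> in_piece i j ?a \<in> U \<Longrightarrow> out_piece i j ?b \<in> U"
    "i < ?a \<Longrightarrow> in_piece i j ?b \<in> U \<Longrightarrow> out_piece i j ?a \<in> U"
    using assms(1,2) unfolding balanced_def Let_def by blast+
  have S: "?S j - {?a, ?b} = ?S (Suc j) - {?a, ?b}"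
  proof -
    have "d \<in> ?S j \<longleftrightarrow> d \<in> ?S (Suc j)" if "d \<notin> {?a, ?b}" for d
      using bal(1)[of d] that by (auto simp: lines_at_def in_piece_def out_piece_def split: if_splits)
    then show ?thesis by blast
  qed
  have ne: "?a \<noteq> ?b" using ab(1) by simp
  have mem: "?a \<in> ?S c \<longleftrightarrow> (?a \<le> i) \<noteq> ((c, ?a) \<in> U)"
    "?b \<in> ?S c \<longleftrightarrow> (?b \<le> i) \<noteq> ((c, ?b) \<in> U)" for c
    using ab(2,3) by (simp_all add: lines_at_def)
  have C: "of_bool (?a \<in> ?S j) + of_bool (?b \<in> ?S j) = (of_bool (?a \<in> ?S (Suc j)) + of_bool (?b \<in> ?S (Suc j)) :: int)"
  proof -
    have "of_bool (in_piece i j ?a \<in> U) + of_bool (in_piece i j ?b \<in> U) =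
        (of_bool (out_piece i j ?a \<in> U) + of_bool (out_piece i j ?b \<in> U) :: nat)"
      using bal(2) ne by (simp add: card_Int_two)
    then show ?thesis using ab(1) unfolding mem in_piece_def out_piece_def
      by (cases "?a \<le> i"; cases "?b \<le> i"; cases "(j, ?a) \<in> U"; cases "(Suc j, ?a) \<in> U";
          cases "(j, ?b) \<in> U"; cases "(Suc j, ?b) \<in> U") simp_all
  qed
  \<comment> \<open>This would be a particle moving down. Between two base lines, or two other
    lines, it would enter on the line that may not go straight without taking the turn that rigor
    demands.\<close>
  have F: "?a \<le> i \<and> i < ?b" if "?b \<in> ?S j" "?a \<notin> ?S (Suc j)"
  proof -
    have "?b \<le> i \<Longrightarrow> ?a \<le> i" using ab(1) by simp
    then show ?thesis using bal(3,4) that unfolding mem in_piece_def out_piece_def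
      by (cases "?a \<le> i"; cases "?b \<le> i") simp_all
  qed
  have base: "count_above w (Suc j) (?S (Suc j) - {?a, ?b}) r = count_above w j (?S j - {?a, ?b}) r" for r
  proof -
    have "{x \<in> ?S j - {?a, ?b}. r < height w (Suc j) x} = {x \<in> ?S j - {?a, ?b}. r < height w j x}"
      using ht(5) by auto
    then show ?thesis unfolding S[symmetric] by (simp add: count_above_def)
  qed
  have diff: "M (Suc j) r = M j r + of_bool (?a \<in> ?S (Suc j) \<and> r \<le> ?s) + of_bool (?b \<in> ?S (Suc j) \<and> r < ?s)
      - of_bool (?a \<in> ?S j \<and> r < ?s) - of_bool (?b \<in> ?S j \<and> r \<le> ?s)" for r
    unfolding M_def count_above_split[OF finite_lines_at ne, of w "Suc j"] count_above_split[OF finite_lines_at ne, of w j] base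
    by (simp add: ht less_Suc_eq_le)
  have other: "M (Suc j) r = M j r" if "r \<noteq> ?s" for r
    using diff[of r] C that by (cases "r < ?s") simp_all
  have s: "M (Suc j) ?s = M j ?s + of_bool (?a \<in> ?S (Suc j)) - of_bool (?b \<in> ?S j)"
    using diff[of ?s] by simp
  have lev: "M (Suc j) (?s - 1) = M (Suc j) ?s + of_bool (?b \<in> ?S (Suc j))"
    "M (Suc j) ?s = M (Suc j) (Suc ?s) + of_bool (?a \<in> ?S (Suc j))"
    using count_above_Suc_level[of "?S (Suc j)" w "Suc j" "?s - 1"]
      count_above_Suc_level[of "?S (Suc j)" w "Suc j" ?s] ab(4) ht(3,4)
    unfolding M_def by (simp_all add: height_eq_iff)
  consider "?a \<in> ?S (Suc j) \<longleftrightarrow> ?b \<in> ?S j" | "?a \<in> ?S (Suc j)" "?b \<notin> ?S j"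
    | "?a \<notin> ?S (Suc j)" "?b \<in> ?S j"
    by blast
  then show ?thesis
  proof cases
    case 1
    have "M j r = M (Suc j) r" for r
      by (cases "r = ?s") (use other[of r] s 1 in simp_all)
    then have "M j = M (Suc j)" by (rule ext)
    then show ?thesis by (simp add: in_hop_preds_iff)
  next
    case 2
    then have "?b \<notin> ?S (Suc j)" using C by (cases "?a \<in> ?S j"; cases "?b \<in> ?S (Suc j)") simp_all
    moreover have "M j = (M (Suc j))(?s := M (Suc j) ?s - 1)"
    proof
      fix r show "M j r = ((M (Suc j))(?s := M (Suc j) ?s - 1)) r"
        by (cases "r = ?s") (use other[of r] s 2 in simp_all)
    qed
    ultimately show ?thesis using lev 2 unfolding in_hop_preds_iff by simp
  next
    case 3
    have "M (Suc j) = (M j)(?s := M j ?s - 1)"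
    proof
      fix r show "M (Suc j) r = ((M j)(?s := M j ?s - 1)) r"
        by (cases "r = ?s") (use other[of r] s 3 in simp_all)
    qed
    then show ?thesis using F 3 by blast
  qed
qed

text \<open>A double passage through a crossing would be a downward step of the history, and the bounds
  on the deficit exclude these.\<close>

lemma balanced_history:
  assumes bal: "balanced n w i U"
    and start: "lines_at n i U 0 = {1..i}"
    and fin: "\<And>r. top_profile n i r - count_above w (length w) (lines_at n i U (length w)) r \<le> 1"
    and j: "j < length w"
  shows "count_above w j (lines_at n i U j) \<in> hop_preds (w ! j) (count_above w (Suc j) (lines_at n i U (Suc j)))"
proof -
  let ?M = "\<lambda>c. count_above w c (lines_at n i U c)" and ?s = "w ! j"
  have M0: "?M 0 = start_profile i"
    using base_profile_0[of w i] start by (simp add: base_profile_def)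
  have D: "0 \<le> base_profile w i c r - ?M c r \<and> base_profile w i c r - ?M c r \<le> 1" if "c \<le> length w" for c r
    by (rule deficit_bounds[OF w i_le, where h = ?M])
      (use M0 balanced_step[OF bal] fin that in \<open>auto simp: lower_line_def upper_line_def\<close>)
  from balanced_step[OF bal j] show ?thesis
  proof
    assume *: "lower_line w j \<le> i \<and> i < upper_line w j \<and> ?M (Suc j) = (?M j)(?s := ?M j ?s - 1)"
    then have "base_profile w i (Suc j) ?s = base_profile w i j ?s + 1"
      using base_step[OF w i_le j] by (simp add: lower_line_def upper_line_def)
    moreover have "?M (Suc j) ?s = ?M j ?s - 1" using * by (metis fun_upd_same)
    ultimately show ?thesis using D[of j ?s] D[of "Suc j" ?s] j by linarith
  qed
qed

lemma lines_at_eqI: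
  assumes "S \<subseteq> {1..n}" "S' \<subseteq> {1..n}" "\<And>r. count_above w c S r = count_above w c S' r"
  shows "S = S'"
proof -
  have f: "finite S" "finite S'" by (meson assms(1,2) finite_atLeastAtMost finite_subset)+
  have "d \<in> S \<longleftrightarrow> d \<in> S'" if d: "d \<in> {1..n}" for d
  proof -
    have "simple_word n w" using w by (simp add: flip_word_def)
    then have "height w c d \<in> {1..n}" using d height_in by blast
    then obtain r where r: "height w c d = Suc r" by (cases "height w c d") auto
    then have "word_perm (take c w) (Suc r) = d" by (metis word_perm_height)
    then show ?thesis
      using count_above_Suc_level[OF f(1), of w c r] count_above_Suc_level[OF f(2), of w c r] assms(3)
      by (auto simp: of_bool_def split: if_splits)
  qed
  then show ?thesis using assms by blast
qed

text \<open>Such pieces would form closed curves. Their history has the same two ends as the base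
  lines, hence it is the history of the base lines and there are no pieces at all.\<close>

lemma no_leftover:
  assumes bal: "balanced n w i U"
    and sub: "U \<subseteq> {..length w} \<times> {1..n}"
    and ends: "\<And>a. (0, a) \<notin> U" "\<And>a. (length w, a) \<notin> U"
  shows "U = {}"
proof -
  let ?M = "\<lambda>c. count_above w c (lines_at n i U c)"
  have 0: "lines_at n i U 0 = {1..i}" "lines_at n i U (length w) = {1..i}"
    using ends i by (auto simp: lines_at_def)
  have l: "?M (length w) = top_profile n i"
    using base_profile_end[OF w i_le] 0 by (simp add: base_profile_def)
  have M0: "?M 0 = start_profile i"
    using base_profile_0[of w i] 0 by (simp add: base_profile_def)
  have "?M c = base_profile w i c" if "c \<le> length w" for c
    by (rule no_deficit[OF w i_le, where h = ?M]) (use M0 l balanced_history[OF bal 0(1)] that in auto)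
  then have "lines_at n i U c = {1..i}" if "c \<le> length w" for c
    using that i by (intro lines_at_eqI[where c = c]) (auto simp: base_profile_def lines_at_def)
  note lines = this
  have "(c, a) \<notin> U" if "c \<le> length w" "a \<in> {1..n}" for c a
  proof -
    have "a \<in> lines_at n i U c \<longleftrightarrow> a \<in> {1..i}" using lines[OF that(1)] by simp
    then show ?thesis using that(2) by (auto simp: lines_at_def)
  qed
  then show ?thesis using sub by auto
qed

text \<open>A base piece on the path counts 1 and is missing from \<open>lines_at\<close>; any other
  piece on the path counts -1 and is added to it.\<close>

lemma winding_eq:
  assumes "\<And>P. P \<in> set ps \<Longrightarrow> snd P \<in> {1..n}"
  shows "winding w i ps c r = base_profile w i c r - count_above w c (lines_at n i (set ps) c) r"
proof -
  let ?U = "set ps"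
  let ?L = "{a \<in> {1..i}. (c, a) \<in> ?U \<and> r < height w c a}"
  let ?R = "{a \<in> {i<..n}. (c, a) \<in> ?U \<and> r < height w c a}"
  let ?B = "{a \<in> {1..i}. r < height w c a}"
  have "{P \<in> ?U. fst P = c \<and> r < height w c (snd P) \<and> snd P \<le> i} = Pair c ` ?L"
    using assms by (auto simp: image_iff)
  then have 1: "card {P \<in> ?U. fst P = c \<and> r < height w c (snd P) \<and> snd P \<le> i} = card ?L"
    by (simp add: card_image inj_on_def)
  have "{P \<in> ?U. fst P = c \<and> r < height w c (snd P) \<and> i < snd P} = Pair c ` ?R"
    using assms by (auto simp: image_iff)
  then have 2: "card {P \<in> ?U. fst P = c \<and> r < height w c (snd P) \<and> i < snd P} = card ?R"
    by (simp add: card_image inj_on_def)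
  have "{a \<in> lines_at n i ?U c. r < height w c a} = (?B - ?L) \<union> ?R"
    using i by (auto simp: lines_at_def)
  moreover have "card ((?B - ?L) \<union> ?R) = card (?B - ?L) + card ?R"
    by (rule card_Un_disjoint) auto
  moreover have "card (?B - ?L) = card ?B - card ?L" by (rule card_Diff_subset) auto
  moreover have "card ?L \<le> card ?B" by (rule card_mono) auto
  ultimately show ?thesis
    unfolding winding_def 1 2 by (simp add: base_profile_def count_above_def)
qed

lemma path_vec_eq:
  assumes ps: "\<And>P. P \<in> set ps \<Longrightarrow> snd P \<in> {1..n}"
    and h: "h \<in> histories (start_profile i) w (end_profile n i)"
    and c: "\<And>c. c \<le> length w \<Longrightarrow> count_above w c (lines_at n i (set ps) c) = h ! c"
  shows "path_vec n w i ps = gp_vec i w h"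
proof -
  let ?A = "{c. c < length w \<and> (h ! Suc c) (w ! c) < base_profile w i (Suc c) (w ! c)}"
  have "enclosed_faces n w i ps = Cr ` ?A"
  proof (intro set_eqI iffI)
    fix F assume F: "F \<in> enclosed_faces n w i ps"
    show "F \<in> Cr ` ?A"
    proof (cases F)
      case (Unb r)
      have "h ! 0 = base_profile w i 0" using h by (simp add: histories_def base_profile_0)
      then show ?thesis using F Unb c[of 0] by (auto simp: enclosed_faces_def winding_eq[OF ps])
    next
      case (Cr k)
      then show ?thesis using F c[of "Suc k"]
        by (auto simp: enclosed_faces_def winding_eq[OF ps] faces_def)
    qed
  next
    fix F assume "F \<in> Cr ` ?A"
    then obtain k where k: "F = Cr k" "k < length w" "(h ! Suc k) (w ! k) < base_profile w i (Suc k) (w ! k)"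
      by auto
    then show "F \<in> enclosed_faces n w i ps"
      using c[of "Suc k"] history_deficit[OF w i_le h, of "Suc k" "w ! k"]
      by (auto simp: enclosed_faces_def winding_eq[OF ps] faces_def)
  qed
  then show ?thesis
    unfolding path_vec_def gp_vec_def[OF w i_le]
    by (simp add: sum.reindex inj_on_def)
qed

section \<open>Every GP-path is a history\<close>

lemma count_above_end: "count_above w (length w) (insert (Suc i) {1..<i}) = end_profile n i"
proof
  fix r
  have "{a \<in> insert (Suc i) {1..<i}. r < flip n a} =
      {1..min (i - 1) (n - r)} \<union> (if r < n - i then {Suc i} else {})"
    using i by (auto simp: flip_def)
  then have "count_above w (length w) (insert (Suc i) {1..<i}) r =
      int (card ({1..min (i - 1) (n - r)} \<union> (if r < n - i then {Suc i} else {})))"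
    unfolding count_above_def end_height_flip_word[OF w] by simp
  also have "\<dots> = end_profile n i r"
    using i by (auto simp: end_profile_def top_profile_def)
  finally show "count_above w (length w) (insert (Suc i) {1..<i}) r = end_profile n i r" .
qed

lemma top_minus_end: "top_profile n i r - end_profile n i r \<le> 1"
  using i by (auto simp add: top_profile_def end_profile_def)

lemma path_lines:
  assumes "successively (rigorous_step w i) ps" "ps \<noteq> []" "snd (hd ps) \<in> {1..n}" "P \<in> set ps"
  shows "snd P \<in> {1..n}"
  using assms
proof (induction ps)
  case (Cons x ps)
  show ?case
  proof (cases ps)
    case Nil
    then show ?thesis using Cons.prems by simp
  next
    case (Cons y r)
    have "rigorous_step w i x y" using Cons.prems Cons by simp
    then have "snd y \<in> {1..n}"
      using Cons.prems(3) crossing_lines unfolding step_iff turns_at_def by (force split: if_splits)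
    then show ?thesis using Cons.IH Cons.prems Cons by auto
  qed
qed simp

text \<open>At each crossing the successor map of the path matches the entering pieces with the
  leaving ones, which gives \<open>balanced\<close>. The pieces in the first and last columns then
  fix the profiles at the two ends.\<close>

lemma path_history:
  assumes path: "rigorous_path w i ps" and ends: "hd ps = (length w, i)" "last ps = (length w, Suc i)"
  shows "map (\<lambda>c. count_above w c (lines_at n i (set ps) c)) [0..<Suc (length w)] \<in>
      histories (start_profile i) w (end_profile n i)"
    and "path_vec n w i ps =
      gp_vec i w (map (\<lambda>c. count_above w c (lines_at n i (set ps) c)) [0..<Suc (length w)])"
proof -
  let ?U = "set ps" and ?l = "length w"
  have ps: "ps \<noteq> []" "distinct ps" "successively (rigorous_step w i) ps"
    using path by (auto simp: rigorous_path_def)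
  have lines: "snd P \<in> {1..n}" if "P \<in> ?U" for P
    by (rule path_lines[OF ps(3,1) _ that]) (use ends i in simp)
  obtain f where f: "bij_betw f (?U - {(?l, Suc i)}) (?U - {(?l, i)})"
    "\<And>P. P \<in> ?U - {(?l, Suc i)} \<Longrightarrow> rigorous_step w i P (f P)"
    using path_successor[OF ps] unfolding ends by blast
  have mem: "(?l, i) \<in> ?U" "(?l, Suc i) \<in> ?U"
    using hd_in_set[OF ps(1)] last_in_set[OF ps(1)] ends by auto
  have succ: "\<exists>e. f (in_piece i j d) = out_piece i j e \<and> turns_at w i j d e \<and> out_piece i j e \<in> ?U"
    if "in_piece i j d \<in> ?U" "j < ?l" for j d
  proof -
    have "in_piece i j d \<in> ?U - {(?l, Suc i)}" using that by (auto simp: in_piece_def)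
    then have "rigorous_step w i (in_piece i j d) (f (in_piece i j d))" "f (in_piece i j d) \<in> ?U"
      using f(2) bij_betwE[OF f(1)] by auto
    then show ?thesis unfolding step_iff in_piece_inject by metis
  qed
  have pred: "\<exists>d. in_piece i j d \<in> ?U \<and> f (in_piece i j d) = out_piece i j e \<and> turns_at w i j d e"
    if "out_piece i j e \<in> ?U" "j < ?l" for j e
  proof -
    have "out_piece i j e \<in> ?U - {(?l, i)}" using that by (auto simp: out_piece_def)
    then obtain P where P: "P \<in> ?U - {(?l, Suc i)}" "f P = out_piece i j e"
      using f(1) unfolding bij_betw_def by (metis imageE)
    then have "rigorous_step w i P (out_piece i j e)" "P \<in> ?U" using f(2)[OF P(1)] by auto
    then show ?thesis using P(2) unfolding step_iff out_piece_inject by metis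
  qed
  have bal: "balanced n w i ?U"
    unfolding balanced_def Let_def
  proof (intro allI impI conjI ballI)
    fix j assume j: "j < ?l"
    let ?a = "lower_line w j" and ?b = "upper_line w j"
    show "in_piece i j d \<in> ?U \<longleftrightarrow> out_piece i j d \<in> ?U" if "d \<in> {1..n} - {?a, ?b}" for d
      using succ[OF _ j, of d] pred[OF _ j, of d] that
      by (auto simp: turns_at_def split: if_splits)
    show "card (?U \<inter> {in_piece i j ?a, in_piece i j ?b}) = card (?U \<inter> {out_piece i j ?a, out_piece i j ?b})"
    proof (rule bij_betw_same_card[of f], rule bij_betw_imageI)
      show "inj_on f (?U \<inter> {in_piece i j ?a, in_piece i j ?b})"
      proof (rule inj_on_subset)
        show "inj_on f (?U - {(?l, Suc i)})" using f(1) by (simp add: bij_betw_def)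
        show "?U \<inter> {in_piece i j ?a, in_piece i j ?b} \<subseteq> ?U - {(?l, Suc i)}"
          using j by (auto simp: in_piece_def)
      qed
      show "f ` (?U \<inter> {in_piece i j ?a, in_piece i j ?b}) = ?U \<inter> {out_piece i j ?a, out_piece i j ?b}"
      proof (intro set_eqI iffI)
        fix Q assume "Q \<in> f ` (?U \<inter> {in_piece i j ?a, in_piece i j ?b})"
        then obtain d where d: "in_piece i j d \<in> ?U" "d \<in> {?a, ?b}" "Q = f (in_piece i j d)" by blast
        obtain e where "Q = out_piece i j e" "turns_at w i j d e" "Q \<in> ?U" using succ[OF d(1) j] d(3) by auto
        then show "Q \<in> ?U \<inter> {out_piece i j ?a, out_piece i j ?b}"
          using d(2) by (auto simp: turns_at_def)
      next
        fix Q assume Q: "Q \<in> ?U \<inter> {out_piece i j ?a, out_piece i j ?b}"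
        then obtain e where e: "out_piece i j e \<in> ?U" "e \<in> {?a, ?b}" "Q = out_piece i j e" by blast
        obtain d where d: "in_piece i j d \<in> ?U" "f (in_piece i j d) = Q" "turns_at w i j d e"
          using pred[OF e(1) j] e(3) by auto
        then have "d \<in> {?a, ?b}" using e(2) by (auto simp: turns_at_def split: if_splits)
        then show "Q \<in> f ` (?U \<inter> {in_piece i j ?a, in_piece i j ?b})" using d by blast
      qed
    qed
    show "out_piece i j ?b \<in> ?U" if "?b \<le> i \<and> in_piece i j ?a \<in> ?U"
      using succ[OF _ j, of ?a] that by (auto simp: turns_at_def)
    show "out_piece i j ?a \<in> ?U" if "i < ?a \<and> in_piece i j ?b \<in> ?U"
      using succ[OF _ j, of ?b] that by (auto simp: turns_at_def)
  qed
  \<comment> \<open>A piece that runs into no crossing has no successor, so it is the last one;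
    \<open>noout\<close> is the mirror image. This keeps the path out of column 0 and restricts it
    to its two ends in the last column.\<close>
  have noin: "(c, a) = (?l, Suc i)" if "(c, a) \<in> ?U" "\<nexists>j. j < ?l \<and> (c, a) = in_piece i j a" for c a
    using f(2)[of "(c, a)"] that unfolding step_iff by (metis DiffI singletonD snd_piece(1) snd_conv)
  have noout: "(c, a) = (?l, i)" if "(c, a) \<in> ?U" "\<nexists>j. j < ?l \<and> (c, a) = out_piece i j a" for c a
  proof (rule ccontr)
    assume "(c, a) \<noteq> (?l, i)"
    then have "(c, a) \<in> f ` (?U - {(?l, Suc i)})" using that(1) f(1) by (auto simp: bij_betw_def)
    then obtain P where "P \<in> ?U - {(?l, Suc i)}" "(c, a) = f P" by blast
    then show False using f(2)[of P] that(2) unfolding step_iff by (metis snd_piece(2) snd_conv)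
  qed
  have l: "?l > 0"
  proof (rule ccontr)
    assume "\<not> ?l > 0"
    then have "(?l, i) = (?l, Suc i)" using noin[of ?l i] mem by simp
    then show False by simp
  qed
  have "(0, a) \<notin> ?U" for a
  proof
    assume a: "(0, a) \<in> ?U"
    show False
    proof (cases "a \<le> i")
      case True
      then show ?thesis using noin[OF a] l by (auto simp: in_piece_def)
    next
      case False
      then show ?thesis using noout[OF a] l by (auto simp: out_piece_def)
    qed
  qed
  then have 0: "lines_at n i ?U 0 = {1..i}" using i by (auto simp: lines_at_def)
  have "(?l, a) \<in> ?U \<longleftrightarrow> a = i \<or> a = Suc i" for a
  proof
    assume a: "(?l, a) \<in> ?U"
    show "a = i \<or> a = Suc i"
    proof (cases "a \<le> i")
      case True
      then show ?thesis using noout[OF a] by (auto simp: out_piece_def)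
    next
      case False
      then show ?thesis using noin[OF a] by (auto simp: in_piece_def)
    qed
  qed (use mem in auto)
  note mem_l = this
  have "lines_at n i ?U ?l = insert (Suc i) {1..<i}"
  proof (rule set_eqI)
    fix a
    have "a \<in> lines_at n i ?U ?l \<longleftrightarrow> 1 \<le> a \<and> a \<le> n \<and> (a \<le> i) \<noteq> (a = i \<or> a = Suc i)"
      unfolding lines_at_def mem_Collect_eq mem_l by simp
    also have "\<dots> \<longleftrightarrow> a = Suc i \<or> 1 \<le> a \<and> a < i" using i by auto
    finally show "a \<in> lines_at n i ?U ?l \<longleftrightarrow> a \<in> insert (Suc i) {1..<i}" by simp
  qed
  then have e: "count_above w ?l (lines_at n i ?U ?l) = end_profile n i"
    using count_above_end by simp
  have M0: "count_above w 0 (lines_at n i ?U 0) = start_profile i"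
    using base_profile_0[of w i] 0 by (simp add: base_profile_def)
  have step: "count_above w j (lines_at n i ?U j) \<in> hop_preds (w ! j) (count_above w (Suc j) (lines_at n i ?U (Suc j)))"
    if "j < ?l" for j
    by (rule balanced_history[OF bal 0 _ that]) (use e top_minus_end in simp)
  show h: "map (\<lambda>c. count_above w c (lines_at n i ?U c)) [0..<Suc ?l] \<in>
      histories (start_profile i) w (end_profile n i)"
    using M0 e step by (simp add: histories_def nth_append)
  show "path_vec n w i ps = gp_vec i w (map (\<lambda>c. count_above w c (lines_at n i ?U c)) [0..<Suc ?l])"
    by (rule path_vec_eq[OF lines h]) simp_all
qed

text \<open>The bounds on the deficit show that the pieces in \<open>U\<close> pass each crossing at
  most once (\<open>passage\<close>), so they have unique successors and predecessors. Following
  them from the right end of line \<open>i\<close> gives a path to that of line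
  \<open>Suc i\<close>, and the pieces it misses are balanced without ends, hence absent.\<close>

lemma history_path:
  assumes h: "h \<in> histories (start_profile i) w (end_profile n i)"
  shows "\<exists>ps. gp_path n w i ps \<and> path_vec n w i ps = gp_vec i w h"
proof -
  let ?l = "length w"
  \<comment> \<open>The lines that carry a particle in column \<open>c\<close>: the profile drops by
    one across their height.\<close>
  define S where "S c = {a \<in> {1..n}. (h ! c) (height w c a - 1) = (h ! c) (height w c a) + 1}" for c
  define U where "U = {(c, a). c \<le> ?l \<and> a \<in> {1..n} \<and> (a \<le> i) \<noteq> (a \<in> S c)}"
  have sw: "simple_word n w" using w by (simp add: flip_word_def)
  have step: "h ! j \<in> hop_preds (w ! j) (h ! Suc j)" if "j < ?l" for j
    using h that by (simp add: histories_def)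
  have hl: "h ! ?l = end_profile n i" and h0: "h ! 0 = start_profile i" using h by (auto simp: histories_def)
  have prof: "is_profile (h ! c)" if "c \<le> ?l" for c
    using that
  proof (induction c rule: inc_induct)
    case base
    then show ?case using is_profile_end[OF i] hl by simp
  next
    case (step j)
    then show ?case using is_profile_hop_preds[OF step.IH \<open>\<And>j. j < ?l \<Longrightarrow> h ! j \<in> hop_preds (w ! j) (h ! Suc j)\<close>]
        crossing_lines(4)[of j] by simp
  qed
  have zero: "(h ! c) r = 0" if "c \<le> ?l" "n \<le> r" for c r
    using that(1)
  proof (induction c rule: inc_induct)
    case base
    have "r \<noteq> n - i" using i that(2) by simp linarith
    then show ?case using that(2) by (simp add: hl end_profile_def top_profile_def)
  next
    case (step j)
    then show ?case using hop_preds_other[OF \<open>\<And>j. j < ?l \<Longrightarrow> h ! j \<in> hop_preds (w ! j) (h ! Suc j)\<close>, of j r]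
        crossing_lines(4)[of j] that(2) by simp
  qed
  have cnt: "count_above w c (S c) = h ! c" if c: "c \<le> ?l" for c
  proof
    fix r
    have top: "count_above w c (S c) r = (h ! c) r" if "n \<le> r" for r
    proof -
      have "height w c a \<le> n" if "a \<in> S c" for a
        using height_in[OF sw, of c a] that by (simp add: S_def)
      then have e: "{a \<in> S c. r < height w c a} = {}" using that by fastforce
      show ?thesis unfolding count_above_def e using zero[OF c that] by simp
    qed
    show "count_above w c (S c) r = (h ! c) r"
    proof (cases "n \<le> r")
      case False
      then have "r \<le> n" by simp
      then show ?thesis
      proof (induction r rule: inc_induct)
        case base
        then show ?case using top by simp
      next
        case (step r)
        have "word_perm (take c w) (Suc r) \<in> {1..n}"
          unfolding word_perm_take_in[OF sw] using step.hyps by simp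
        then have "word_perm (take c w) (Suc r) \<in> S c \<longleftrightarrow> (h ! c) r = (h ! c) (Suc r) + 1"
          by (simp add: S_def)
        moreover have "(h ! c) r = (h ! c) (Suc r) \<or> (h ! c) r = (h ! c) (Suc r) + 1"
          using prof[OF c] by (simp add: is_profile_def)
        ultimately show ?case
          using count_above_Suc_level[of "S c" w c r] step.IH by (auto simp: S_def)
      qed
    qed (use top in simp)
  qed
  have linesU: "lines_at n i U c = S c" if "c \<le> ?l" for c
    using that by (auto simp: lines_at_def U_def S_def)
  have Ssub: "S c \<subseteq> {1..n}" for c by (auto simp: S_def)
  have S0: "S 0 = {1..i}"
    by (rule lines_at_eqI[of _ _ 0]) (use Ssub i cnt[of 0] h0 base_profile_0[of w i] in \<open>auto simp: base_profile_def\<close>)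
  have Sl: "S ?l = insert (Suc i) {1..<i}"
    by (rule lines_at_eqI[of _ _ ?l]) (use Ssub i cnt[of ?l] hl count_above_end in auto)
  have mem: "(c, a) \<in> U \<longleftrightarrow> (a \<le> i) \<noteq> (a \<in> S c)" if "c \<le> ?l" "a \<in> {1..n}" for c a
    using that by (simp add: U_def)
  have straight: "in_piece i j d \<in> U \<longleftrightarrow> out_piece i j d \<in> U"
    if j: "j < ?l" and d: "d \<in> {1..n}" "d \<notin> {lower_line w j, upper_line w j}" for j d
  proof -
    note ht = crossing_heights(5,6)[OF j d(2)]
    have "height w j d \<in> {1..n}" using height_in[OF sw] d(1) by blast
    then have "height w j d - 1 \<noteq> w ! j" using ht(2) by auto
    then have "d \<in> S j \<longleftrightarrow> d \<in> S (Suc j)"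
      using hop_preds_other[OF step[OF j]] ht by (simp add: S_def)
    then show ?thesis using mem[of j d] mem[of "Suc j" d] j d(1)
      by (auto simp: in_piece_def out_piece_def)
  qed
  have passage: "(\<forall>d\<in>{lower_line w j, upper_line w j}. in_piece i j d \<notin> U \<and> out_piece i j d \<notin> U) \<or>
      (\<exists>x\<in>{lower_line w j, upper_line w j}. \<exists>y\<in>{lower_line w j, upper_line w j}. turns_at w i j x y \<and>
        (\<forall>d\<in>{lower_line w j, upper_line w j}. 
          (in_piece i j d \<in> U \<longleftrightarrow> d = x) \<and> (out_piece i j d \<in> U \<longleftrightarrow> d = y)))"
    if j: "j < ?l" for j
  proof -
    let ?a = "lower_line w j" and ?b = "upper_line w j" and ?s = "w ! j"
    let ?H = "h ! j" and ?H' = "h ! Suc j"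
    note ab = crossing_lines[OF j]
    note ht = crossing_heights[OF j]
    have A: "?a \<in> S j \<longleftrightarrow> ?H (?s - 1) = ?H ?s + 1" "?b \<in> S j \<longleftrightarrow> ?H ?s = ?H (Suc ?s) + 1"
      "?b \<in> S (Suc j) \<longleftrightarrow> ?H' (?s - 1) = ?H' ?s + 1" "?a \<in> S (Suc j) \<longleftrightarrow> ?H' ?s = ?H' (Suc ?s) + 1"
      using ab by (simp_all add: S_def ht)
    \<comment> \<open>Without a hop the particles keep their heights and so exchange the lines; with
      a hop the particle follows line \<open>?a\<close> upwards.\<close>
    have "?s - 1 \<noteq> ?s" using ab(4) by auto
    then have AA: "((?a \<in> S (Suc j) \<longleftrightarrow> ?b \<in> S j) \<and> (?b \<in> S (Suc j) \<longleftrightarrow> ?a \<in> S j)) \<or>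
        (?a \<in> S j \<and> ?b \<notin> S j \<and> ?a \<in> S (Suc j) \<and> ?b \<notin> S (Suc j))"
      using step[OF j] unfolding in_hop_preds_iff A by auto
    have P: "?H (?s - 1) = ?H ?s \<or> ?H (?s - 1) = ?H ?s + 1" "?H ?s = ?H (Suc ?s) \<or> ?H ?s = ?H (Suc ?s) + 1"
    proof -
      have p: "?H r = ?H (Suc r) \<or> ?H r = ?H (Suc r) + 1" for r
        using prof[of j] j by (simp add: is_profile_def)
      show "?H (?s - 1) = ?H ?s \<or> ?H (?s - 1) = ?H ?s + 1" using p[of "?s - 1"] ab(4) by simp
      show "?H ?s = ?H (Suc ?s) \<or> ?H ?s = ?H (Suc ?s) + 1" by (rule p)
    qed
    have jl: "j \<le> ?l" "Suc j \<le> ?l" using j by auto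
    note D = history_deficit[OF w i_le h jl(1)]
    note m = mem[OF jl(1) ab(2)] mem[OF jl(1) ab(3)] mem[OF jl(2) ab(2)] mem[OF jl(2) ab(3)]
    show ?thesis
    proof (cases rule: base_cases[OF w i_le j])
      case 1
      then have "?a \<le> i" "i < ?b" by (simp_all add: lower_line_def upper_line_def)
      then show ?thesis using AA ab(1)
        by (cases "?a \<in> S j"; cases "?b \<in> S j")
          (auto simp: in_piece_def out_piece_def m turns_at_def)
    next
      case 2
      then have i': "?a \<le> i" "?b \<le> i" using ab(1) by (simp_all add: lower_line_def upper_line_def)
      \<comment> \<open>Across the two heights the base profile drops by two while the deficit
        varies by at most one, so a particle remains. In the last case the base profile does not
        drop, and the same reasoning leaves room for at most one particle.\<close>
      have "?a \<in> S j \<or> ?b \<in> S j"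
        using 2(2,3) D[of "?s - 1"] D[of ?s] D[of "Suc ?s"] P unfolding A by linarith
      then show ?thesis using AA ab(1) i'
        by (cases "?a \<in> S j"; cases "?b \<in> S j")
          (auto simp: in_piece_def out_piece_def m turns_at_def)
    next
      case 3
      then have i': "\<not> ?a \<le> i" "\<not> ?b \<le> i" using ab(1) by (simp_all add: lower_line_def upper_line_def)
      have "\<not> (?a \<in> S j \<and> ?b \<in> S j)"
        using 3(2,3) D[of "?s - 1"] D[of ?s] D[of "Suc ?s"] P unfolding A by linarith
      then show ?thesis using AA ab(1) i'
        by (cases "?a \<in> S j"; cases "?b \<in> S j")
          (auto simp: in_piece_def out_piece_def m turns_at_def)
    qed
  qed
  let ?R = "rigorous_step w i"
  have fin: "finite U"
    by (rule finite_subset[of _ "{..?l} \<times> {1..n}"]) (auto simp: U_def)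
  have ends: "(?l, i) \<in> U" "(?l, Suc i) \<in> U"
    using i by (auto simp: mem Sl)
  have col0: "(0, a) \<notin> U" for a by (auto simp: U_def S0)
  have coll: "(?l, a) \<in> U \<Longrightarrow> a = i \<or> a = Suc i" for a
    by (auto simp: U_def Sl)
  have succ: "\<exists>Q\<in>U. ?R P Q" if P: "P \<in> U" "P \<noteq> (?l, Suc i)" for P
  proof -
    obtain c d where cd: "P = (c, d)" "c \<le> ?l" "d \<in> {1..n}" using P(1) by (auto simp: U_def)
    have "\<exists>j<?l. P = in_piece i j d"
    proof (cases "d \<le> i")
      case True
      have "c \<noteq> 0" using col0[of d] P(1) cd(1) by (cases c) auto
      then show ?thesis using cd True by (intro exI[of _ "c - 1"]) (auto simp: in_piece_def)
    next
      case False
      then have "c \<noteq> ?l" using coll[of d] P cd(1) by auto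
      then show ?thesis using cd False by (intro exI[of _ c]) (auto simp: in_piece_def)
    qed
    then obtain j where j: "j < ?l" "P = in_piece i j d" by blast
    show ?thesis
    proof (cases "d \<in> {lower_line w j, upper_line w j}")
      case True
      then obtain y where "y \<in> {lower_line w j, upper_line w j}" "turns_at w i j d y" "out_piece i j y \<in> U"
        using passage[OF j(1)] P(1) j(2) by metis
      then show ?thesis using j unfolding step_iff by blast
    next
      case False
      then have "out_piece i j d \<in> U" "turns_at w i j d d"
        using straight[OF j(1) cd(3)] P(1) j(2) by (auto simp: turns_at_def)
      then show ?thesis using j unfolding step_iff by blast
    qed
  qed
  have single: "d = d' \<longleftrightarrow> e = e'"
    if "j < ?l" "in_piece i j d \<in> U" "in_piece i j d' \<in> U" "out_piece i j e \<in> U" "out_piece i j e' \<in> U"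
      "turns_at w i j d e" "turns_at w i j d' e'" for j d d' e e'
    using passage[OF that(1)] that(2-7) by (auto simp: turns_at_def split: if_splits)
  have inj: "P = P'" if "P \<in> U" "P' \<in> U" "Q \<in> U" "?R P Q" "?R P' Q" for P P' Q
    using that single unfolding step_iff by (metis out_piece_inject)
  have func: "Q = Q'" if "P \<in> U" "Q \<in> U" "Q' \<in> U" "?R P Q" "?R P Q'" for P Q Q'
    using that single unfolding step_iff by (metis in_piece_inject)
  have src: "\<not> ?R P (?l, i)" for P
    unfolding step_iff by (auto simp: out_piece_def)
  have snk: "\<not> ?R (?l, Suc i) Q" for Q
    unfolding step_iff by (auto simp: in_piece_def)
  have "\<exists>ps. ps \<noteq> [] \<and> distinct ps \<and> successively ?R ps \<and> set ps \<subseteq> U \<and>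
      hd ps = (?l, i) \<and> last ps = (?l, Suc i)"
  proof (rule successor_path[OF fin ends])
    show "\<exists>Q\<in>U. ?R P Q" if "P \<in> U" "P \<noteq> (?l, Suc i)" for P using that by (rule succ)
    show "P = P'" if "P \<in> U" "P' \<in> U" "Q \<in> U" "?R P Q" "?R P' Q" for P P' Q using that by (rule inj)
    show "\<not> ?R P (?l, i)" for P by (rule src)
  qed
  then obtain ps where ps: "ps \<noteq> []" "distinct ps" "successively ?R ps" "set ps \<subseteq> U"
      "hd ps = (?l, i)" "last ps = (?l, Suc i)"
    by (elim exE conjE)
  obtain f where f: "bij_betw f (set ps - {(?l, Suc i)}) (set ps - {(?l, i)})"
    "\<And>P. P \<in> set ps - {(?l, Suc i)} \<Longrightarrow> ?R P (f P)"
    using path_successor[OF ps(1-3)] unfolding ps(5,6) by blast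
  \<comment> \<open>The path is closed under successors and predecessors in \<open>U\<close>, so its
    complement in \<open>U\<close> inherits the balance.\<close>
  have link: "P \<in> set ps \<longleftrightarrow> Q \<in> set ps" if "P \<in> U" "Q \<in> U" "?R P Q" for P Q
  proof
    assume "P \<in> set ps"
    then have P: "P \<in> set ps - {(?l, Suc i)}" using snk that(3) by blast
    have fP: "f P \<in> set ps" using P bij_betwE[OF f(1)] by blast
    then have "Q = f P" using func[OF that(1,2) _ that(3) f(2)[OF P]] ps(4) by blast
    then show "Q \<in> set ps" using fP by simp
  next
    assume "Q \<in> set ps"
    then have "Q \<in> set ps - {(?l, i)}" using src that(3) by blast
    then obtain P' where P': "P' \<in> set ps - {(?l, Suc i)}" "f P' = Q"
      using f(1) unfolding bij_betw_def by (metis imageE)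
    have "P = P'"
      by (rule inj[OF that(1) _ that(2,3)]) (use P' f(2)[OF P'(1)] ps(4) in blast)+
    then show "P \<in> set ps" using P'(1) by simp
  qed
  have stepI: "?R (in_piece i j d) (out_piece i j e)" if "j < ?l" "turns_at w i j d e" for j d e
    using that unfolding step_iff by blast
  have "balanced n w i (U - set ps)"
    unfolding balanced_def Let_def
  proof (intro allI impI)
    fix j assume j: "j < ?l"
    let ?a = "lower_line w j" and ?b = "upper_line w j" and ?V = "U - set ps"
    have ne: "?a \<noteq> ?b" using crossing_lines(1)[OF j] by simp
    have 1: "\<forall>d\<in>{1..n} - {?a, ?b}. in_piece i j d \<in> ?V \<longleftrightarrow> out_piece i j d \<in> ?V"
    proof
      fix d assume d: "d \<in> {1..n} - {?a, ?b}"
      then have "turns_at w i j d d" by (auto simp: turns_at_def)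
      then show "in_piece i j d \<in> ?V \<longleftrightarrow> out_piece i j d \<in> ?V"
        using straight[OF j, of d] link[OF _ _ stepI[OF j]] d by blast
    qed
    have "card (?V \<inter> {in_piece i j ?a, in_piece i j ?b}) = card (?V \<inter> {out_piece i j ?a, out_piece i j ?b}) \<and>
     (?b \<le> i \<and> in_piece i j ?a \<in> ?V \<longrightarrow> out_piece i j ?b \<in> ?V) \<and>
     (i < ?a \<and> in_piece i j ?b \<in> ?V \<longrightarrow> out_piece i j ?a \<in> ?V)"
      using passage[OF j]
    proof
      assume "\<forall>d\<in>{?a, ?b}. in_piece i j d \<notin> U \<and> out_piece i j d \<notin> U"
      then show ?thesis using ne by (simp add: card_Int_two)
    next
      assume "\<exists>x\<in>{?a, ?b}. \<exists>y\<in>{?a, ?b}. turns_at w i j x y \<and>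
        (\<forall>d\<in>{?a, ?b}. (in_piece i j d \<in> U \<longleftrightarrow> d = x) \<and> (out_piece i j d \<in> U \<longleftrightarrow> d = y))"
      then obtain x y where xy: "x \<in> {?a, ?b}" "y \<in> {?a, ?b}" "turns_at w i j x y"
        and mem': "\<forall>d\<in>{?a, ?b}. (in_piece i j d \<in> U \<longleftrightarrow> d = x) \<and> (out_piece i j d \<in> U \<longleftrightarrow> d = y)"
        by blast
      have 2: "in_piece i j ?a \<in> U \<longleftrightarrow> ?a = x" "in_piece i j ?b \<in> U \<longleftrightarrow> ?b = x"
        "out_piece i j ?a \<in> U \<longleftrightarrow> ?a = y" "out_piece i j ?b \<in> U \<longleftrightarrow> ?b = y"
        using mem' by simp_all
      have "in_piece i j x \<in> U" "out_piece i j y \<in> U" using mem' xy(1,2) by blast+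
      then have "in_piece i j x \<in> set ps \<longleftrightarrow> out_piece i j y \<in> set ps"
        by (rule link[OF _ _ stepI[OF j xy(3)]])
      then have 3: "in_piece i j x \<in> ?V \<longleftrightarrow> out_piece i j y \<in> ?V"
        using \<open>in_piece i j x \<in> U\<close> \<open>out_piece i j y \<in> U\<close> by blast
      from xy(1,2) consider "x = ?a" "y = ?a" | "x = ?a" "y = ?b" | "x = ?b" "y = ?a" | "x = ?b" "y = ?b"
        by blast
      moreover have ne2: "in_piece i j ?a \<noteq> in_piece i j ?b" "out_piece i j ?a \<noteq> out_piece i j ?b"
        using ne by simp_all
      ultimately show ?thesis
        unfolding card_Int_two[OF ne2(1)] card_Int_two[OF ne2(2)]
        by cases (use 2 3 ne xy(3) in \<open>simp_all add: turns_at_def\<close>)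
    qed
    then show "(\<forall>d\<in>{1..n} - {?a, ?b}. in_piece i j d \<in> ?V \<longleftrightarrow> out_piece i j d \<in> ?V) \<and>
      card (?V \<inter> {in_piece i j ?a, in_piece i j ?b}) = card (?V \<inter> {out_piece i j ?a, out_piece i j ?b}) \<and>
     (?b \<le> i \<and> in_piece i j ?a \<in> ?V \<longrightarrow> out_piece i j ?b \<in> ?V) \<and>
     (i < ?a \<and> in_piece i j ?b \<in> ?V \<longrightarrow> out_piece i j ?a \<in> ?V)" using 1 by blast
  qed
  moreover have "U - set ps \<subseteq> {..?l} \<times> {1..n}" by (auto simp: U_def)
  moreover have "(?l, a) \<notin> U - set ps" for a
    using coll[of a] hd_in_set[OF ps(1)] last_in_set[OF ps(1)] ps(5,6) by auto
  ultimately have "U - set ps = {}" using col0 by (intro no_leftover) auto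
  then have U: "set ps = U" using ps(4) by auto
  have "gp_path n w i ps"
    unfolding gp_path_def rigorous_path_def end_height_def end_height_flip_word[OF w]
    using ps(1-3,5,6) i by (intro conjI exI[of _ i] exI[of _ "Suc i"]) (auto simp: flip_def)
  moreover have "path_vec n w i ps = gp_vec i w h"
  proof (rule path_vec_eq[OF _ h])
    show "snd P \<in> {1..n}" if "P \<in> set ps" for P using that unfolding U by (auto simp: U_def)
    show "count_above w c (lines_at n i (set ps) c) = h ! c" if "c \<le> ?l" for c
      unfolding U linesU[OF that] by (rule cnt[OF that])
  qed
  ultimately show ?thesis by blast
qed

lemma gp_path_vecs:
  "path_vec n w i ` {ps. gp_path n w i ps} = gp_vec i w ` histories (start_profile i) w (end_profile n i)"
proof (intro set_eqI iffI)
  fix u assume "u \<in> path_vec n w i ` {ps. gp_path n w i ps}"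
  then obtain ps where u: "u = path_vec n w i ps" and "gp_path n w i ps" by blast
  then obtain p q where pq: "rigorous_path w i ps" "1 \<le> p" "p \<le> i" "i < q" "q \<le> n"
    "flip n p \<in> {flip n (Suc i)..flip n i}" "flip n q \<in> {flip n (Suc i)..flip n i}"
    "hd ps = (length w, p)" "last ps = (length w, q)"
    unfolding gp_path_def end_height_def end_height_flip_word[OF w] by blast
  \<comment> \<open>For the longest element line \<open>a\<close> ends at height
    \<open>n + 1 - a\<close>, so the condition on the heights admits only the ends of the lines
    \<open>i\<close> and \<open>Suc i\<close>.\<close>
  have "p = i" "q = Suc i" using pq(2-7) i by (auto simp: flip_def)
  then show "u \<in> gp_vec i w ` histories (start_profile i) w (end_profile n i)"
    unfolding u using path_history[OF pq(1)] pq(8,9) by blast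
next
  fix u assume "u \<in> gp_vec i w ` histories (start_profile i) w (end_profile n i)"
  then show "u \<in> path_vec n w i ` {ps. gp_path n w i ps}" using history_path by force
qed

end

section \<open>The two cones\<close>

lemma lookup_sum_nonneg:
  fixes g :: "'a \<Rightarrow> laurent"
  assumes "\<And>a v. a \<in> A \<Longrightarrow> Poly_Mapping.lookup (g a) v \<ge> 0"
  shows "Poly_Mapping.lookup (sum g A) v \<ge> 0"
  using assms by (induction A rule: infinite_finite_induct) (auto simp: lookup_add)

lemma keys_sum_nonneg:
  fixes g :: "'a \<Rightarrow> laurent"
  assumes "finite A" "\<And>a v. a \<in> A \<Longrightarrow> Poly_Mapping.lookup (g a) v \<ge> 0"
  shows "Poly_Mapping.keys (sum g A) = (\<Union>a\<in>A. Poly_Mapping.keys (g a))"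
  using assms
proof (induction A rule: finite_induct)
  case (insert a A)
  then show ?case by (simp add: keys_nonneg_add lookup_sum_nonneg)
qed simp

lemma keys_explicit_superpotential:
  "Poly_Mapping.keys (explicit_superpotential n w) = (\<Union>i\<in>{1..<n}.
     gp_vec i w ` histories (start_profile i) w (end_profile n i) \<union>
     level_vec w i ` {..<length (level_crossings w i)})"
  unfolding explicit_superpotential_def
  by (subst keys_sum_nonneg)
    (simp_all add: keys_nonneg_add keys_monom_sum lookup_monom_sum_nonneg lookup_add)

text \<open>The last vector of each level is redundant: it exceeds the previous one by the vector of the
  face that is unbounded to the right, and this one is the vector of the history in which the base
  lines omit only their last hop at that level.\<close>

lemma last_face_history:
  assumes w: "flip_word n w" and i: "i \<in> {1..<n}"
    and last: "level_crossings w (n - i) = js @ [j]"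
  shows "\<exists>h\<in>histories (start_profile i) w (end_profile n i). gp_vec i w h = - basis_vec (Cr j)"
proof -
  let ?B = "base_profile w i" and ?l = "length w"
  have in_lc: "k \<in> set (level_crossings w (n - i)) \<longleftrightarrow> k < ?l \<and> w ! k = n - i" for k
    by (auto simp: level_crossings_def)
  have j: "j < ?l" "w ! j = n - i" using in_lc[of j] last by auto
  have sorted: "sorted (level_crossings w (n - i))"
    unfolding level_crossings_def by (rule sorted_wrt_filter) simp
  have later: "w ! k \<noteq> n - i" if "j < k" "k < ?l" for k
    using in_lc[of k] that sorted last by (auto simp: sorted_append)
  have i': "i \<le> n" using i by simp
  have lev: "?B c (n - i) = int i" if "j < c" "c \<le> ?l" for c
    using that(2,1)
  proof (induction c rule: inc_induct)
    case base
    then show ?case using i' by (simp add: base_profile_end[OF w i'] top_profile_def)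
  next
    case (step k)
    then show ?case using base_step[OF w i', of k] later[of k] by simp
  qed
  \<comment> \<open>Once all \<open>i\<close> base lines are above level \<open>n - i\<close>, they
    fill the top \<open>i\<close> heights, so their profile is already the final one.\<close>
  have top: "?B c = top_profile n i" if c: "j < c" "c \<le> ?l" for c
  proof
    fix r
    have p: "?B c r = ?B c (Suc r) \<or> ?B c r = ?B c (Suc r) + 1" for r
      using is_profile_count_above[of "{1..i}" w c] by (simp add: is_profile_def base_profile_def)
    have "?B c (r + k) \<le> ?B c r \<and> ?B c r \<le> ?B c (r + k) + int k" for r k
    proof (induction k)
      case (Suc k)
      then show ?case using p[of "r + k"] by auto
    qed simp
    then have mono: "?B c (r + k) \<le> ?B c r" "?B c r \<le> ?B c (r + k) + int k" for r k by blast+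
    have "{a \<in> {1..i}. r < height w c a} \<subseteq> {1..i}" for r by auto
    then have le_i: "?B c r \<le> int i" for r
      unfolding base_profile_def count_above_def using card_mono[of "{1..i}" "{a \<in> {1..i}. r < height w c a}"] by simp
    have sw: "simple_word n w" using w by (simp add: flip_word_def)
    have zero: "?B c n = 0"
    proof -
      have "height w c a \<le> n" if "a \<in> {1..i}" for a
        using height_in[OF sw, of c a] that i' by simp
      then have e: "{a \<in> {1..i}. n < height w c a} = {}" by fastforce
      show ?thesis unfolding base_profile_def count_above_def e by simp
    qed
    show "?B c r = top_profile n i r"
    proof (cases "r \<le> n - i")
      case True
      then have "r + (n - i - r) = n - i" by simp
      then have "int i \<le> ?B c r" using mono(1)[of r "n - i - r"] lev[OF c] by metis
      then show ?thesis using le_i[of r] True i' by (simp add: top_profile_def)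
    next
      case False
      have 1: "int i \<le> ?B c r + int (r - (n - i))" using mono(2)[of "n - i" "r - (n - i)"] lev[OF c] False by simp
      show ?thesis
      proof (cases "r \<le> n")
        case True
        then have "?B c r \<le> int (n - r)" using mono(2)[of r "n - r"] zero by simp
        then show ?thesis using 1 False True i' by (simp add: top_profile_def of_nat_diff)
      next
        case F: False
        then have "?B c r \<le> 0" using mono(1)[of n "r - n"] zero by simp
        moreover have "0 \<le> ?B c r" by (simp add: base_profile_def count_above_def)
        ultimately show ?thesis using F by (simp add: top_profile_def)
      qed
    qed
  qed
  define h where "h c = (if c \<le> j then ?B c else end_profile n i)" for c
  have step: "h k \<in> hop_preds (w ! k) (h (Suc k))" if k: "k < ?l" for k
  proof -
    consider "k < j" | "k = j" | "j < k" by linarith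
    then show ?thesis
    proof cases
      case 1
      then show ?thesis using base_in_hop_preds[OF w i' k] by (simp add: h_def)
    next
      case 2
      \<comment> \<open>The base lines must hop at this crossing: otherwise they would already have
        the final profile before it, which contradicts the occupation required in the other two
        cases.\<close>
      have "?B j = end_profile n i"
      proof (cases rule: base_cases[OF w i' j(1)])
        case 1
        have e: "top_profile n i = (?B j)(n - i := ?B j (n - i) + 1)"
          using 1(5) top[of "Suc j"] j by simp
        have "?B j (n - i) = int i - 1"
          using fun_cong[OF e, of "n - i"] i' by (simp add: top_profile_def)
        then have "?B j r = end_profile n i r" for r
          using fun_cong[OF e, of r] by (cases "r = n - i") (simp_all add: end_profile_def)
        then show ?thesis by (rule ext)
      next
        case 2
        then have e: "?B j = top_profile n i" using top[of "Suc j"] j(1) by simp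
        have "n - (n - i - 1) = Suc i" using i by auto
        then have "top_profile n i (n - i - 1) = int i" "top_profile n i (n - i) = int i"
          using i by (simp_all add: top_profile_def)
        then show ?thesis using 2(2) unfolding e j(2) by simp
      next
        case 3
        then have e: "?B j = top_profile n i" using top[of "Suc j"] j(1) by simp
        have "n - Suc (n - i) = i - 1" using i by auto
        then have "top_profile n i (Suc (n - i)) = int (i - 1)" "top_profile n i (n - i) = int i"
          using i by (simp_all add: top_profile_def)
        moreover have "i - 1 < i" using i by simp
        ultimately have False using 3(3) unfolding e j(2) by linarith
        then show ?thesis ..
      qed
      then show ?thesis using 2 by (simp add: h_def in_hop_preds_iff)
    next
      case 3
      then show ?thesis by (simp add: h_def in_hop_preds_iff)
    qed
  qed
  let ?h = "map h [0..<Suc ?l]"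
  have mem: "?h \<in> histories (start_profile i) w (end_profile n i)"
    using step j base_profile_0[of w i]
    by (auto simp: histories_def h_def simp del: upt_Suc)
  have "{c. c < ?l \<and> (?h ! Suc c) (w ! c) < ?B (Suc c) (w ! c)} = {j}"
  proof (intro set_eqI iffI)
    fix c assume c: "c \<in> {c. c < ?l \<and> (?h ! Suc c) (w ! c) < ?B (Suc c) (w ! c)}"
    then have "j \<le> c" by (auto simp: h_def simp del: upt_Suc split: if_splits)
    moreover have "w ! c = n - i"
      using c \<open>j \<le> c\<close> top[of "Suc c"] by (auto simp: h_def end_profile_def simp del: upt_Suc split: if_splits)
    ultimately show "c \<in> {j}" using later[of c] c by fastforce
  next
    fix c assume "c \<in> {j}"
    then show "c \<in> {c. c < ?l \<and> (?h ! Suc c) (w ! c) < ?B (Suc c) (w ! c)}"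
      using j top[of "Suc j"] i' by (auto simp: h_def end_profile_def top_profile_def simp del: upt_Suc)
  qed
  then have "gp_vec i w ?h = - basis_vec (Cr j)" unfolding gp_vec_def[OF w i'] by simp
  then show ?thesis using mem by blast
qed

text \<open>No base line starts above level \<open>i\<close>, but \<open>min i (n - i)\<close> of
  them end above it, which takes a crossing of this level.\<close>

lemma level_crossings_nonempty:
  assumes w: "flip_word n w" and i: "i \<in> {1..<n}"
  shows "level_crossings w i \<noteq> []"
proof
  assume "level_crossings w i = []"
  then have ne: "w ! k \<noteq> i" if "k < length w" for k
    using that by (auto simp: level_crossings_def filter_empty_conv)
  have i': "i \<le> n" using i by simp
  have "base_profile w i c i = 0" if "c \<le> length w" for c
    using that
  proof (induction c)
    case (Suc c)
    then show ?case using base_step[OF w i', of c] ne[of c] by simp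
  qed (simp add: base_profile_0 start_profile_def)
  then have "top_profile n i i = 0" using base_profile_end[OF w i'] by fastforce
  then show False using i by (simp add: top_profile_def min_def split: if_splits)
qed

theorem theorem6:
  fixes n :: nat and w\<^sub>0 :: "nat \<Rightarrow> nat" and w :: "nat list"
  assumes "longest_element n w\<^sub>0"
    and "reduced_expression n w\<^sub>0 w"
  shows "weighted_area_cone n w = superpotential_cone n w"
proof -
  have w: "flip_word n w" using assms by (rule flip_word_of_reduced_expression)
  have gp: "(\<forall>i ps. gp_path n w i ps \<longrightarrow> pairing (path_vec n w i ps) x \<ge> 0) \<longleftrightarrow>
      (\<forall>i\<in>{1..<n}. \<forall>u\<in>gp_vec i w ` histories (start_profile i) w (end_profile n i). pairing u x \<ge> 0)" for x
  proof -
    have "(\<forall>i ps. gp_path n w i ps \<longrightarrow> pairing (path_vec n w i ps) x \<ge> 0) \<longleftrightarrow>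
        (\<forall>i\<in>{1..<n}. \<forall>u\<in>path_vec n w i ` {ps. gp_path n w i ps}. pairing u x \<ge> 0)"
      by (auto simp: gp_path_def)
    then show ?thesis using gp_path_vecs[OF w] by simp
  qed
  have level: "pairing (level_vec w i k) x \<ge> 0"
    if gp: "\<forall>i\<in>{1..<n}. \<forall>u\<in>gp_vec i w ` histories (start_profile i) w (end_profile n i). pairing u x \<ge> 0"
      and lt: "\<forall>i\<in>{1..<n}. \<forall>k<length (level_crossings w i). pairing (level_vec w i k) x \<ge> 0"
      and i: "i \<in> {1..<n}" and k: "k \<le> length (level_crossings w i)" for x i k
  proof (cases "k < length (level_crossings w i)")
    case True
    then show ?thesis using lt i by blast
  next
    case False
    obtain js j where js: "level_crossings w i = js @ [j]"
      using level_crossings_nonempty[OF w i] by (metis rev_exhaust)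
    \<comment> \<open>The orientation is the one for \<open>n - i\<close>, because the right ends of
      the lines \<open>n - i\<close> and \<open>n - i + 1\<close> are at the heights
      \<open>i + 1\<close> and \<open>i\<close>, on the two sides of level \<open>i\<close>.\<close>
    have "n - i \<in> {1..<n}" "n - (n - i) = i" using i by auto
    then obtain h where "h \<in> histories (start_profile (n - i)) w (end_profile n (n - i))"
      "gp_vec (n - i) w h = - basis_vec (Cr j)"
      using last_face_history[OF w, of "n - i" js j] js by auto
    then have "pairing (- basis_vec (Cr j)) x \<ge> 0" using gp \<open>n - i \<in> {1..<n}\<close> by (metis imageI)
    moreover have "pairing (level_vec w i (length js)) x \<ge> 0" using lt i js by simp
    moreover have "level_vec w i k = level_vec w i (length js) + - basis_vec (Cr j)"
      using False k js by (simp add: level_vec_def)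
    ultimately show ?thesis by (simp only: pairing_add)
  qed
  have "x \<in> weighted_area_cone n w \<longleftrightarrow> x \<in> superpotential_cone n w" for x
  proof -
    have "x \<in> weighted_area_cone n w \<longleftrightarrow> x \<in> face_space n w \<and>
        (\<forall>i\<in>{1..<n}. \<forall>u\<in>gp_vec i w ` histories (start_profile i) w (end_profile n i). pairing u x \<ge> 0) \<and>
        (\<forall>i\<in>{1..<n}. \<forall>k<length (level_crossings w i). pairing (level_vec w i k) x \<ge> 0)"
      unfolding weighted_area_cone_def mem_Collect_eq gp using level by (meson less_imp_le)
    also have "\<dots> \<longleftrightarrow> x \<in> superpotential_cone n w"
      unfolding superpotential_cone_def superpotential_explicit[OF w] mem_Collect_eq trop_nonneg_iff
        keys_explicit_superpotential by (auto simp: ball_Un)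
    finally show ?thesis .
  qed
  then show ?thesis by blast
qed

end
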